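(* Let $z_0\in V$ and $s>0$. Under $\mathbb{P}_{z_0}\otimes P^{G,U}$ set $$\Phi_x=\sqrt{2\ell_x(H_{x_0})+(\varphi_x+s)^2},\qquad x\in V.$$ Then, under $\mathbb{P}_{z_0}\otimes P^{G,U}$, the conditional law of $\varphi+s=(\varphi_x+s)_{x\in V}$ given $\Phi=(\Phi_x)_{x\in V}$ is the law of $$\sigma\check L(\check H_{x_0})=(\sigma_x\check L_x(\check H_{x_0}))_{x\in V},$$ where $\check L(\check H_{x_0})$ is distributed under $\mathbb{P}^{\check Y}_{\Phi,z_0}$, $\check H_{x_0}$ being the first hitting time of $x_0$ by $\check Y$, and, conditionally on $\check L(\check H_{x_0})$, $\sigma$ is distributed according to the Ising model on $G$ with interaction $J_{i,j}(\check H_{x_0})=W_{i,j}\check L_i(\check H_{x_0})\check L_j(\check H_{x_0})$ and boundary condition $\sigma_{x_0}=+1$.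
   Context: Graph. $G=(V,E)$ is a finite connected undirected graph without loops, with positive conductances $(W_e)_{e\in E}$; $W_{x,y}=W_{\{x,y\}}$ if $\{x,y\}\in E$ and $W_{x,y}=0$ otherwise. A vertex $x_0\in V$ is fixed and $U=V\setminus\{x_0\}$. Gaussian free field. $\mathcal{E}(f,f)=\frac12\sum_{x,y\in V}W_{x,y}(f(x)-f(y))^2$ for $f\in\mathbb{R}^V$. $P^{G,U}$ is the law of the centered Gaussian field $\varphi=(\varphi_x)_{x\in V}$ with $\varphi_{x_0}=0$ and density on $\mathbb{R}^U$ proportional to $\exp(-\frac12\mathcal{E}(\varphi,\varphi))\prod_{x\in U}d\varphi_x$. Markov jump process. Under $\mathbb{P}_{z_0}$, $(X_t)_{t\ge0}$ is the right-continuous continuous-time Markov jump process on $V$ started at $z_0$ with jump rate $W_{i,j}$ from $i$ to $j$; $\ell_x(t)=\int_0^t 1_{\{X_r=x\}}\,dr$ and $H_{x_0}=\inf\{t\ge0:X_t=x_0\}$. Under $\mathbb{P}_{z_0}\otimes P^{G,U}$, $X$ and $\varphi$ are independent. Ising model. The Ising model on $G$ with interaction $(J_{i,j})_{\{i,j\}\in E}$ and boundary condition $\sigma_{x_0}=+1$ is the probability on $\{\sigma\in\{-1,+1\}^V:\sigma_{x_0}=+1\}$ giving $\sigma$ a weight proportional to $\exp(\sum_{\{i,j\}\in E}J_{i,j}\sigma_i\sigma_j)$. The process $\check Y$. Let $\Phi=(\Phi_x)_{x\in V}$ be positive reals. $\mathbb{P}^{\check Y}_{\Phi,z}$ is the law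 of the continuous-time $V$-valued jump process $(\check Y_r)_{r\ge 0}$ with $\check Y_0=z$ defined as follows. Put $\check L_i(r)=\Phi_i-\int_0^r 1_{\{\check Y_v=i\}}\,dv$, and let $\langle\cdot\rangle_r$ denote the expectation of the Ising model on $G$ with interaction $J_{i,j}(r)=W_{i,j}\check L_i(r)\check L_j(r)$ and boundary condition $\sigma_{x_0}=+1$. Conditionally on the past at time $r$, if $\check Y_r=i$, the process jumps from $i$ to $j$ at rate $W_{i,j}\check L_j(r)\,\langle\sigma_j\rangle_r/\langle\sigma_i\rangle_r$. It is stopped at time $S=\sup\{r\ge0:\check L_i(r)>0\text{ for all }i\in V\}$; one has $\langle\sigma_x\rangle_r>0$ for all $x\in V$ and $r<S$, so the process is defined up to time $S$. Almost surely $\check H_{x_0}\le S$. *)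

theory Defs
  imports "HOL-Probability.Probability"
begin

text \<open>The vertex set is the whole finite type; an edge is a two-element set of vertices.\<close>

definition weighted_graph :: "'v::finite set set \<Rightarrow> ('v set \<Rightarrow> real) \<Rightarrow> bool" where
  "weighted_graph E W \<longleftrightarrow>
     (\<forall>e\<in>E. card e = 2) \<and> (\<forall>e\<in>E. 0 < W e) \<and> (\<forall>x y. (x, y) \<in> {(a, b). {a, b} \<in> E}\<^sup>*)"

definition conductance :: "'v set set \<Rightarrow> ('v set \<Rightarrow> real) \<Rightarrow> 'v \<Rightarrow> 'v \<Rightarrow> real" where
  "conductance E W x y = (if {x, y} \<in> E then W {x, y} else 0)"

abbreviation field_space :: "('v \<Rightarrow> real) measure" where
  "field_space \<equiv> Pi\<^sub>M UNIV (\<lambda>_. borel)"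

definition dirichlet_energy ::
    "'v::finite set set \<Rightarrow> ('v set \<Rightarrow> real) \<Rightarrow> ('v \<Rightarrow> real) \<Rightarrow> real" where
  "dirichlet_energy E W f = (\<Sum>x\<in>UNIV. \<Sum>y\<in>UNIV. conductance E W x y * (f x - f y)\<^sup>2) / 2"

text \<open>The density lives on the functions on \<open>- {x0}\<close>; \<open>f(x0 := 0)\<close> extends such a function by
  \<open>0\<close> at \<open>x0\<close>.\<close>

definition gff :: "'v::finite set set \<Rightarrow> ('v set \<Rightarrow> real) \<Rightarrow> 'v \<Rightarrow> ('v \<Rightarrow> real) measure" where
  "gff E W x0 =
     (let \<mu> = Pi\<^sub>M (- {x0}) (\<lambda>_. lborel);
          g = (\<lambda>f. exp (- dirichlet_energy E W (f(x0 := 0)) / 2))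
      in distr (density \<mu> (\<lambda>f. ennreal (g f / (\<integral>f. g f \<partial>\<mu>)))) field_space (\<lambda>f. f(x0 := 0)))"

definition spins :: "'v \<Rightarrow> ('v \<Rightarrow> real) set" where
  "spins x0 = {\<sigma>. (\<forall>x. \<sigma> x \<in> {-1, 1}) \<and> \<sigma> x0 = 1}"

text \<open>\<open>J\<close> is symmetric in all uses, so half the sum over ordered pairs is the sum over edges.\<close>

definition ising_weight ::
    "'v::finite set set \<Rightarrow> ('v \<Rightarrow> 'v \<Rightarrow> real) \<Rightarrow> ('v \<Rightarrow> real) \<Rightarrow> real" where
  "ising_weight E J \<sigma> = exp ((\<Sum>(i, j)\<in>{(i, j). {i, j} \<in> E}. J i j * \<sigma> i * \<sigma> j) / 2)"

definition ising ::
    "'v::finite set set \<Rightarrow> ('v \<Rightarrow> 'v \<Rightarrow> real) \<Rightarrow> 'v \<Rightarrow> ('v \<Rightarrow> real) measure" where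
  "ising E J x0 =
     point_measure (spins x0)
       (\<lambda>\<sigma>. ennreal (ising_weight E J \<sigma> / (\<Sum>\<tau>\<in>spins x0. ising_weight E J \<tau>)))"

definition interaction ::
    "'v set set \<Rightarrow> ('v set \<Rightarrow> real) \<Rightarrow> ('v \<Rightarrow> real) \<Rightarrow> 'v \<Rightarrow> 'v \<Rightarrow> real" where
  "interaction E W L i j = conductance E W i j * L i * L j"

definition magnetization ::
    "'v::finite set set \<Rightarrow> ('v set \<Rightarrow> real) \<Rightarrow> 'v \<Rightarrow> ('v \<Rightarrow> real) \<Rightarrow> 'v \<Rightarrow> real" where
  "magnetization E W x0 L i = (\<integral>\<sigma>. \<sigma> i \<partial>ising E (interaction E W L) x0)"

text \<open>Paths are functions of real time, of which only the values at times \<open>\<ge> 0\<close> are used.\<close>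

definition local_time :: "(real \<Rightarrow> 'v) \<Rightarrow> real \<Rightarrow> 'v \<Rightarrow> real" where
  "local_time y t x = (\<integral>r\<in>{0..t}. indicator {x} (y r) \<partial>lborel)"

definition hitting_time :: "(real \<Rightarrow> 'v) \<Rightarrow> 'v \<Rightarrow> real" where
  "hitting_time y x = Inf {t. 0 \<le> t \<and> y t = x}"

text \<open>The infimum over the empty set is \<open>\<infinity>\<close>: this is the value of \<open>jump_time y n\<close> when there are
  fewer than \<open>n\<close> jumps.\<close>

primrec jump_time :: "(real \<Rightarrow> 'v) \<Rightarrow> nat \<Rightarrow> ereal" where
  "jump_time y 0 = 0"
| "jump_time y (Suc n) =
     (INF t\<in>{t. jump_time y n < ereal t \<and> y t \<noteq> y (real_of_ereal (jump_time y n))}. ereal t)"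

definition jump_state :: "(real \<Rightarrow> 'v) \<Rightarrow> nat \<Rightarrow> 'v" where
  "jump_state y n = y (real_of_ereal (jump_time y n))"

text \<open>The \<open>\<sigma>\<close>-algebra of the past up to the \<open>n\<close>-th jump time.\<close>

definition past :: "'a measure \<Rightarrow> (real \<Rightarrow> 'a \<Rightarrow> 'v) \<Rightarrow> nat \<Rightarrow> 'a measure" where
  "past M Y n =
     vimage_algebra (space M)
       (\<lambda>\<omega>. \<lambda>k\<in>{..n}. (jump_time (\<lambda>t. Y t \<omega>) k, jump_state (\<lambda>t. Y t \<omega>) k))
       (Pi\<^sub>M {..n} (\<lambda>_. borel \<Otimes>\<^sub>M count_space UNIV))"

text \<open>\<open>\<rho> l i j\<close> is the rate of a jump from \<open>i\<close> to \<open>j\<close> when the current local times are \<open>l\<close>.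
  If the process sits at \<open>i\<close> with local times \<open>l\<close>, then \<open>u\<close> time units later, without any jump in
  between, the local times are \<open>l(i := l i + u)\<close>. Hence the density below of the event that the
  next jump happens after a holding time \<open>u\<close> and leads to \<open>j\<close>. The density may have total mass
  less than \<open>1\<close>; the missing mass is the probability that no further jump happens.\<close>

definition jump_density ::
    "(('v::finite \<Rightarrow> real) \<Rightarrow> 'v \<Rightarrow> 'v \<Rightarrow> real) \<Rightarrow> ('v \<Rightarrow> real) \<Rightarrow> 'v \<Rightarrow> 'v \<Rightarrow> real \<Rightarrow> real" where
  "jump_density \<rho> l i j u =
     \<rho> (l(i := l i + u)) i j *
     exp (- (\<integral>v\<in>{0..u}. (\<Sum>k\<in>UNIV. \<rho> (l(i := l i + v)) i k) \<partial>lborel))"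

definition jump_process ::
    "'a measure \<Rightarrow> (('v::finite \<Rightarrow> real) \<Rightarrow> 'v \<Rightarrow> 'v \<Rightarrow> real) \<Rightarrow> 'v \<Rightarrow> (real \<Rightarrow> 'a \<Rightarrow> 'v) \<Rightarrow> bool"
where
  "jump_process M \<rho> z Y \<longleftrightarrow>
     prob_space M \<and>
     (\<forall>t\<ge>0. Y t \<in> M \<rightarrow>\<^sub>M count_space UNIV) \<and>
     (\<forall>\<omega>\<in>space M. \<forall>t\<ge>0. \<forall>\<^sub>F u in at_right t. Y u \<omega> = Y t \<omega>) \<and>
     (AE \<omega> in M. Y 0 \<omega> = z) \<and>
     (\<forall>n. \<forall>A\<in>sets (past M Y n). \<forall>B\<in>sets borel. \<forall>j.
        emeasure M {\<omega>\<in>A. let y = (\<lambda>t. Y t \<omega>) in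
            jump_time y (Suc n) - jump_time y n \<in> ereal ` B \<and> jump_state y (Suc n) = j} =
        (\<integral>\<^sup>+\<omega>\<in>{\<omega>\<in>A. jump_time (\<lambda>t. Y t \<omega>) n < \<infinity>}.
           (let y = (\<lambda>t. Y t \<omega>) in
            \<integral>\<^sup>+u\<in>B \<inter> {0<..}. ennreal (jump_density \<rho>
               (local_time y (real_of_ereal (jump_time y n))) (jump_state y n) j u) \<partial>lborel) \<partial>M))"

definition markov_jump_process ::
    "'a measure \<Rightarrow> 'v::finite set set \<Rightarrow> ('v set \<Rightarrow> real) \<Rightarrow> 'v \<Rightarrow> (real \<Rightarrow> 'a \<Rightarrow> 'v) \<Rightarrow> bool" where
  "markov_jump_process M E W z X \<longleftrightarrow> jump_process M (\<lambda>_. conductance E W) z X"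

text \<open>The coordinates of \<open>L = \<Phi> - l\<close> are nonincreasing in time, so all of them are positive exactly
  before the time \<open>S\<close>, the supremum of the times at which they are all positive. Setting the rates
  to \<open>0\<close> from then on stops the process at \<open>S\<close>. The total rate may fail to be integrable up to \<open>S\<close>,
  in which case the integral in \<open>jump_density\<close> is \<open>0\<close> by convention; this is harmless, since the
  factor in front of the exponential is \<open>0\<close> there.\<close>

definition check_rate ::
    "'v::finite set set \<Rightarrow> ('v set \<Rightarrow> real) \<Rightarrow> 'v \<Rightarrow> ('v \<Rightarrow> real) \<Rightarrow> ('v \<Rightarrow> real) \<Rightarrow> 'v \<Rightarrow> 'v \<Rightarrow> real"
where
  "check_rate E W x0 \<Phi> l i j =
     (let L = (\<lambda>x. \<Phi> x - l x) in
      if \<forall>x. 0 < L x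
      then conductance E W i j * L j * magnetization E W x0 L j / magnetization E W x0 L i
      else 0)"

definition check_process ::
    "'a measure \<Rightarrow> 'v::finite set set \<Rightarrow> ('v set \<Rightarrow> real) \<Rightarrow> 'v \<Rightarrow> ('v \<Rightarrow> real) \<Rightarrow> 'v \<Rightarrow>
     (real \<Rightarrow> 'a \<Rightarrow> 'v) \<Rightarrow> bool" where
  "check_process N E W x0 \<Phi> z Y \<longleftrightarrow> jump_process N (check_rate E W x0 \<Phi>) z Y"

definition check_L :: "('v \<Rightarrow> real) \<Rightarrow> (real \<Rightarrow> 'v) \<Rightarrow> real \<Rightarrow> 'v \<Rightarrow> real" where
  "check_L \<Phi> y r x = \<Phi> x - local_time y r x"

text \<open>The second argument of the bind is the conditional law of \<open>\<sigma> L\<close> given \<open>L\<close>. The hitting time is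
  almost surely the infimum of a nonempty set.\<close>

definition signed_check_L_law ::
    "'v::finite set set \<Rightarrow> ('v set \<Rightarrow> real) \<Rightarrow> 'v \<Rightarrow> ('v \<Rightarrow> real) \<Rightarrow> 'a measure \<Rightarrow>
     (real \<Rightarrow> 'a \<Rightarrow> 'v) \<Rightarrow> ('v \<Rightarrow> real) measure" where
  "signed_check_L_law E W x0 \<Phi> N Y =
     distr N field_space
       (\<lambda>\<omega>. let y = (\<lambda>t. Y t \<omega>) in check_L \<Phi> y (hitting_time y x0))
     \<bind> (\<lambda>L. distr (ising E (interaction E W L) x0) field_space (\<lambda>\<sigma> x. \<sigma> x * L x))"

text \<open>\<open>K\<close> is a regular conditional law of \<open>\<psi>\<close> given \<open>\<Phi>\<close>, where \<open>\<Phi>\<close> lies almost surely in the set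
  \<open>D\<close> on which \<open>K\<close> is meaningful.\<close>

definition conditional_law_given ::
    "'a measure \<Rightarrow> 'b measure \<Rightarrow> ('a \<Rightarrow> 'b) \<Rightarrow> 'c measure \<Rightarrow> ('a \<Rightarrow> 'c) \<Rightarrow> 'c set \<Rightarrow>
     ('c \<Rightarrow> 'b measure) \<Rightarrow> bool" where
  "conditional_law_given P S \<psi> T \<Phi> D K \<longleftrightarrow>
     \<psi> \<in> P \<rightarrow>\<^sub>M S \<and> \<Phi> \<in> P \<rightarrow>\<^sub>M T \<and> (AE \<omega> in P. \<Phi> \<omega> \<in> D) \<and>
     K \<in> restrict_space T D \<rightarrow>\<^sub>M prob_algebra S \<and>
     (\<forall>A\<in>sets S. AE \<omega> in P.
        real_cond_exp P (vimage_algebra (space P) \<Phi> T) (indicator (\<psi> -` A \<inter> space P)) \<omega> =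
        measure (K (\<Phi> \<omega>)) A)"

definition ray_knight_field ::
    "(real \<Rightarrow> 'a \<Rightarrow> 'v) \<Rightarrow> 'v \<Rightarrow> real \<Rightarrow> 'a \<times> ('v \<Rightarrow> real) \<Rightarrow> 'v \<Rightarrow> real" where
  "ray_knight_field X x0 s = (\<lambda>(\<omega>, \<phi>) x. let y = (\<lambda>t. X t \<omega>) in
     sqrt (2 * local_time y (hitting_time y x0) x + (\<phi> x + s)\<^sup>2))"

end

theory Submission
  imports Defs
begin

text \<open>Put \<open>\<psi> = \<phi> + s\<close>, write \<open>c i j\<close> for the conductances and \<open>w i = (\<Sum>j\<in>UNIV. c i j)\<close>. The energy of
  \<open>\<psi>\<close> is \<open>\<Sum>x. w x * (\<psi> x)\<^sup>2\<close> minus the interaction \<open>\<Sum>x y. c x y * \<psi> x * \<psi> y\<close>. The first part depends only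
  on \<open>L = \<bar>\<psi>\<bar>\<close>, and the second one is an Ising energy in the signs: given \<open>L\<close>, the signs of \<open>\<psi>\<close> form the
  Ising model with couplings \<open>c x y * L x * L y\<close>. So the task is to find the law of \<open>L\<close> given \<open>\<Phi>\<close>.

  Up to the first visit of \<open>x0\<close>, each of the two processes is described by its jumps, and the
  expectation of a function of the local times is a sum over the number of jumps of iterated integrals
  over the holding times (\<open>nn_integral_local_time_hitting\<close>). For the walk, a visit of \<open>i\<close> of length \<open>u\<close>
  raises the field at \<open>i\<close> from \<open>L i\<close> to \<open>sqrt ((L i)\<^sup>2 + 2 * u)\<close> with weight \<open>exp (- w i * u)\<close>; these
  integrals are the operators \<open>raise\<close>. For the reversed process, a visit of \<open>i\<close> lowers the field at
  \<open>i\<close>; these integrals are the operators \<open>lower\<close>. The substitution \<open>t = sqrt (v\<^sup>2 + 2 * u)\<close>, for which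
  \<open>t dt = du\<close>, shows that \<open>raise i\<close> and \<open>lower i\<close> are adjoint with respect to the Gaussian weight
  \<open>exp (- (\<Sum>x. w x * (L x)\<^sup>2) / 2)\<close> (\<open>raise_adjoint\<close>). An adjoint of a product reverses the order of
  its factors, but the operators \<open>lower\<close> commute, so the walk along a path is dual to the descent along
  the same path (\<open>descent_ascent_duality\<close>).

  It remains to recognise the descent as the reversed process. The unnormalised magnetizations
  \<open>h i = (\<Sum>\<sigma>. \<sigma> i * gibbs (\<sigma> L))\<close> satisfy \<open>\<partial>h i / \<partial>L i = (\<Sum>j. c i j * L j * h j)\<close>. Hence the total jump rate
  at \<open>i\<close> is minus the logarithmic derivative of \<open>h i\<close> along the holding time, the survival probability is a
  quotient of two values of \<open>h i\<close>, and along a path all the values of \<open>h\<close> cancel except the first one and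
  the last one (\<open>hit_expect_check\<close>). Since \<open>h i = 0\<close> for \<open>L i = 0\<close> and \<open>i \<noteq> x0\<close>, the same equation in
  integrated form determines \<open>h\<close> from \<open>h x0\<close>; the uniqueness statement behind this
  (\<open>subsolution_eq_0\<close>) yields both the positivity of \<open>h\<close> and that the reversed process reaches \<open>x0\<close>
  almost surely (\<open>spin_mass_le_descent\<close>).

  Together, the joint law of \<open>\<psi>\<close> and \<open>\<Phi>\<close> is expressed through sums of descents (\<open>joint_law\<close>), and the
  law proposed for \<open>\<psi>\<close> given \<open>\<Phi>\<close> is the quotient of such a sum by its total mass
  (\<open>signed_check_L_law_emeasure\<close>).\<close>

section \<open>Right-continuous paths\<close>

definition right_continuous_path :: "(real \<Rightarrow> 'v) \<Rightarrow> bool" where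
  "right_continuous_path y \<longleftrightarrow> (\<forall>t\<ge>0. \<forall>\<^sub>F u in at_right t. y u = y t)"

lemma right_continuous_pathD:
  assumes "right_continuous_path y" "0 \<le> t"
  obtains e where "t < e" "\<And>u. t \<le> u \<Longrightarrow> u < e \<Longrightarrow> y u = y t"
proof -
  from assms have "\<forall>\<^sub>F u in at_right t. y u = y t"
    by (auto simp: right_continuous_path_def)
  then obtain b where "t < b" and b: "\<forall>u>t. u < b \<longrightarrow> y u = y t"
    unfolding eventually_at_right_field by auto
  show ?thesis
  proof (rule that[OF \<open>t < b\<close>])
    fix u assume "t \<le> u" "u < b"
    then show "y u = y t" using b by (cases "u = t") auto
  qed
qed

lemma jump_time_nonneg: "0 \<le> jump_time y n"
proof (induction n)
  case (Suc n)
  show ?case unfolding jump_time.simps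
    by (rule INF_greatest) (use Suc in \<open>auto dest: order.strict_trans1 simp flip: ereal_less_eq(5)\<close>)
qed simp

lemma jump_time_mono: "jump_time y n \<le> jump_time y (Suc n)"
  by (auto intro!: INF_greatest)

declare jump_time.simps(2) [simp del]

lemma jump_time_finite_cases:
  assumes "jump_time y n < \<infinity>"
  obtains t where "0 \<le> t" "jump_time y n = ereal t"
  using assms jump_time_nonneg[of y n] by (cases "jump_time y n") auto

lemma jump_time_antimono_finite: "jump_time y (Suc n) < \<infinity> \<Longrightarrow> jump_time y n < \<infinity>"
  using jump_time_mono[of y n] by (rule le_less_trans)

lemma path_until_jump:
  assumes "jump_time y n = ereal t" "t \<le> u" "ereal u < jump_time y (Suc n)"
  shows "y u = jump_state y n"
proof (rule ccontr)
  assume *: "y u \<noteq> jump_state y n"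
  then have "u \<noteq> t" using assms by (auto simp: jump_state_def)
  then have "t < u" using assms by simp
  then have "jump_time y (Suc n) \<le> ereal u"
    unfolding jump_time.simps using * assms(1)
    by (intro INF_lower) (auto simp: jump_state_def)
  then show False using assms by simp
qed

lemma jump_time_strict:
  assumes "right_continuous_path y" "jump_time y n < \<infinity>"
  shows "jump_time y n < jump_time y (Suc n)"
proof -
  obtain t where t: "0 \<le> t" "jump_time y n = ereal t"
    using assms(2) by (rule jump_time_finite_cases)
  obtain e where e: "t < e" "\<And>u. t \<le> u \<Longrightarrow> u < e \<Longrightarrow> y u = y t"
    using right_continuous_pathD[OF assms(1) t(1)] by metis
  have "ereal e \<le> jump_time y (Suc n)"
    unfolding jump_time.simps
  proof (rule INF_greatest)
    fix u assume "u \<in> {u. jump_time y n < ereal u \<and> y u \<noteq> y (real_of_ereal (jump_time y n))}"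
    then have "t \<le> u" "y u \<noteq> y t" using t by auto
    then show "ereal e \<le> ereal u" using e(2)[of u] by (meson ereal_less_eq(3) not_less)
  qed
  with e(1) t(2) show ?thesis by (metis less_ereal.simps(1) less_le_trans)
qed

text \<open>The local times at the \<open>n\<close>-th jump, as a function of the first \<open>n\<close> jumps only.\<close>

primrec elapsed :: "(real \<Rightarrow> 'v) \<Rightarrow> nat \<Rightarrow> 'v \<Rightarrow> real" where
  "elapsed y 0 = (\<lambda>_. 0)"
| "elapsed y (Suc n) = (elapsed y n)(jump_state y n :=
     elapsed y n (jump_state y n) + real_of_ereal (jump_time y (Suc n) - jump_time y n))"

definition first_hit :: "(real \<Rightarrow> 'v) \<Rightarrow> 'v \<Rightarrow> nat \<Rightarrow> bool" where
  "first_hit y x n \<longleftrightarrow>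
     jump_time y n < \<infinity> \<and> jump_state y n = x \<and> (\<forall>k<n. jump_state y k \<noteq> x)"

abbreviation hitting_local_time :: "(real \<Rightarrow> 'v) \<Rightarrow> 'v \<Rightarrow> 'v \<Rightarrow> real" where
  "hitting_local_time y x \<equiv> local_time y (hitting_time y x)"

lemma path_eq_jump_state:
  assumes "jump_time y n = ereal t" "0 \<le> r" "r < t"
  shows "\<exists>k<n. y r = jump_state y k"
  using assms
proof (induction n arbitrary: t)
  case 0
  then show ?case by simp
next
  case (Suc n)
  have fin: "jump_time y n < \<infinity>"
    using Suc.prems jump_time_antimono_finite[of y n] by simp
  then obtain t' where t': "jump_time y n = ereal t'"
    by (rule jump_time_finite_cases)
  show ?case
  proof (cases "r < t'")
    case True
    with Suc.IH[OF t'] Suc.prems show ?thesis by (auto intro: less_SucI)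
  next
    case False
    have "y r = jump_state y n"
      by (rule path_until_jump[OF t']) (use False Suc.prems in auto)
    then show ?thesis by auto
  qed
qed

lemma hitting_time_first_hit:
  assumes "first_hit y x n"
  shows "hitting_time y x = real_of_ereal (jump_time y n)"
proof -
  from assms obtain t where t: "0 \<le> t" "jump_time y n = ereal t"
    by (auto simp: first_hit_def simp del: ereal_infty_less elim: jump_time_finite_cases)
  have yt: "y t = x" using assms t by (auto simp: first_hit_def jump_state_def)
  have "t \<le> r" if "0 \<le> r" "y r = x" for r
  proof (rule ccontr)
    assume "\<not> t \<le> r"
    then have "r < t" by simp
    then have "\<exists>k<n. y r = jump_state y k"
      using path_eq_jump_state[OF t(2), of r] that by auto
    with assms that show False by (auto simp: first_hit_def)
  qed
  then have "Inf {t. 0 \<le> t \<and> y t = x} = t"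
    using t yt by (intro cInf_eq_minimum) auto
  then show ?thesis by (simp add: hitting_time_def t)
qed

lemma local_time_jump_time:
  assumes "right_continuous_path y" "jump_time y n < \<infinity>"
  shows "local_time y (real_of_ereal (jump_time y n)) = elapsed y n \<and>
    (\<forall>x. set_integrable lborel {0..real_of_ereal (jump_time y n)} (\<lambda>r. indicator {x} (y r) :: real))"
  using assms(2)
proof (induction n)
  case 0
  have *: "(\<lambda>r. indicat_real {0..0} r *\<^sub>R indicat_real {x} (y r)) =
      (\<lambda>r. indicator {0} r *\<^sub>R indicat_real {x} (y 0))" for x
    by (auto simp: indicator_def)
  have "integrable lborel (\<lambda>r. indicat_real {0} r *\<^sub>R indicat_real {x} (y 0))" for x
    by (rule integrable_scaleR_left) auto
  then show ?case
    by (simp del: atLeastAtMost_singleton real_scaleR_def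
        add: local_time_def fun_eq_iff set_lebesgue_integral_def set_integrable_def *)
next
  case (Suc n)
  have fin: "jump_time y n < \<infinity>"
    using Suc.prems by (rule jump_time_antimono_finite)
  obtain t where t: "0 \<le> t" "jump_time y n = ereal t"
    using fin by (rule jump_time_finite_cases)
  obtain t' where t': "0 \<le> t'" "jump_time y (Suc n) = ereal t'"
    using Suc.prems by (rule jump_time_finite_cases)
  have tt: "t < t'" using jump_time_strict[OF assms(1) fin] t t' by simp
  define i where "i = jump_state y n"
  have IH: "local_time y t = elapsed y n"
    "\<And>x. set_integrable lborel {0..t} (\<lambda>r. indicator {x} (y r) :: real)"
    using Suc.IH[OF fin] t by auto
  have "local_time y t' x = elapsed y (Suc n) x \<and>
      set_integrable lborel {0..t'} (\<lambda>r. indicator {x} (y r) :: real)" for x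
  proof -
    \<comment> \<open>on the half-open holding interval the path is constant; the jump itself has measure 0\<close>
    let ?f = "\<lambda>r. indicator {x} (y r) :: real"
    have eq: "indicator {0..t'} r *\<^sub>R ?f r = indicator {0..t} r *\<^sub>R ?f r
        + (indicator {t<..<t'} r *\<^sub>R indicator {x} i + indicator {t'} r *\<^sub>R indicator {x} (y t'))" for r
    proof -
      consider "r < 0" | "0 \<le> r" "r \<le> t" | "t < r" "r < t'" | "r = t'" | "t' < r" by linarith
      then show ?thesis
      proof cases
        case 3
        then have "y r = i"
          unfolding i_def using path_until_jump[OF t(2), of r] t' by simp
        with 3 t show ?thesis by (auto simp: indicator_def)
      qed (use t tt in \<open>auto simp: indicator_def\<close>)
    qed
    have int1: "integrable lborel (\<lambda>r. indicator {0..t} r *\<^sub>R ?f r)"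
      using IH(2)[of x] by (simp add: set_integrable_def)
    have int2: "integrable lborel (\<lambda>r::real. indicator {t<..<t'} r *\<^sub>R (indicator {x} i :: real))"
      and int3: "integrable lborel (\<lambda>r::real. indicator {t'} r *\<^sub>R (indicator {x} (y t') :: real))"
      using tt by (auto intro!: integrable_scaleR_left)
    have "local_time y t' x = local_time y t x + (t' - t) * indicator {x} i"
      unfolding local_time_def set_lebesgue_integral_def eq
      using int1 int2 int3 tt by simp
    moreover have "integrable lborel (\<lambda>r. indicator {0..t'} r *\<^sub>R ?f r)"
      unfolding eq using int1 int2 int3 by simp
    ultimately show ?thesis
      using IH(1) t t' by (auto simp: set_integrable_def i_def)
  qed
  then show ?case using t' by auto
qed

section \<open>Measurability of path functionals\<close>

text \<open>The dyadic point strictly above a time. A right-continuous path with values in a discrete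
  space agrees with its values at these points from some level on, which reduces measurability at
  random times to measurability at countably many fixed times.\<close>

definition grid_above :: "nat \<Rightarrow> real \<Rightarrow> real" where
  "grid_above k t = (of_int \<lfloor>t * 2 ^ k\<rfloor> + 1) / 2 ^ k"

lemma grid_above_gt: "t < grid_above k t"
proof -
  have "t * 2 ^ k < of_int \<lfloor>t * 2 ^ k\<rfloor> + 1" by linarith
  then show ?thesis by (simp add: grid_above_def field_simps)
qed

lemma grid_above_le: "grid_above k t \<le> t + (1/2) ^ k"
proof -
  have "of_int \<lfloor>t * 2 ^ k\<rfloor> + 1 \<le> t * 2 ^ k + 1" by linarith
  then show ?thesis by (simp add: grid_above_def field_simps power_divide)
qed

lemma eventually_path_grid:
  assumes "right_continuous_path y" "0 \<le> t"
  shows "\<forall>\<^sub>F k in sequentially. y (grid_above k t) = y t"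
proof -
  obtain e where e: "t < e" "\<And>u. t \<le> u \<Longrightarrow> u < e \<Longrightarrow> y u = y t"
    using right_continuous_pathD[OF assms] by metis
  have "(\<lambda>k. (1/2::real) ^ k) \<longlonglongrightarrow> 0" by (rule LIMSEQ_power_zero) auto
  then have "\<forall>\<^sub>F k in sequentially. (1/2::real) ^ k < e - t"
    using e(1) by (intro order_tendstoD(2)) auto
  then show ?thesis
  proof (rule eventually_mono)
    fix k assume "(1/2::real) ^ k < e - t"
    then show "y (grid_above k t) = y t"
      using grid_above_gt[of t k] grid_above_le[of k t] by (intro e(2)) linarith+
  qed
qed

locale right_continuous_process =
  fixes M :: "'a measure" and Y :: "real \<Rightarrow> 'a \<Rightarrow> 'v::finite"
  assumes Y_meas: "\<And>t. 0 \<le> t \<Longrightarrow> Y t \<in> M \<rightarrow>\<^sub>M count_space UNIV"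
    and Y_rc: "\<And>\<omega>. \<omega> \<in> space M \<Longrightarrow> right_continuous_path (\<lambda>t. Y t \<omega>)"
begin

lemma measurable_at_random_time:
  assumes T[measurable]: "T \<in> borel_measurable N" and Om[measurable]: "f \<in> N \<rightarrow>\<^sub>M M"
    and nn: "\<And>\<omega>. \<omega> \<in> space N \<Longrightarrow> 0 \<le> T \<omega>"
  shows "(\<lambda>\<omega>. Y (T \<omega>) (f \<omega>)) \<in> N \<rightarrow>\<^sub>M count_space UNIV"
proof -
  have "{\<omega>\<in>space N. Y (T \<omega>) (f \<omega>) = j} \<in> sets N" for j
  proof -
    have Ym: "{\<omega>\<in>space N. Y r (f \<omega>) = j} \<in> sets N" if "0 \<le> r" for r
    proof -
      note [measurable] = Y_meas[OF that]
      show ?thesis by measurable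
    qed
    define g where "g k i = (real i + 1) / 2 ^ k" for k i :: nat
    have [measurable]: "Measurable.pred N (\<lambda>\<omega>. Y (g k i) (f \<omega>) = j)" for k i
      using Ym[of "g k i"] by (simp add: pred_def g_def)
    have "{\<omega>\<in>space N. Y (T \<omega>) (f \<omega>) = j} =
      {\<omega>\<in>space N. \<exists>m. \<forall>k\<ge>m. \<exists>i. \<lfloor>T \<omega> * 2 ^ k\<rfloor> = int i \<and> Y (g k i) (f \<omega>) = j}"
      (is "?l = ?r")
    proof (rule Collect_cong, rule conj_cong[OF refl])
      fix \<omega> assume \<omega>: "\<omega> \<in> space N"
      have rc: "right_continuous_path (\<lambda>t. Y t (f \<omega>))"
        using \<omega> by (intro Y_rc measurable_space[OF Om])
      have ev: "\<forall>\<^sub>F k in sequentially. Y (grid_above k (T \<omega>)) (f \<omega>) = Y (T \<omega>) (f \<omega>)"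
        by (rule eventually_path_grid[OF rc nn[OF \<omega>]])
      have "(\<exists>i. \<lfloor>T \<omega> * 2 ^ k\<rfloor> = int i \<and> Y (g k i) (f \<omega>) = j) \<longleftrightarrow>
          Y (grid_above k (T \<omega>)) (f \<omega>) = j" for k
      proof -
        have "0 \<le> \<lfloor>T \<omega> * 2 ^ k\<rfloor>" using nn[OF \<omega>] by simp
        then obtain i where i: "\<lfloor>T \<omega> * 2 ^ k\<rfloor> = int i" by (metis nonneg_int_cases)
        then have "g k i = grid_above k (T \<omega>)" by (simp add: g_def grid_above_def)
        with i show ?thesis by auto
      qed
      then have "(\<exists>m. \<forall>k\<ge>m. \<exists>i. \<lfloor>T \<omega> * 2 ^ k\<rfloor> = int i \<and> Y (g k i) (f \<omega>) = j) \<longleftrightarrow>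
          (\<forall>\<^sub>F k in sequentially. Y (grid_above k (T \<omega>)) (f \<omega>) = j)"
        by (simp add: eventually_sequentially)
      also have "\<dots> \<longleftrightarrow> Y (T \<omega>) (f \<omega>) = j"
      proof
        assume "\<forall>\<^sub>F k in sequentially. Y (grid_above k (T \<omega>)) (f \<omega>) = j"
        with ev have "\<forall>\<^sub>F k in sequentially. Y (T \<omega>) (f \<omega>) = j"
          by eventually_elim auto
        then show "Y (T \<omega>) (f \<omega>) = j" by simp
      qed (use ev in auto)
      finally show "Y (T \<omega>) (f \<omega>) = j \<longleftrightarrow>
          (\<exists>m. \<forall>k\<ge>m. \<exists>i. \<lfloor>T \<omega> * 2 ^ k\<rfloor> = int i \<and> Y (g k i) (f \<omega>) = j)" by simp
    qed
    also have "\<dots> \<in> sets N" by measurable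
    finally show ?thesis .
  qed
  then show ?thesis
    by (auto simp: measurable_count_space_eq_countable vimage_def Int_def conj_commute)
qed


abbreviation tau :: "nat \<Rightarrow> 'a \<Rightarrow> ereal" where
  "tau n \<omega> \<equiv> jump_time (\<lambda>t. Y t \<omega>) n"

abbreviation state :: "nat \<Rightarrow> 'a \<Rightarrow> 'v" where
  "state n \<omega> \<equiv> jump_state (\<lambda>t. Y t \<omega>) n"

abbreviation ell :: "nat \<Rightarrow> 'a \<Rightarrow> 'v \<Rightarrow> real" where
  "ell n \<omega> \<equiv> elapsed (\<lambda>t. Y t \<omega>) n"

abbreviation holding :: "nat \<Rightarrow> 'a \<Rightarrow> real" where
  "holding n \<omega> \<equiv> real_of_ereal (tau (Suc n) \<omega> - tau n \<omega>)"

lemma measurable_Y_max [measurable]: "(\<lambda>\<omega>. Y (max 0 r) \<omega>) \<in> M \<rightarrow>\<^sub>M count_space UNIV"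
  by (rule Y_meas) simp

text \<open>What a right-continuous path does at a time, it still does at a rational time shortly after; so
  the events that define jump times and hitting times are countable unions.\<close>

lemma rational_witness:
  assumes "\<omega> \<in> space M" "0 \<le> t" "ereal t < a"
  shows "\<exists>q::rat. t < of_rat q \<and> ereal (of_rat q) < a \<and> Y (max 0 (of_rat q)) \<omega> = Y t \<omega>"
proof -
  obtain e where e: "t < e" "\<And>u. t \<le> u \<Longrightarrow> u < e \<Longrightarrow> Y u \<omega> = Y t \<omega>"
    using right_continuous_pathD[OF Y_rc[OF assms(1)] assms(2)] by metis
  obtain b where b: "t < b" "ereal b < a"
    using ereal_dense2[OF assms(3)] by auto
  obtain q :: rat where q: "t < of_rat q" "of_rat q < min e b"
    using of_rat_dense[of t "min e b"] e(1) b(1) by auto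
  have "(0::real) < of_rat q" using q(1) assms(2) by linarith
  have "ereal (of_rat q) < ereal b" using q by simp
  then have "ereal (of_rat q) < a" using b(2) by (rule less_trans)
  moreover have "Y (max 0 (of_rat q)) \<omega> = Y t \<omega>"
    using q \<open>0 < of_rat q\<close> e(2)[of "of_rat q"] by (simp add: max_def)
  ultimately show ?thesis using q by blast
qed

lemma measurable_tau_state: "tau n \<in> borel_measurable M \<and> state n \<in> M \<rightarrow>\<^sub>M count_space UNIV"
proof (induction n)
  case 0
  have "(\<lambda>\<omega>. Y 0 \<omega>) \<in> M \<rightarrow>\<^sub>M count_space UNIV" by (rule Y_meas) simp
  then show ?case by (simp add: jump_state_def)
next
  case (Suc n)
  then have [measurable]: "tau n \<in> borel_measurable M" "state n \<in> M \<rightarrow>\<^sub>M count_space UNIV"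
    by auto
  have tau: "tau (Suc n) \<in> borel_measurable M"
  proof (rule borel_measurableI_less)
    fix a
    have "{\<omega>\<in>space M. tau (Suc n) \<omega> < a} = {\<omega>\<in>space M. \<exists>q::rat. ereal (of_rat q) < a \<and>
        tau n \<omega> < ereal (of_rat q) \<and> Y (max 0 (of_rat q)) \<omega> \<noteq> state n \<omega>}"
    proof (rule Collect_cong, rule conj_cong[OF refl], rule iffI)
      fix \<omega> assume \<omega>: "\<omega> \<in> space M" and "tau (Suc n) \<omega> < a"
      then obtain t where t: "tau n \<omega> < ereal t" "Y t \<omega> \<noteq> state n \<omega>" "ereal t < a"
        by (auto simp: jump_time.simps INF_less_iff jump_state_def)
      from t(1) have "0 \<le> t"
        using jump_time_nonneg[of "\<lambda>t. Y t \<omega>" n]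
        by (metis ereal_less_eq(5) less_imp_le order.trans)
      obtain q :: rat where q: "t < of_rat q" "ereal (of_rat q) < a"
          "Y (max 0 (of_rat q)) \<omega> = Y t \<omega>"
        using rational_witness[OF \<omega> \<open>0 \<le> t\<close> t(3)] by blast
      from q(1) have "ereal t < ereal (of_rat q)" by simp
      then have "tau n \<omega> < ereal (of_rat q)" using t(1) by (rule less_trans[rotated])
      with q t show "\<exists>q::rat. ereal (of_rat q) < a \<and> tau n \<omega> < ereal (of_rat q) \<and>
          Y (max 0 (of_rat q)) \<omega> \<noteq> state n \<omega>" by auto
    next
      fix \<omega> assume "\<exists>q::rat. ereal (of_rat q) < a \<and> tau n \<omega> < ereal (of_rat q) \<and>
          Y (max 0 (of_rat q)) \<omega> \<noteq> state n \<omega>"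
      then obtain q :: rat where q: "ereal (of_rat q) < a" "tau n \<omega> < ereal (of_rat q)"
          "Y (max 0 (of_rat q)) \<omega> \<noteq> state n \<omega>" by blast
      from q(2) have "0 < ereal (of_rat q)"
        using jump_time_nonneg[of "\<lambda>t. Y t \<omega>" n] by (rule le_less_trans[rotated])
      then have "max 0 (of_rat q) = (of_rat q :: real)" by simp
      with q(2,3) have "tau (Suc n) \<omega> \<le> ereal (of_rat q)"
        unfolding jump_time.simps by (intro INF_lower) (auto simp: jump_state_def)
      then show "tau (Suc n) \<omega> < a" using q(1) by (rule le_less_trans)
    qed
    also have "\<dots> \<in> sets M" by measurable
    finally show "{\<omega>\<in>space M. tau (Suc n) \<omega> < a} \<in> sets M" .
  qed
  have "(\<lambda>\<omega>. Y (real_of_ereal (tau (Suc n) \<omega>)) \<omega>) \<in> M \<rightarrow>\<^sub>M count_space UNIV"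
    using tau by (intro measurable_at_random_time) (auto intro: real_of_ereal_pos jump_time_nonneg)
  with tau show ?case by (simp add: jump_state_def)
qed

lemma measurable_tau [measurable]: "tau n \<in> borel_measurable M"
  and measurable_state [measurable]: "state n \<in> M \<rightarrow>\<^sub>M count_space UNIV"
  using measurable_tau_state by auto

lemma measurable_hitting_time [measurable]:
  "(\<lambda>\<omega>. hitting_time (\<lambda>t. Y t \<omega>) x) \<in> borel_measurable M"
proof (rule borel_measurableI_less)
  fix a :: real
  let ?hits = "\<lambda>\<omega>. \<exists>q::rat. 0 \<le> q \<and> Y (max 0 (of_rat q)) \<omega> = x"
  have "{\<omega>\<in>space M. hitting_time (\<lambda>t. Y t \<omega>) x < a} =
    {\<omega>\<in>space M. (\<exists>q::rat. 0 \<le> q \<and> of_rat q < a \<and> Y (max 0 (of_rat q)) \<omega> = x) \<or>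
       (\<not> ?hits \<omega> \<and> (Inf {} :: real) < a)}"
  proof (rule Collect_cong, rule conj_cong[OF refl])
    fix \<omega> assume \<omega>: "\<omega> \<in> space M"
    define H where "H = {t. 0 \<le> t \<and> Y t \<omega> = x}"
    have wit: "\<exists>q::rat. 0 \<le> q \<and> ereal (of_rat q) < b \<and> Y (max 0 (of_rat q)) \<omega> = x"
      if H: "t \<in> H" "ereal t < b" for t b
    proof -
      have "0 \<le> t" "Y t \<omega> = x" using that by (auto simp: H_def)
      then obtain q :: rat where q: "t < of_rat q" "ereal (of_rat q) < b" "Y (max 0 (of_rat q)) \<omega> = x"
        using rational_witness[OF \<omega> _ H(2)] by auto
      then have "(0::real) \<le> of_rat q" using \<open>0 \<le> t\<close> by linarith
      with q show ?thesis by auto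
    qed
    have H_rat: "of_rat q \<in> H" if "0 \<le> q" "Y (max 0 (of_rat q)) \<omega> = x" for q :: rat
      using that by (auto simp: H_def max_def)
    show "hitting_time (\<lambda>t. Y t \<omega>) x < a \<longleftrightarrow>
      (\<exists>q::rat. 0 \<le> q \<and> of_rat q < a \<and> Y (max 0 (of_rat q)) \<omega> = x) \<or>
       (\<not> ?hits \<omega> \<and> (Inf {} :: real) < a)"
    proof (cases "H = {}")
      case True
      then have "\<not> ?hits \<omega>" using H_rat by auto
      then show ?thesis using True by (auto simp: hitting_time_def H_def[symmetric])
    next
      case False
      then obtain t where "t \<in> H" by auto
      then have hits: "?hits \<omega>" using wit[of t \<infinity>] by auto
      have "bdd_below H" by (auto simp: H_def intro: bdd_belowI[of _ 0])
      then have "hitting_time (\<lambda>t. Y t \<omega>) x < a \<longleftrightarrow> (\<exists>t\<in>H. t < a)"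
        using False by (simp add: hitting_time_def H_def[symmetric] cInf_less_iff)
      also have "\<dots> \<longleftrightarrow> (\<exists>q::rat. 0 \<le> q \<and> of_rat q < a \<and> Y (max 0 (of_rat q)) \<omega> = x)"
        using wit[of _ "ereal a"] H_rat by fastforce
      finally show ?thesis using hits by simp
    qed
  qed
  also have "\<dots> \<in> sets M" by measurable
  finally show "{\<omega>\<in>space M. hitting_time (\<lambda>t. Y t \<omega>) x < a} \<in> sets M" .
qed

lemma measurable_local_time [measurable]:
  assumes [measurable]: "T \<in> borel_measurable M"
  shows "(\<lambda>\<omega>. local_time (\<lambda>t. Y t \<omega>) (T \<omega>) x) \<in> borel_measurable M"
proof -
  have [measurable]: "(\<lambda>p. Y (max 0 (snd p)) (fst p)) \<in> M \<Otimes>\<^sub>M lborel \<rightarrow>\<^sub>M count_space UNIV"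
    by (rule measurable_at_random_time) auto
  have "(\<lambda>\<omega>. \<integral>r. indicator {0..T \<omega>} r *\<^sub>R (indicator {x} (Y (max 0 r) \<omega>) :: real) \<partial>lborel)
      \<in> borel_measurable M"
  proof (rule sigma_finite_measure.borel_measurable_lebesgue_integral)
    show "sigma_finite_measure (lborel :: real measure)" by (rule lborel.sigma_finite_measure_axioms)
    have eq: "(\<lambda>(\<omega>, r). indicator {0..T \<omega>} r *\<^sub>R (indicator {x} (Y (max 0 r) \<omega>) :: real)) =
        (\<lambda>p. if 0 \<le> snd p \<and> snd p \<le> T (fst p) \<and> Y (max 0 (snd p)) (fst p) = x then 1 else 0)"
      by (rule ext) (auto simp: indicator_def split: prod.split)
    show "(\<lambda>(\<omega>, r). indicator {0..T \<omega>} r *\<^sub>R (indicator {x} (Y (max 0 r) \<omega>) :: real))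
      \<in> borel_measurable (M \<Otimes>\<^sub>M lborel)"
      unfolding eq by measurable
  qed
  moreover have "local_time (\<lambda>t. Y t \<omega>) (T \<omega>) x =
      (\<integral>r. indicator {0..T \<omega>} r *\<^sub>R (indicator {x} (Y (max 0 r) \<omega>) :: real) \<partial>lborel)" for \<omega>
    unfolding local_time_def set_lebesgue_integral_def
    by (intro Bochner_Integration.integral_cong) (auto simp: indicator_def max_def)
  ultimately show ?thesis by simp
qed

lemma measurable_field_at_hitting:
  assumes g: "\<And>x. g x \<in> borel_measurable borel"
  shows "(\<lambda>\<omega>. (\<lambda>x. g x (hitting_local_time (\<lambda>t. Y t \<omega>) x0 x)))
     \<in> M \<rightarrow>\<^sub>M field_space"
proof (rule measurable_PiM_single')
  fix x
  note [measurable] = g[of x]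
  show "(\<lambda>\<omega>. g x (hitting_local_time (\<lambda>t. Y t \<omega>) x0 x)) \<in> borel_measurable M"
    by measurable
qed auto

lemma space_past [simp]: "space (past M Y n) = space M"
  by (simp add: past_def)

lemma measurable_past_tau: "k \<le> n \<Longrightarrow> tau k \<in> borel_measurable (past M Y n)"
  and measurable_past_state: "k \<le> n \<Longrightarrow> state k \<in> past M Y n \<rightarrow>\<^sub>M count_space UNIV"
proof -
  let ?P = "\<lambda>\<omega>. \<lambda>k\<in>{..n}. (tau k \<omega>, state k \<omega>)"
  have P: "?P \<in> past M Y n \<rightarrow>\<^sub>M Pi\<^sub>M {..n} (\<lambda>_. borel \<Otimes>\<^sub>M count_space UNIV)"
    unfolding past_def by (rule measurable_vimage_algebra1) (auto simp: space_PiM space_pair_measure)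
  assume k: "k \<le> n"
  have "(\<lambda>\<omega>. ?P \<omega> k) \<in> past M Y n \<rightarrow>\<^sub>M borel \<Otimes>\<^sub>M count_space UNIV"
    by (rule measurable_compose[OF P]) (use k in auto)
  then have c: "(\<lambda>\<omega>. (tau k \<omega>, state k \<omega>)) \<in> past M Y n \<rightarrow>\<^sub>M borel \<Otimes>\<^sub>M count_space UNIV"
    using k by simp
  show "tau k \<in> borel_measurable (past M Y n)"
    using measurable_compose[OF c measurable_fst] by simp
  show "state k \<in> past M Y n \<rightarrow>\<^sub>M count_space UNIV"
    using measurable_compose[OF c measurable_snd] by simp
qed

lemma measurable_id_past: "(\<lambda>\<omega>. \<omega>) \<in> M \<rightarrow>\<^sub>M past M Y n"
  unfolding past_def
proof (rule measurable_vimage_algebra2)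
  show "(\<lambda>\<omega>. \<lambda>k\<in>{..n}. (tau k \<omega>, state k \<omega>)) \<in> M \<rightarrow>\<^sub>M Pi\<^sub>M {..n} (\<lambda>_. borel \<Otimes>\<^sub>M count_space UNIV)"
    by (rule measurable_restrict) measurable
qed auto

lemma measurable_past_imp: "f \<in> past M Y n \<rightarrow>\<^sub>M S \<Longrightarrow> f \<in> M \<rightarrow>\<^sub>M S"
  using measurable_compose[OF measurable_id_past] by blast

lemma measurable_field_update:
  assumes f: "f \<in> N \<rightarrow>\<^sub>M field_space" and i: "i \<in> N \<rightarrow>\<^sub>M count_space (UNIV :: 'v set)"
    and r: "r \<in> borel_measurable N"
  shows "(\<lambda>\<omega>. (f \<omega>)(i \<omega> := r \<omega>)) \<in> N \<rightarrow>\<^sub>M field_space"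
proof (rule measurable_PiM_single')
  fix x :: 'v
  note [measurable] = f i r
  have [measurable]: "(\<lambda>\<omega>. f \<omega> x) \<in> borel_measurable N"
    by (rule measurable_compose[OF f]) simp
  have "(\<lambda>\<omega>. if i \<omega> = x then r \<omega> else f \<omega> x) \<in> borel_measurable N" by measurable
  then show "(\<lambda>\<omega>. ((f \<omega>)(i \<omega> := r \<omega>)) x) \<in> borel_measurable N"
    by (rule measurable_cong[THEN iffD1, rotated]) auto
qed auto

lemma measurable_past_ell: "k \<le> n \<Longrightarrow> ell k \<in> past M Y n \<rightarrow>\<^sub>M field_space"
proof (induction k)
  case 0
  have "(\<lambda>\<omega>. (\<lambda>_. 0) :: 'v \<Rightarrow> real) \<in> past M Y n \<rightarrow>\<^sub>M field_space"
    by (rule measurable_const) (simp add: space_PiM)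
  then show ?case by (simp only: elapsed.simps)
next
  case (Suc k)
  then have ell[measurable]: "ell k \<in> past M Y n \<rightarrow>\<^sub>M field_space" by simp
  have st[measurable]: "state k \<in> past M Y n \<rightarrow>\<^sub>M count_space UNIV"
    and [measurable]: "tau k \<in> borel_measurable (past M Y n)" "tau (Suc k) \<in> borel_measurable (past M Y n)"
    using Suc.prems by (auto intro: measurable_past_state measurable_past_tau)
  have [measurable]: "(\<lambda>\<omega>. ell k \<omega> (state k \<omega>)) \<in> borel_measurable (past M Y n)"
  proof -
    have [measurable]: "(\<lambda>\<omega>. ell k \<omega> x) \<in> borel_measurable (past M Y n)" for x
      by (rule measurable_compose[OF ell]) simp
    have "(\<lambda>\<omega>. \<Sum>x\<in>UNIV. if state k \<omega> = x then ell k \<omega> x else 0) \<in> borel_measurable (past M Y n)"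
      by measurable
    then show ?thesis by simp
  qed
  show ?case unfolding elapsed.simps
    by (rule measurable_field_update[OF ell st]) measurable
qed


lemma measurable_ell [measurable]: "ell n \<in> M \<rightarrow>\<^sub>M field_space"
  by (rule measurable_past_imp[OF measurable_past_ell[OF order_refl]])

end

section \<open>The law of the local times at the first hitting time\<close>

lemma measurable_fun_upd_field [measurable]:
  assumes f: "f \<in> N \<rightarrow>\<^sub>M field_space" and r: "r \<in> borel_measurable N"
  shows "(\<lambda>\<omega>. (f \<omega>)(i := r \<omega>)) \<in> N \<rightarrow>\<^sub>M (field_space :: ('v \<Rightarrow> real) measure)"
proof (rule measurable_PiM_single')
  fix x :: 'v
  note [measurable] = r
  have [measurable]: "(\<lambda>\<omega>. f \<omega> x) \<in> borel_measurable N"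
    by (rule measurable_compose[OF f]) simp
  show "(\<lambda>\<omega>. ((f \<omega>)(i := r \<omega>)) x) \<in> borel_measurable N"
    by (cases "i = x") (auto simp: fun_upd_def)
qed auto

text \<open>If the process sits at \<open>i\<close> with local times \<open>l\<close>, this is the expectation of \<open>f\<close> of the local times
  at the first hitting of \<open>x0\<close>, on the event that this happens at the \<open>n\<close>-th jump from now on.\<close>

primrec hit_expect ::
    "(('v::finite \<Rightarrow> real) \<Rightarrow> 'v \<Rightarrow> 'v \<Rightarrow> real) \<Rightarrow> 'v \<Rightarrow> nat \<Rightarrow> 'v \<Rightarrow> ('v \<Rightarrow> real) \<Rightarrow>
     (('v \<Rightarrow> real) \<Rightarrow> ennreal) \<Rightarrow> ennreal" where
  "hit_expect \<rho> x0 0 i l f = (if i = x0 then f l else 0)"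
| "hit_expect \<rho> x0 (Suc n) i l f = (if i = x0 then 0 else
     \<Sum>j\<in>UNIV. \<integral>\<^sup>+u. indicator {0<..} u * ennreal (jump_density \<rho> l i j u) *
       hit_expect \<rho> x0 n j (l(i := l i + u)) f \<partial>lborel)"

locale local_time_jump_process = right_continuous_process M Y
  for M :: "'a measure" and Y :: "real \<Rightarrow> 'a \<Rightarrow> 'v::finite" +
  fixes \<rho> :: "('v \<Rightarrow> real) \<Rightarrow> 'v \<Rightarrow> 'v \<Rightarrow> real" and z :: 'v
  assumes jp: "jump_process M \<rho> z Y"
    and rho_measurable [measurable]: "\<And>i j. (\<lambda>l. \<rho> l i j) \<in> borel_measurable field_space"
begin

sublocale prob_space M
  using jp by (simp add: jump_process_def)

lemma measurable_jump_density [measurable]: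
  assumes [measurable]: "l \<in> N \<rightarrow>\<^sub>M field_space" "u \<in> borel_measurable N"
  shows "(\<lambda>\<omega>. jump_density \<rho> (l \<omega>) i j (u \<omega>)) \<in> borel_measurable N"
proof -
  have [measurable]: "(\<lambda>\<omega>. l \<omega> x) \<in> borel_measurable N" for x
    by (rule measurable_compose[OF assms(1)]) simp
  have [measurable]: "(\<lambda>\<omega>. \<rho> ((l \<omega>)(i := l \<omega> i + u \<omega>)) i j) \<in> borel_measurable N"
    by (rule measurable_compose[OF _ rho_measurable]) measurable
  have [measurable]: "(\<lambda>p. \<rho> ((l (fst p))(i := l (fst p) i + snd p)) i k) \<in> borel_measurable (N \<Otimes>\<^sub>M lborel)" for k
    by (rule measurable_compose[OF _ rho_measurable]) measurable
  have "(\<lambda>\<omega>. \<integral>v. indicator {0..u \<omega>} v *\<^sub>R (\<Sum>k\<in>UNIV. \<rho> ((l \<omega>)(i := l \<omega> i + v)) i k) \<partial>lborel)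
      \<in> borel_measurable N"
  proof (rule sigma_finite_measure.borel_measurable_lebesgue_integral)
    show "sigma_finite_measure (lborel :: real measure)" by (rule lborel.sigma_finite_measure_axioms)
    have eq: "(\<lambda>(\<omega>, v). indicator {0..u \<omega>} v *\<^sub>R (\<Sum>k\<in>UNIV. \<rho> ((l \<omega>)(i := l \<omega> i + v)) i k)) =
      (\<lambda>p. if 0 \<le> snd p \<and> snd p \<le> u (fst p)
           then \<Sum>k\<in>UNIV. \<rho> ((l (fst p))(i := l (fst p) i + snd p)) i k else 0)"
      by (auto simp: indicator_def)
    show "(\<lambda>(\<omega>, v). indicator {0..u \<omega>} v *\<^sub>R (\<Sum>k\<in>UNIV. \<rho> ((l \<omega>)(i := l \<omega> i + v)) i k))
       \<in> borel_measurable (N \<Otimes>\<^sub>M lborel)"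
      unfolding eq by measurable
  qed
  then show ?thesis
    unfolding jump_density_def set_lebesgue_integral_def by measurable
qed

lemma measurable_hit_expect [measurable]:
  assumes [measurable]: "f \<in> borel_measurable field_space"
  shows "(\<lambda>l. hit_expect \<rho> x0 n i l f) \<in> borel_measurable field_space"
proof (induction n arbitrary: i)
  case 0
  show ?case by simp
next
  case (Suc n)
  note [measurable] = measurable_compose[OF _ Suc.IH]
  show ?case by simp measurable
qed

lemma increment_mem_iff:
  assumes "\<omega> \<in> space M"
  shows "tau (Suc n) \<omega> - tau n \<omega> \<in> ereal ` B \<longleftrightarrow> tau (Suc n) \<omega> < \<infinity> \<and> holding n \<omega> \<in> B"
proof (cases "tau (Suc n) \<omega> < \<infinity>")
  case True
  then have "tau n \<omega> < \<infinity>" by (rule jump_time_antimono_finite)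
  then obtain t where t: "tau n \<omega> = ereal t" by (rule jump_time_finite_cases)
  obtain t' where "tau (Suc n) \<omega> = ereal t'" using True by (rule jump_time_finite_cases)
  with t show ?thesis by auto
next
  case False
  then have "tau (Suc n) \<omega> = \<infinity>" by (simp add: less_top[symmetric])
  then show ?thesis by auto
qed

lemma measurable_jump_density_state [measurable]:
  "(\<lambda>p. jump_density \<rho> (ell n (fst p)) (state n (fst p)) j (snd p)) \<in> borel_measurable (M \<Otimes>\<^sub>M lborel)"
proof -
  have "(\<lambda>p. \<Sum>i\<in>UNIV. if state n (fst p) = i then jump_density \<rho> (ell n (fst p)) i j (snd p) else 0)
      \<in> borel_measurable (M \<Otimes>\<^sub>M lborel)"
    by measurable
  then show ?thesis by simp
qed

abbreviation jumps_to :: "nat \<Rightarrow> 'v \<Rightarrow> 'a \<Rightarrow> ennreal" where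
  "jumps_to n j \<equiv> indicator {\<omega>. tau (Suc n) \<omega> < \<infinity> \<and> state (Suc n) \<omega> = j}"

abbreviation jump_integral :: "nat \<Rightarrow> 'v \<Rightarrow> ('a \<times> real \<Rightarrow> ennreal) \<Rightarrow> 'a \<Rightarrow> ennreal" where
  "jump_integral n j F \<omega> \<equiv> indicator {\<omega>. tau n \<omega> < \<infinity>} \<omega> *
     (\<integral>\<^sup>+u. indicator {0<..} u * ennreal (jump_density \<rho> (ell n \<omega>) (state n \<omega>) j u) * F (\<omega>, u) \<partial>lborel)"

lemma measurable_jumps_to [measurable]:
  "jumps_to n j \<in> borel_measurable M" "(\<lambda>\<omega>. indicator {\<omega>. tau n \<omega> < \<infinity>} \<omega> :: ennreal) \<in> borel_measurable M"
  unfolding indicator_def by measurable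

lemma measurable_past_pair:
  assumes "F \<in> borel_measurable (past M Y n \<Otimes>\<^sub>M (borel :: real measure))"
  shows "F \<in> borel_measurable (M \<Otimes>\<^sub>M borel)"
proof -
  have "(\<lambda>p. (fst p, snd p)) \<in> M \<Otimes>\<^sub>M borel \<rightarrow>\<^sub>M past M Y n \<Otimes>\<^sub>M (borel :: real measure)"
    by (rule measurable_Pair[OF measurable_compose[OF measurable_fst measurable_id_past] measurable_snd])
  from measurable_compose[OF this assms] show ?thesis by simp
qed

text \<open>The definition of a jump process gives this identity for the indicators of rectangles. Both
  sides are integrals of \<open>F\<close> against measures on the product of the past and the holding time, and
  finite measures that agree on rectangles are equal.\<close>

lemma one_step:
  assumes F: "F \<in> borel_measurable (past M Y n \<Otimes>\<^sub>M borel)"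
  shows "(\<integral>\<^sup>+\<omega>. jumps_to n j \<omega> * F (\<omega>, holding n \<omega>) \<partial>M) = (\<integral>\<^sup>+\<omega>. jump_integral n j F \<omega> \<partial>M)"
proof -
  let ?S = "past M Y n \<Otimes>\<^sub>M (borel :: real measure)"
  let ?d = "\<lambda>\<omega> u. indicator {0<..} u * ennreal (jump_density \<rho> (ell n \<omega>) (state n \<omega>) j u)"
  let ?e = "\<lambda>p. indicator {\<omega>. tau n \<omega> < \<infinity>} (fst p) * ?d (fst p) (snd p)"
  have [measurable]: "?e \<in> borel_measurable (M \<Otimes>\<^sub>M lborel)"
    by measurable
  have T1 [measurable]: "(\<lambda>\<omega>. (\<omega>, holding n \<omega>)) \<in> M \<rightarrow>\<^sub>M ?S"
    by (rule measurable_Pair[OF measurable_id_past]) measurable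
  have T2 [measurable]: "(\<lambda>p. (fst p, snd p)) \<in> M \<Otimes>\<^sub>M lborel \<rightarrow>\<^sub>M ?S"
    by (rule measurable_Pair[OF measurable_compose[OF measurable_fst measurable_id_past]]) measurable
  define \<nu>1 where "\<nu>1 = distr (density M (jumps_to n j)) ?S (\<lambda>\<omega>. (\<omega>, holding n \<omega>))"
  define \<nu>2 where "\<nu>2 = distr (density (M \<Otimes>\<^sub>M lborel) ?e) ?S (\<lambda>p. (fst p, snd p))"
  have mu1: "(\<integral>\<^sup>+x. G x \<partial>\<nu>1) = (\<integral>\<^sup>+\<omega>. jumps_to n j \<omega> * G (\<omega>, holding n \<omega>) \<partial>M)"
    if G: "G \<in> borel_measurable ?S" for G
  proof -
    have "(\<lambda>\<omega>. G (\<omega>, holding n \<omega>)) \<in> borel_measurable M"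
      by (rule measurable_compose[OF T1 G])
    then show ?thesis unfolding \<nu>1_def using G by (simp add: nn_integral_distr nn_integral_density)
  qed
  have mu2: "(\<integral>\<^sup>+x. G x \<partial>\<nu>2) = (\<integral>\<^sup>+\<omega>. jump_integral n j G \<omega> \<partial>M)"
    if G: "G \<in> borel_measurable ?S" for G
  proof -
    have [measurable]: "G \<in> borel_measurable (M \<Otimes>\<^sub>M borel)" by (rule measurable_past_pair[OF G])
    have "(\<integral>\<^sup>+x. G x \<partial>\<nu>2) = (\<integral>\<^sup>+p. ?e p * G p \<partial>(M \<Otimes>\<^sub>M lborel))"
      unfolding \<nu>2_def using T2 G by (subst nn_integral_distr) (auto simp: nn_integral_density)
    also have "\<dots> = (\<integral>\<^sup>+\<omega>. \<integral>\<^sup>+u. ?e (\<omega>, u) * G (\<omega>, u) \<partial>lborel \<partial>M)"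
      by (subst lborel.nn_integral_fst[symmetric]) auto
    also have "\<dots> = (\<integral>\<^sup>+\<omega>. jump_integral n j G \<omega> \<partial>M)"
      by (intro nn_integral_cong) (auto simp: indicator_def mult.assoc)
    finally show ?thesis .
  qed
  have "\<nu>1 = \<nu>2"
  proof (rule measure_eqI_generator_eq)
    let ?E = "{a \<times> b | a b. a \<in> sets (past M Y n) \<and> b \<in> sets (borel :: real measure)}"
    show "Int_stable ?E" by (rule Int_stable_pair_measure_generator)
    show "?E \<subseteq> Pow (space ?S)"
      by (simp only: space_pair_measure pair_measure_closed)
    show "sets \<nu>1 = sigma_sets (space ?S) ?E" "sets \<nu>2 = sigma_sets (space ?S) ?E"
      by (simp_all add: \<nu>1_def \<nu>2_def sets_pair_measure space_pair_measure)
    have "space ?S = space (past M Y n) \<times> (UNIV :: real set)"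
      by (simp only: space_pair_measure space_borel)
    moreover have "space (past M Y n) \<times> UNIV \<in> ?E"
      by (rule CollectI, intro exI conjI, rule refl, rule sets.top, simp)
    ultimately show "range (\<lambda>_::nat. space ?S) \<subseteq> ?E"
      by (simp only: image_subset_iff) simp
    have "emeasure \<nu>1 (space ?S) = (\<integral>\<^sup>+\<omega>. jumps_to n j \<omega> * 1 \<partial>M)"
      using mu1[of "\<lambda>_. 1"] by (simp add: \<nu>1_def)
    also have "\<dots> \<le> (\<integral>\<^sup>+\<omega>. 1 \<partial>M)"
      by (intro nn_integral_mono) (auto simp: indicator_def)
    finally have "emeasure \<nu>1 (space ?S) \<le> 1" by (simp add: emeasure_space_1)
    then show "emeasure \<nu>1 (space ?S) \<noteq> \<infinity>" by (auto simp: top_unique)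
    fix X assume "X \<in> ?E"
    then obtain A B where X: "X = A \<times> B" and A: "A \<in> sets (past M Y n)" and B [measurable]: "B \<in> sets borel"
      by auto
    have XS: "X \<in> sets ?S" using A B by (simp add: X)
    have AM [measurable]: "A \<in> sets M" and sub: "A \<subseteq> space M"
      using measurable_sets[OF measurable_id_past A] sets.sets_into_space[OF A] by (simp_all add: Int_absorb2)
    define R where "R = {\<omega>\<in>A. let y = (\<lambda>t. Y t \<omega>) in
      jump_time y (Suc n) - jump_time y n \<in> ereal ` B \<and> jump_state y (Suc n) = j}"
    have "R = A \<inter> {\<omega>\<in>space M. tau (Suc n) \<omega> < \<infinity> \<and> holding n \<omega> \<in> B \<and> state (Suc n) \<omega> = j}"
      using sub by (auto simp: R_def Let_def increment_mem_iff)
    also have "\<dots> \<in> sets M" by measurable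
    finally have R: "R \<in> sets M" .
    have "emeasure \<nu>1 X = (\<integral>\<^sup>+x. indicator X x \<partial>\<nu>1)"
      using XS by (simp add: \<nu>1_def)
    also have "\<dots> = (\<integral>\<^sup>+\<omega>. jumps_to n j \<omega> * indicator X (\<omega>, holding n \<omega>) \<partial>M)"
      by (rule mu1[OF borel_measurable_indicator[OF XS]])
    also have "\<dots> = (\<integral>\<^sup>+\<omega>. indicator R \<omega> \<partial>M)"
      by (intro nn_integral_cong) (auto simp: indicator_def Let_def increment_mem_iff X R_def)
    also have "\<dots> = emeasure M R" by (rule nn_integral_indicator[OF R])
    also have "\<dots> = (\<integral>\<^sup>+\<omega>\<in>{\<omega>\<in>A. jump_time (\<lambda>t. Y t \<omega>) n < \<infinity>}.
           (let y = (\<lambda>t. Y t \<omega>) in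
            \<integral>\<^sup>+u\<in>B \<inter> {0<..}. ennreal (jump_density \<rho>
               (local_time y (real_of_ereal (jump_time y n))) (jump_state y n) j u) \<partial>lborel) \<partial>M)"
      using jp A B unfolding jump_process_def R_def by blast
    also have "\<dots> = (\<integral>\<^sup>+\<omega>. jump_integral n j (indicator X) \<omega> \<partial>M)"
    proof (intro nn_integral_cong)
      fix \<omega> assume \<omega>: "\<omega> \<in> space M"
      show "(let y = (\<lambda>t. Y t \<omega>) in
            \<integral>\<^sup>+u\<in>B \<inter> {0<..}. ennreal (jump_density \<rho>
               (local_time y (real_of_ereal (jump_time y n))) (jump_state y n) j u) \<partial>lborel) *
          indicator {\<omega>\<in>A. jump_time (\<lambda>t. Y t \<omega>) n < \<infinity>} \<omega> = jump_integral n j (indicator X) \<omega>"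
      proof (cases "tau n \<omega> < \<infinity> \<and> \<omega> \<in> A")
        case True
        have "local_time (\<lambda>t. Y t \<omega>) (real_of_ereal (tau n \<omega>)) = ell n \<omega>"
          using local_time_jump_time[OF Y_rc[OF \<omega>]] True by blast
        then show ?thesis using True
          by (auto simp: Let_def X indicator_def intro!: nn_integral_cong)
      qed (auto simp: X)
    qed
    also have "\<dots> = (\<integral>\<^sup>+x. indicator X x \<partial>\<nu>2)"
      by (rule mu2[OF borel_measurable_indicator[OF XS], symmetric])
    also have "\<dots> = emeasure \<nu>2 X"
      using XS by (simp add: \<nu>2_def)
    finally show "emeasure \<nu>1 X = emeasure \<nu>2 X" .
  qed auto
  then show ?thesis using mu1[OF F] mu2[OF F] by simp
qed

lemma measurable_random_state:
  assumes S: "S \<in> N \<rightarrow>\<^sub>M count_space (UNIV :: 'v set)"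
    and f: "\<And>i. (\<lambda>\<omega>. f i \<omega>) \<in> borel_measurable N"
  shows "(\<lambda>\<omega>. f (S \<omega>) \<omega> :: ennreal) \<in> borel_measurable N"
proof -
  note [measurable] = S f
  have "(\<lambda>\<omega>. \<Sum>i\<in>UNIV. if S \<omega> = i then f i \<omega> else 0) \<in> borel_measurable N"
    by measurable
  then show ?thesis by simp
qed

abbreviation not_hit :: "nat \<Rightarrow> 'v \<Rightarrow> 'a \<Rightarrow> ennreal" where
  "not_hit m x \<equiv> indicator {\<omega>. tau m \<omega> < \<infinity> \<and> (\<forall>k<m. state k \<omega> \<noteq> x)}"

text \<open>Conditioning on one jump after another: \<open>n\<close> of the \<open>m + n\<close> jumps up to the hitting of \<open>x0\<close>
  are integrated out in \<open>hit_expect\<close>, and each \<open>one_step\<close> moves a jump from there to the process.\<close>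

lemma hit_expect_chain:
  assumes f [measurable]: "f \<in> borel_measurable field_space"
  shows "(\<integral>\<^sup>+\<omega>. not_hit m x0 \<omega> * hit_expect \<rho> x0 n (state m \<omega>) (ell m \<omega>) f \<partial>M) =
    (\<integral>\<^sup>+\<omega>. indicator {\<omega>. first_hit (\<lambda>t. Y t \<omega>) x0 (m + n)} \<omega> * f (ell (m + n) \<omega>) \<partial>M)"
proof (induction n arbitrary: m)
  case 0
  show ?case
    by (intro nn_integral_cong) (auto simp: first_hit_def indicator_def)
next
  case (Suc n)
  let ?A = "{\<omega>. \<forall>k\<le>m. state k \<omega> \<noteq> x0}" and ?h = "\<lambda>j l. hit_expect \<rho> x0 n j l f"
  let ?P = "past M Y m \<Otimes>\<^sub>M (borel :: real measure)"
  define F where "F j p = indicator ?A (fst p) *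
      ?h j ((ell m (fst p))(state m (fst p) := ell m (fst p) (state m (fst p)) + snd p))"
    for j and p :: "'a \<times> real"
  have F_past: "F j \<in> borel_measurable ?P" for j
  proof -
    have [measurable]: "state k \<in> past M Y m \<rightarrow>\<^sub>M count_space UNIV" if "k \<in> {..m}" for k
      using that by (intro measurable_past_state) simp
    have st: "state m \<in> past M Y m \<rightarrow>\<^sub>M count_space UNIV"
      by (rule measurable_past_state) simp
    have el [measurable]: "ell m \<in> past M Y m \<rightarrow>\<^sub>M field_space"
      by (rule measurable_past_ell) simp
    have [measurable]: "(\<lambda>p. ell m (fst p) i) \<in> borel_measurable ?P" for i
      by (rule measurable_compose[OF measurable_compose[OF measurable_fst el]]) simp
    have [measurable]: "(\<lambda>p. ?h j ((ell m (fst p))(state m (fst p) :=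
        ell m (fst p) (state m (fst p)) + snd p))) \<in> borel_measurable ?P"
    proof (rule measurable_random_state[where S = "\<lambda>p. state m (fst p)" and
          f = "\<lambda>i p. ?h j ((ell m (fst p))(i := ell m (fst p) i + snd p))"])
      show "(\<lambda>p. state m (fst p)) \<in> ?P \<rightarrow>\<^sub>M count_space UNIV"
        by (rule measurable_compose[OF measurable_fst st])
      show "(\<lambda>p. ?h j ((ell m (fst p))(i := ell m (fst p) i + snd p))) \<in> borel_measurable ?P" for i
        by (rule measurable_compose[OF _ measurable_hit_expect[OF f]]) measurable
    qed
    have "(\<lambda>\<omega>. if \<forall>k\<in>{..m}. state k \<omega> \<noteq> x0 then 1 else 0 :: ennreal) \<in> borel_measurable (past M Y m)"
      by measurable
    then have "(\<lambda>\<omega>. indicator ?A \<omega> :: ennreal) \<in> borel_measurable (past M Y m)"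
      by (simp add: indicator_def cong: if_cong)
    from measurable_compose[OF measurable_fst this]
    have [measurable]: "(\<lambda>p. indicator ?A (fst p) :: ennreal) \<in> borel_measurable ?P" .
    show ?thesis unfolding F_def by measurable
  qed
  have F_M [measurable]: "F j \<in> borel_measurable (M \<Otimes>\<^sub>M borel)" for j
    by (rule measurable_past_pair[OF F_past])
  have "(\<integral>\<^sup>+\<omega>. not_hit m x0 \<omega> * hit_expect \<rho> x0 (Suc n) (state m \<omega>) (ell m \<omega>) f \<partial>M) =
     (\<integral>\<^sup>+\<omega>. (\<Sum>j\<in>UNIV. jump_integral m j (F j) \<omega>) \<partial>M)"
  proof (intro nn_integral_cong)
    fix \<omega>
    have le_iff: "(\<forall>k\<le>m. state k \<omega> \<noteq> x0) \<longleftrightarrow> (\<forall>k<m. state k \<omega> \<noteq> x0) \<and> state m \<omega> \<noteq> x0"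
      by (auto simp: le_less)
    show "not_hit m x0 \<omega> * hit_expect \<rho> x0 (Suc n) (state m \<omega>) (ell m \<omega>) f =
        (\<Sum>j\<in>UNIV. jump_integral m j (F j) \<omega>)"
      by (cases "\<forall>k\<le>m. state k \<omega> \<noteq> x0")
         (auto simp: F_def le_iff indicator_def mult.assoc)
  qed
  also have "\<dots> = (\<Sum>j\<in>UNIV. \<integral>\<^sup>+\<omega>. jump_integral m j (F j) \<omega> \<partial>M)"
    by (rule nn_integral_sum) measurable
  also have "\<dots> = (\<Sum>j\<in>UNIV. \<integral>\<^sup>+\<omega>. jumps_to m j \<omega> * F j (\<omega>, holding m \<omega>) \<partial>M)"
    by (rule sum.cong[OF refl]) (rule one_step[OF F_past, symmetric])
  also have "\<dots> = (\<integral>\<^sup>+\<omega>. (\<Sum>j\<in>UNIV. jumps_to m j \<omega> * F j (\<omega>, holding m \<omega>)) \<partial>M)"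
    by (rule nn_integral_sum[symmetric]) measurable
  also have "\<dots> = (\<integral>\<^sup>+\<omega>. not_hit (Suc m) x0 \<omega> * ?h (state (Suc m) \<omega>) (ell (Suc m) \<omega>) \<partial>M)"
  proof (intro nn_integral_cong)
    fix \<omega>
    have "(\<Sum>j\<in>UNIV. jumps_to m j \<omega> * F j (\<omega>, holding m \<omega>)) =
      (\<Sum>j\<in>UNIV. if state (Suc m) \<omega> = j
         then indicator {\<omega>. tau (Suc m) \<omega> < \<infinity>} \<omega> * F j (\<omega>, holding m \<omega>) else 0)"
      by (intro sum.cong) (auto simp: indicator_def)
    also have "\<dots> = indicator {\<omega>. tau (Suc m) \<omega> < \<infinity>} \<omega> * F (state (Suc m) \<omega>) (\<omega>, holding m \<omega>)"
      by simp
    finally show "(\<Sum>j\<in>UNIV. jumps_to m j \<omega> * F j (\<omega>, holding m \<omega>)) =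
        not_hit (Suc m) x0 \<omega> * ?h (state (Suc m) \<omega>) (ell (Suc m) \<omega>)"
      by (auto simp: F_def indicator_def less_Suc_eq_le)
  qed
  also note Suc.IH[of "Suc m"]
  finally show ?case by (simp only: add_Suc add_Suc_right)
qed

lemma hit_expect_first_hit:
  assumes f [measurable]: "f \<in> borel_measurable field_space"
  shows "(\<integral>\<^sup>+\<omega>. indicator {\<omega>. first_hit (\<lambda>t. Y t \<omega>) x0 n} \<omega> * f (ell n \<omega>) \<partial>M) =
    hit_expect \<rho> x0 n z (\<lambda>_. 0) f"
proof -
  have "AE \<omega> in M. state 0 \<omega> = z"
    using jp by (simp add: jump_process_def jump_state_def)
  then have "(\<integral>\<^sup>+\<omega>. hit_expect \<rho> x0 n (state 0 \<omega>) (\<lambda>_. 0) f \<partial>M) =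
      (\<integral>\<^sup>+\<omega>. hit_expect \<rho> x0 n z (\<lambda>_. 0) f \<partial>M)"
    by (intro nn_integral_cong_AE) auto
  then show ?thesis
    using hit_expect_chain[OF f, where m = 0 and n = n and ?x0.0 = x0] by (simp add: emeasure_space_1)
qed

lemma first_hit_unique: "first_hit y x m \<Longrightarrow> first_hit y x n \<Longrightarrow> m = n"
  by (metis first_hit_def linorder_neqE_nat)

lemma pred_first_hit [measurable]: "Measurable.pred M (\<lambda>\<omega>. first_hit (\<lambda>t. Y t \<omega>) x0 n)"
  unfolding first_hit_def by measurable

text \<open>The events that \<open>x0\<close> is first hit at the \<open>n\<close>-th jump are disjoint, and the assumption \<open>mass\<close>
  says that one of them occurs almost surely. On each of them the hitting time is a jump time, and
  the local times there are those accumulated over finitely many holding times.\<close>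

theorem nn_integral_local_time_hitting:
  assumes f [measurable]: "f \<in> borel_measurable field_space"
    and mass: "1 \<le> (\<Sum>n. hit_expect \<rho> x0 n z (\<lambda>_. 0) (\<lambda>_. 1))"
  shows "(\<integral>\<^sup>+\<omega>. f (hitting_local_time (\<lambda>t. Y t \<omega>) x0) \<partial>M) =
    (\<Sum>n. hit_expect \<rho> x0 n z (\<lambda>_. 0) f)"
proof -
  let ?H = "\<lambda>n. {\<omega>\<in>space M. first_hit (\<lambda>t. Y t \<omega>) x0 n}"
  have [measurable]: "(\<lambda>\<omega>. indicator {\<omega>. first_hit (\<lambda>t. Y t \<omega>) x0 n} \<omega> :: ennreal) \<in> borel_measurable M" for n
    unfolding indicator_def by measurable
  have eH: "emeasure M (?H n) = hit_expect \<rho> x0 n z (\<lambda>_. 0) (\<lambda>_. 1)" for n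
  proof -
    have "emeasure M (?H n) = (\<integral>\<^sup>+\<omega>. indicator (?H n) \<omega> \<partial>M)" by simp
    also have "\<dots> = (\<integral>\<^sup>+\<omega>. indicator {\<omega>. first_hit (\<lambda>t. Y t \<omega>) x0 n} \<omega> * 1 \<partial>M)"
      by (intro nn_integral_cong) (auto simp: indicator_def)
    also have "\<dots> = hit_expect \<rho> x0 n z (\<lambda>_. 0) (\<lambda>_. 1)"
      by (rule hit_expect_first_hit) simp
    finally show ?thesis .
  qed
  have "emeasure M (\<Union>n. ?H n) = (\<Sum>n. emeasure M (?H n))"
    by (intro suminf_emeasure[symmetric]) (auto simp: disjoint_family_on_def dest: first_hit_unique)
  then have "1 \<le> emeasure M (\<Union>n. ?H n)" using mass by (simp only: eH)
  then have "emeasure M (\<Union>n. ?H n) = 1" using emeasure_le_1[of "\<Union>n. ?H n"] by (rule antisym[rotated])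
  then have "AE \<omega> in M. \<omega> \<in> (\<Union>n. ?H n)"
    by (intro AE_prob_1) (simp add: measure_def)
  then have "(\<integral>\<^sup>+\<omega>. f (hitting_local_time (\<lambda>t. Y t \<omega>) x0) \<partial>M) =
    (\<integral>\<^sup>+\<omega>. (\<Sum>n. indicator {\<omega>. first_hit (\<lambda>t. Y t \<omega>) x0 n} \<omega> * f (ell n \<omega>)) \<partial>M)"
  proof (intro nn_integral_cong_AE, eventually_elim)
    fix \<omega> assume "\<omega> \<in> (\<Union>n. ?H n)"
    then obtain n where \<omega>: "\<omega> \<in> space M" and n: "first_hit (\<lambda>t. Y t \<omega>) x0 n" by auto
    have "tau n \<omega> < \<infinity>" using n unfolding first_hit_def by blast
    then have "hitting_local_time (\<lambda>t. Y t \<omega>) x0 = ell n \<omega>"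
      using local_time_jump_time[OF Y_rc[OF \<omega>]] by (simp only: hitting_time_first_hit[OF n])
    moreover have "(\<Sum>m. indicator {\<omega>. first_hit (\<lambda>t. Y t \<omega>) x0 m} \<omega> * f (ell m \<omega>)) = f (ell n \<omega>)"
    proof -
      have "(\<Sum>m. indicator {\<omega>. first_hit (\<lambda>t. Y t \<omega>) x0 m} \<omega> * f (ell m \<omega>)) =
          (\<Sum>m\<in>{n}. indicator {\<omega>. first_hit (\<lambda>t. Y t \<omega>) x0 m} \<omega> * f (ell m \<omega>))"
        using n by (intro suminf_finite) (auto simp: indicator_def dest: first_hit_unique)
      then show ?thesis using n by simp
    qed
    ultimately show "f (hitting_local_time (\<lambda>t. Y t \<omega>) x0) =
        (\<Sum>n. indicator {\<omega>. first_hit (\<lambda>t. Y t \<omega>) x0 n} \<omega> * f (ell n \<omega>))" by simp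
  qed
  also have "\<dots> = (\<Sum>n. hit_expect \<rho> x0 n z (\<lambda>_. 0) f)"
    by (subst nn_integral_suminf) (auto simp: hit_expect_first_hit)
  finally show ?thesis .
qed

end

lemma local_time_jump_processI:
  assumes "jump_process M \<rho> z Y" "\<And>i j. (\<lambda>l. \<rho> l i j) \<in> borel_measurable field_space"
  shows "local_time_jump_process M Y \<rho> z"
proof
  show "Y t \<in> M \<rightarrow>\<^sub>M count_space UNIV" if "0 \<le> t" for t
    using assms(1) that by (simp add: jump_process_def)
  show "right_continuous_path (\<lambda>t. Y t \<omega>)" if "\<omega> \<in> space M" for \<omega>
    using assms(1) that by (simp add: jump_process_def right_continuous_path_def)
qed (use assms in auto)

section \<open>The descent operators\<close>

lemma measurable_const_field [measurable]: "(\<lambda>_. L) \<in> N \<rightarrow>\<^sub>M (field_space :: ('v \<Rightarrow> real) measure)"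
  by (rule measurable_const) (simp add: space_PiM)

lemma nn_integral_exp_le:
  assumes "0 < a" "0 < b"
  shows "(\<integral>\<^sup>+v. indicator {0<..<b} v * ennreal (exp (a * (T - b + v))) \<partial>lborel) \<le> ennreal (exp (a * T) / a)"
proof -
  have "(\<integral>\<^sup>+v. indicator {0<..<b} v * ennreal (exp (a * (T - b + v))) \<partial>lborel) \<le>
     (\<integral>\<^sup>+v. ennreal (exp (a * (T - b + v))) * indicator {0..b} v \<partial>lborel)"
    by (intro nn_integral_mono) (auto simp: indicator_def)
  also have "\<dots> = ennreal (exp (a * (T - b + b)) / a - exp (a * (T - b + 0)) / a)"
    using assms by (intro nn_integral_FTC_Icc) (auto intro!: derivative_eq_intros)
  also have "\<dots> \<le> ennreal (exp (a * T) / a)"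
    using assms by (intro ennreal_leI) simp
  finally show ?thesis .
qed

locale conductance_graph =
  fixes E :: "'v::finite set set" and W :: "'v set \<Rightarrow> real" and x0 :: 'v
  assumes graph: "weighted_graph E W"
begin

abbreviation c :: "'v \<Rightarrow> 'v \<Rightarrow> real" where
  "c \<equiv> conductance E W"

lemma c_nonneg: "0 \<le> c i j"
  using graph by (auto simp: weighted_graph_def conductance_def less_imp_le)

lemma c_sym: "c i j = c j i"
  by (simp add: conductance_def insert_commute)

lemma c_diag [simp]: "c i i = 0"
  using graph by (force simp: weighted_graph_def conductance_def)

lemma vertex_induct:
  assumes "P x0" "\<And>i j. P j \<Longrightarrow> 0 < c i j \<Longrightarrow> P i"
  shows "P i"
proof -
  have "(i, x0) \<in> {(a, b). {a, b} \<in> E}\<^sup>*"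
    using graph by (auto simp: weighted_graph_def)
  then show ?thesis
  proof (induction rule: converse_rtrancl_induct)
    case (step i j)
    then have "0 < c i j" using graph by (auto simp: weighted_graph_def conductance_def)
    with step assms(2) show ?case by blast
  qed (rule assms(1))
qed

definition positive_fields :: "('v \<Rightarrow> real) set" where
  "positive_fields = {L. \<forall>x. 0 < L x}"

lemma positive_fieldsD: "L \<in> positive_fields \<Longrightarrow> 0 < L x"
  by (simp add: positive_fields_def)

lemma positive_fields_upd: "L \<in> positive_fields \<Longrightarrow> 0 < v \<Longrightarrow> L(i := v) \<in> positive_fields"
  by (simp add: positive_fields_def)

lemma sets_positive_fields [measurable]: "positive_fields \<in> sets field_space"
proof -
  have "Measurable.pred field_space (\<lambda>L :: 'v \<Rightarrow> real. \<forall>x. 0 < L x)" by measurable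
  then show ?thesis by (simp add: pred_def positive_fields_def space_PiM)
qed

text \<open>Integrates out the value \<open>v\<close> to which the field at \<open>i\<close> descends during one visit of \<open>i\<close>. The jump
  rates of the reversed process contain the field at the vertex that is entered. This factor is
  attached here to the visit of that vertex, as \<open>L i\<close> at the beginning of the visit: only with this
  choice do the operators of different vertices commute.\<close>

definition lower :: "'v \<Rightarrow> (('v \<Rightarrow> real) \<Rightarrow> ennreal) \<Rightarrow> ('v \<Rightarrow> real) \<Rightarrow> ennreal" where
  "lower i k L = ennreal (L i) * (\<integral>\<^sup>+v. indicator {0<..<L i} v * k (L(i := v)) \<partial>lborel)"

lemma measurable_lower_integrand:
  fixes k :: "('v \<Rightarrow> real) \<Rightarrow> ennreal"
  assumes k: "k \<in> borel_measurable field_space" and f: "f \<in> N \<rightarrow>\<^sub>M field_space"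
  shows "(\<lambda>p. indicator {0<..<f (fst p) i} (snd p) * k ((f (fst p))(i := snd p)))
     \<in> borel_measurable (N \<Otimes>\<^sub>M (borel :: real measure))"
proof -
  have [measurable]: "(\<lambda>p. f (fst p) i) \<in> borel_measurable (N \<Otimes>\<^sub>M (borel :: real measure))"
    by (rule measurable_compose[OF measurable_compose[OF measurable_fst f]]) simp
  have [measurable]: "(\<lambda>p. k ((f (fst p))(i := snd p))) \<in> borel_measurable (N \<Otimes>\<^sub>M (borel :: real measure))"
    by (rule measurable_compose[OF _ k]) (use f in measurable)
  have eq: "(\<lambda>p. indicator {0<..<f (fst p) i} (snd p) * k ((f (fst p))(i := snd p))) =
     (\<lambda>p. if 0 < snd p \<and> snd p < f (fst p) i then k ((f (fst p))(i := snd p)) else 0)"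
    by (auto split: split_indicator)
  show ?thesis unfolding eq by measurable
qed

lemma measurable_lower_slice:
  fixes k :: "('v \<Rightarrow> real) \<Rightarrow> ennreal"
  assumes k: "k \<in> borel_measurable field_space"
  shows "(\<lambda>v. k (L(i := v))) \<in> borel_measurable (borel :: real measure)"
  by (rule measurable_compose[OF _ k]) measurable

lemma measurable_lower [measurable]:
  assumes [measurable]: "k \<in> borel_measurable field_space"
  shows "lower i k \<in> borel_measurable field_space"
proof -
  have "(\<lambda>p. indicator {0<..<fst p i} (snd p) * k ((fst p)(i := snd p)))
      \<in> borel_measurable (field_space \<Otimes>\<^sub>M lborel)"
    using measurable_lower_integrand[OF assms measurable_ident] by simp
  then show ?thesis unfolding lower_def by measurable
qed

lemma lower_mono:
  assumes "\<And>v. 0 < v \<Longrightarrow> v < L i \<Longrightarrow> k (L(i := v)) \<le> k' (L(i := v))"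
  shows "lower i k L \<le> lower i k' L"
  unfolding lower_def
  by (rule mult_left_mono[OF nn_integral_mono]) (auto simp: assms split: split_indicator)

lemma lower_cong:
  assumes "\<And>v. 0 < v \<Longrightarrow> v < L i \<Longrightarrow> k (L(i := v)) = k' (L(i := v))"
  shows "lower i k L = lower i k' L"
  by (intro antisym lower_mono) (simp_all add: assms)

lemma lower_add:
  assumes [measurable]: "k \<in> borel_measurable field_space" "k' \<in> borel_measurable field_space"
  shows "lower i (\<lambda>L. k L + k' L) L = lower i k L + lower i k' L"
  using assms[THEN measurable_lower_slice] unfolding lower_def by (simp add: nn_integral_add distrib_left)

lemma lower_cmult:
  assumes [measurable]: "k \<in> borel_measurable field_space"
  shows "lower i (\<lambda>L. a * k L) L = a * lower i k L"
  using assms[THEN measurable_lower_slice] unfolding lower_def by (simp add: nn_integral_cmult mult.left_commute)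

lemma lower_sum:
  assumes [measurable]: "\<And>j. k j \<in> borel_measurable field_space"
  shows "lower i (\<lambda>L. \<Sum>j\<in>A. k j L) L = (\<Sum>j\<in>A. lower i (k j) L)"
  using assms[THEN measurable_lower_slice] unfolding lower_def by (simp add: sum_distrib_left nn_integral_sum)

lemma lower_suminf:
  assumes "\<And>n. k n \<in> borel_measurable field_space"
  shows "lower i (\<lambda>L. \<Sum>n. k n L) L = (\<Sum>n. lower i (k n) L)"
proof -
  have meas: "(\<lambda>v. indicator {0<..<L i} v * k n (L(i := v))) \<in> borel_measurable lborel" for n
    using measurable_lower_slice[OF assms, of n L i] by simp
  have "(\<integral>\<^sup>+v. indicator {0<..<L i} v * (\<Sum>n. k n (L(i := v))) \<partial>lborel) =
      (\<integral>\<^sup>+v. (\<Sum>n. indicator {0<..<L i} v * k n (L(i := v))) \<partial>lborel)"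
    by simp
  also have "\<dots> = (\<Sum>n. \<integral>\<^sup>+v. indicator {0<..<L i} v * k n (L(i := v)) \<partial>lborel)"
    by (rule nn_integral_suminf) (rule meas)
  finally show ?thesis unfolding lower_def by simp
qed

lemma lower_commute:
  assumes [measurable]: "k \<in> borel_measurable field_space"
  shows "lower i (lower j k) L = lower j (lower i k) L"
proof (cases "i = j")
  case False
  have k2: "(\<lambda>p. k (L(a := fst p, b := snd p))) \<in> borel_measurable (lborel \<Otimes>\<^sub>M lborel)" for a b
    by (rule measurable_compose[OF _ assms]) measurable
  note [measurable] = k2[of i j]
  have iter: "lower a (lower b k) L = ennreal (L a) * (ennreal (L b) * (\<integral>\<^sup>+v. \<integral>\<^sup>+w. indicator {0<..<L a} v *
      (indicator {0<..<L b} w * k (L(a := v, b := w))) \<partial>lborel \<partial>lborel))" if "a \<noteq> b" for a b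
  proof -
    note [measurable] = k2[of a b]
    have [measurable]: "(\<lambda>w. k (L(a := v, b := w))) \<in> borel_measurable borel" for v
      by (rule measurable_lower_slice[OF assms])
    have "(\<integral>\<^sup>+v. indicator {0<..<L a} v * lower b k (L(a := v)) \<partial>lborel) =
      (\<integral>\<^sup>+v. ennreal (L b) * (\<integral>\<^sup>+w. indicator {0<..<L a} v *
      (indicator {0<..<L b} w * k (L(a := v, b := w))) \<partial>lborel) \<partial>lborel)"
      using that by (simp add: lower_def nn_integral_cmult mult.left_commute)
    also have "\<dots> = ennreal (L b) * (\<integral>\<^sup>+v. \<integral>\<^sup>+w. indicator {0<..<L a} v *
      (indicator {0<..<L b} w * k (L(a := v, b := w))) \<partial>lborel \<partial>lborel)"
      by (rule nn_integral_cmult) measurable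
    finally show ?thesis by (simp add: lower_def[of a])
  qed
  have "(\<integral>\<^sup>+v. \<integral>\<^sup>+w. indicator {0<..<L i} v *
      (indicator {0<..<L j} w * k (L(i := v, j := w))) \<partial>lborel \<partial>lborel) =
    (\<integral>\<^sup>+w. \<integral>\<^sup>+v. indicator {0<..<L i} v *
      (indicator {0<..<L j} w * k (L(i := v, j := w))) \<partial>lborel \<partial>lborel)"
    by (rule lborel_pair.Fubini') (use k2[of i j] in \<open>simp add: split_def\<close>)
  also have "\<dots> = (\<integral>\<^sup>+w. \<integral>\<^sup>+v. indicator {0<..<L j} w *
      (indicator {0<..<L i} v * k (L(j := w, i := v))) \<partial>lborel \<partial>lborel)"
    by (simp only: fun_upd_twist[OF False] mult.left_commute)
  finally show ?thesis
    unfolding iter[OF False] iter[OF False[symmetric]]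
    by (simp only: mult.left_commute[of "indicator {0<..<L i} _"] mult.left_commute[of "ennreal (L i)"])
qed simp

text \<open>Expanded, this is a sum over the paths of \<open>n\<close> steps from \<open>i\<close> that reach \<open>x0\<close> for the first time at
  their end: the conductances along the path times the operators \<open>lower\<close> of the vertices before \<open>x0\<close>,
  applied in the order of the path. At the end the factor \<open>L x0\<close> of the entrance to \<open>x0\<close> remains.\<close>

primrec descent :: "nat \<Rightarrow> 'v \<Rightarrow> (('v \<Rightarrow> real) \<Rightarrow> ennreal) \<Rightarrow> ('v \<Rightarrow> real) \<Rightarrow> ennreal" where
  "descent 0 i k L = (if i = x0 then ennreal (L x0) * k L else 0)"
| "descent (Suc n) i k L = (if i = x0 then 0 else \<Sum>j\<in>UNIV. ennreal (c i j) * lower i (descent n j k) L)"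

lemma measurable_descent [measurable]:
  assumes [measurable]: "k \<in> borel_measurable field_space"
  shows "descent n i k \<in> borel_measurable field_space"
proof (induction n arbitrary: i)
  case 0
  have "(\<lambda>L. descent 0 i k L) \<in> borel_measurable field_space" by (cases "i = x0") simp_all
  then show ?case by simp
next
  case (Suc n)
  note [measurable] = Suc.IH
  have "(\<lambda>L. descent (Suc n) i k L) \<in> borel_measurable field_space" by (cases "i = x0") simp_all
  then show ?case by simp
qed

text \<open>All the operators that occur in \<open>descent\<close> belong to vertices other than \<open>x0\<close>; they commute with
  \<open>lower i\<close>, and so does the multiplication by \<open>L x0\<close> if \<open>i \<noteq> x0\<close>.\<close>

lemma descent_lower:
  assumes k [measurable]: "k \<in> borel_measurable field_space" and "i \<noteq> x0"
  shows "descent n j (lower i k) L = lower i (descent n j k) L"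
proof (induction n arbitrary: j L)
  case 0
  have "lower i (\<lambda>L. ennreal (L x0) * k L) L = ennreal (L x0) * lower i k L"
  proof -
    have "lower i (\<lambda>L. ennreal (L x0) * k L) L = lower i (\<lambda>L'. ennreal (L x0) * k L') L"
      using \<open>i \<noteq> x0\<close> by (intro lower_cong) simp
    then show ?thesis by (simp add: lower_cmult)
  qed
  moreover have "lower i (\<lambda>_. 0) L = 0" by (simp add: lower_def)
  ultimately show ?case by (simp cong: if_cong)
next
  case (Suc n)
  show ?case
  proof (cases "j = x0")
    case True
    have "lower i (\<lambda>_. 0) L = 0" by (simp add: lower_def)
    then show ?thesis using True by simp
  next
    case False
    have IH: "descent n j' (lower i k) = lower i (descent n j' k)" for j'
      by (rule ext) (rule Suc.IH)
    have "descent (Suc n) j (lower i k) L = (\<Sum>j'\<in>UNIV. ennreal (c j j') * lower j (lower i (descent n j' k)) L)"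
      using False by (simp add: IH)
    also have "\<dots> = (\<Sum>j'\<in>UNIV. lower i (\<lambda>L. ennreal (c j j') * lower j (descent n j' k) L) L)"
      by (simp add: lower_cmult lower_commute[of _ j i])
    also have "\<dots> = lower i (\<lambda>L. \<Sum>j'\<in>UNIV. ennreal (c j j') * lower j (descent n j' k) L) L"
      by (simp add: lower_sum)
    also have "\<dots> = lower i (descent (Suc n) j k) L"
      using False by (intro lower_cong) simp
    finally show ?thesis .
  qed
qed

lemma descent_Suc_right:
  assumes [measurable]: "k \<in> borel_measurable field_space"
  shows "descent (Suc n) i k L =
    (if i = x0 then 0 else \<Sum>j\<in>UNIV. ennreal (c i j) * descent n j (lower i k) L)"
  by (cases "i = x0") (simp_all add: descent_lower)

text \<open>Each \<open>lower i\<close> is an integral over the field at \<open>i\<close> up to its present value. On the functions bounded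
  by \<open>exp (a * (\<Sum>x\<in>UNIV. L x))\<close> it therefore gains a factor of order \<open>1 / a\<close>, and on a bounded set of
  fields the right-hand side of the inequality is a contraction by the factor \<open>1 / 2\<close> once \<open>a\<close> is
  large. Iterating the inequality forces \<open>k = 0\<close>.\<close>

lemma subsolution_eq_0:
  assumes boundary: "\<And>L. L \<in> positive_fields \<Longrightarrow> k x0 L = 0"
    and sub: "\<And>i L. i \<noteq> x0 \<Longrightarrow> L \<in> positive_fields \<Longrightarrow> k i L \<le> (\<Sum>j\<in>UNIV. ennreal (c i j) * lower i (k j) L)"
    and bounded: "\<And>S. \<exists>C\<ge>0. \<forall>i. \<forall>L\<in>positive_fields. (\<forall>x. L x \<le> S) \<longrightarrow> k i L \<le> ennreal C"
    and L: "L \<in> positive_fields"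
  shows "k i L = 0"
proof -
  define S where "S = (\<Sum>x\<in>UNIV. L x)"
  have L_le: "L x \<le> S" for x
    unfolding S_def using positive_fieldsD[OF L] by (intro member_le_sum) (auto intro: less_imp_le)
  have S: "0 < S" using L_le[of x0] positive_fieldsD[OF L, of x0] by simp
  define K where "K = (\<Sum>i\<in>UNIV. \<Sum>j\<in>UNIV. c i j)"
  have K: "0 \<le> K" "(\<Sum>j\<in>UNIV. c i j) \<le> K" for i
    unfolding K_def using c_nonneg by (auto intro!: sum_nonneg member_le_sum[of i UNIV "\<lambda>i. \<Sum>j\<in>UNIV. c i j"])
  \<comment> \<open>one application of the operators multiplies the bound by at most \<open>K * S / a \<le> 1 / 2\<close>\<close>
  define a where "a = 2 * K * S + 1"
  have a: "0 < a" using K(1) S by (simp add: a_def add_nonneg_pos)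
  obtain C where C: "0 \<le> C" "\<And>i L. L \<in> positive_fields \<Longrightarrow> (\<And>x. L x \<le> S) \<Longrightarrow> k i L \<le> ennreal C"
    using bounded[of S] by blast
  have bound: "k i L \<le> ennreal (C * (1/2) ^ n * exp (a * (\<Sum>x\<in>UNIV. L x)))"
    if "L \<in> positive_fields" "\<And>x. L x \<le> S" for n i L
    using that
  proof (induction n arbitrary: i L)
    case 0
    have "1 \<le> exp (a * (\<Sum>x\<in>UNIV. L x))"
      using a 0 by (auto intro!: mult_nonneg_nonneg sum_nonneg simp: positive_fields_def less_imp_le)
    then have "C \<le> C * (1/2) ^ 0 * exp (a * (\<Sum>x\<in>UNIV. L x))"
      using C(1) mult_left_mono[of 1 "exp (a * (\<Sum>x\<in>UNIV. L x))" C] by simp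
    then show ?case using C(2)[OF 0] by (meson ennreal_leI order_trans)
  next
    case (Suc n)
    define T where "T = (\<Sum>x\<in>UNIV. L x)"
    define D where "D = C * (1/2) ^ n"
    have D: "0 \<le> D" using C(1) by (simp add: D_def)
    show ?case
    proof (cases "i = x0")
      case True
      then show ?thesis using boundary[OF Suc.prems(1)] by simp
    next
      case False
      have Li: "0 < L i" using Suc.prems(1) by (rule positive_fieldsD)
      have low: "lower i (k j) L \<le> ennreal (S * (D * (exp (a * T) / a)))" for j
      proof -
        have T': "(\<Sum>x\<in>UNIV. (L(i := v)) x) = T - L i + v" for v
        proof -
          have "(\<Sum>x\<in>UNIV. (L(i := v)) x) = (\<Sum>x\<in>UNIV. L x + (if x = i then v - L i else 0))"
            by (intro sum.cong) auto
          then show ?thesis by (simp add: sum.distrib T_def)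
        qed
        have "lower i (k j) L \<le> lower i (\<lambda>L. ennreal (D * exp (a * (\<Sum>x\<in>UNIV. L x)))) L"
        proof (rule lower_mono)
          fix v assume v: "0 < v" "v < L i"
          have "(L(i := v)) x \<le> S" for x using Suc.prems(2)[of x] Suc.prems(2)[of i] v by simp
          then show "k j (L(i := v)) \<le> ennreal (D * exp (a * (\<Sum>x\<in>UNIV. (L(i := v)) x)))"
            unfolding D_def by (intro Suc.IH positive_fields_upd Suc.prems v)
        qed
        also have "\<dots> = ennreal (L i) * (ennreal D *
            (\<integral>\<^sup>+v. indicator {0<..<L i} v * ennreal (exp (a * (T - L i + v))) \<partial>lborel))"
          using D unfolding lower_def T'
          by (subst nn_integral_cmult[symmetric]) (auto simp: ennreal_mult' mult.left_commute)
        also have "\<dots> \<le> ennreal S * (ennreal D * ennreal (exp (a * T) / a))"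
          using nn_integral_exp_le[OF a Li, of T] Suc.prems(2)[of i]
          by (intro mult_mono ennreal_leI) auto
        also have "\<dots> = ennreal (S * (D * (exp (a * T) / a)))"
          using S D a by (simp add: ennreal_mult del: times_divide_eq_right)
        finally show ?thesis .
      qed
      have "k i L \<le> (\<Sum>j\<in>UNIV. ennreal (c i j) * lower i (k j) L)"
        by (rule sub[OF False Suc.prems(1)])
      also have "\<dots> \<le> (\<Sum>j\<in>UNIV. ennreal (c i j) * ennreal (S * (D * (exp (a * T) / a))))"
        by (intro sum_mono mult_left_mono low) simp
      also have "\<dots> = ennreal ((\<Sum>j\<in>UNIV. c i j) * (S * (D * (exp (a * T) / a))))"
        using c_nonneg by (simp only: sum_distrib_right[symmetric] sum_ennreal ennreal_mult' sum_nonneg)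
      also have "\<dots> \<le> ennreal (D * (1/2) * exp (a * T))"
      proof (rule ennreal_leI)
        have "(\<Sum>j\<in>UNIV. c i j) * (S * (D * (exp (a * T) / a))) \<le> K * (S * (D * (exp (a * T) / a)))"
          using K S D a by (intro mult_right_mono) auto
        also have "\<dots> = (K * S / a) * (D * exp (a * T))" by simp
        also have "\<dots> \<le> (1/2) * (D * exp (a * T))"
        proof (rule mult_right_mono)
          show "K * S / a \<le> 1 / 2" using a by (simp add: a_def field_simps)
        qed (use D in simp)
        finally show "(\<Sum>j\<in>UNIV. c i j) * (S * (D * (exp (a * T) / a))) \<le> D * (1/2) * exp (a * T)"
          by simp
      qed
      finally show ?thesis by (simp add: D_def T_def mult.commute mult.left_commute)
    qed
  qed
  have "(\<lambda>n. ennreal (C * (1/2) ^ n * exp (a * (\<Sum>x\<in>UNIV. L x)))) \<longlonglongrightarrow> ennreal (C * 0 * exp (a * (\<Sum>x\<in>UNIV. L x)))"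
    by (intro tendsto_ennrealI tendsto_intros LIMSEQ_power_zero) auto
  then have "k i L \<le> ennreal (C * 0 * exp (a * (\<Sum>x\<in>UNIV. L x)))"
    by (rule LIMSEQ_le_const) (use bound[OF L L_le] in blast)
  then show ?thesis by simp
qed

end

section \<open>Magnetizations of the Ising model\<close>

context conductance_graph
begin

definition gibbs :: "('v \<Rightarrow> real) \<Rightarrow> real" where
  "gibbs \<psi> = exp ((\<Sum>x\<in>UNIV. \<Sum>y\<in>UNIV. c x y * \<psi> x * \<psi> y) / 2)"

text \<open>The magnetization at \<open>i\<close> of the Ising model with couplings \<open>c x y * L x * L y\<close>, before it is divided
  by the partition function; at \<open>i = x0\<close>, where the spin is \<open>1\<close>, it is the partition function.\<close>

definition spin_sum :: "('v \<Rightarrow> real) \<Rightarrow> 'v \<Rightarrow> real" where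
  "spin_sum L i = (\<Sum>\<sigma>\<in>spins x0. \<sigma> i * gibbs (\<lambda>x. \<sigma> x * L x))"

lemma finite_spins [simp]: "finite (spins x0)"
proof (rule finite_subset)
  show "spins x0 \<subseteq> Pi\<^sub>E UNIV (\<lambda>_. {-1, 1})" by (auto simp: spins_def)
qed (auto intro: finite_PiE)

lemma spins_nonempty [simp]: "spins x0 \<noteq> {}"
proof -
  have "(\<lambda>_. 1) \<in> spins x0" by (simp add: spins_def)
  then show ?thesis by blast
qed

lemma spin_square: "\<sigma> \<in> spins x0 \<Longrightarrow> \<sigma> x * \<sigma> x = 1"
  by (auto simp: spins_def) (metis insert_iff mult_1 mult_minus1 minus_minus singletonD)

lemma spin_abs: "\<sigma> \<in> spins x0 \<Longrightarrow> \<bar>\<sigma> x\<bar> = 1"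
  using spin_square[of \<sigma> x] by (auto simp: abs_if square_eq_1_iff)

lemma spin_root: "\<sigma> \<in> spins x0 \<Longrightarrow> \<sigma> x0 = 1"
  by (simp add: spins_def)

lemma gibbs_pos: "0 < gibbs \<psi>"
  by (simp add: gibbs_def)

lemma spin_sum_root_pos: "0 < spin_sum L x0"
  unfolding spin_sum_def by (intro sum_pos) (auto simp: gibbs_pos spin_root)

text \<open>The exponent of \<open>gibbs\<close> is affine in each coordinate, because there are no loops.\<close>

lemma quadratic_form_upd:
  "(\<Sum>x\<in>UNIV. \<Sum>y\<in>UNIV. c x y * (\<psi>(i := v)) x * (\<psi>(i := v)) y) / 2 =
   (\<Sum>x\<in>UNIV. \<Sum>y\<in>UNIV. c x y * (\<psi>(i := 0)) x * (\<psi>(i := 0)) y) / 2 + v * (\<Sum>j\<in>UNIV. c i j * \<psi> j)"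
proof -
  define p where "p = \<psi>(i := 0)"
  define d where "d x = (if x = i then v else 0)" for x
  have upd: "(\<psi>(i := v)) x = p x + d x" for x by (simp add: p_def d_def)
  have cp: "c i y * p y = c i y * \<psi> y" for y by (simp add: p_def)
  have "(\<Sum>x\<in>UNIV. \<Sum>y\<in>UNIV. c x y * (p x + d x) * (p y + d y)) =
     (\<Sum>x\<in>UNIV. \<Sum>y\<in>UNIV. c x y * p x * p y) + (\<Sum>x\<in>UNIV. \<Sum>y\<in>UNIV. c x y * d x * p y)
     + (\<Sum>x\<in>UNIV. \<Sum>y\<in>UNIV. c x y * p x * d y) + (\<Sum>x\<in>UNIV. \<Sum>y\<in>UNIV. c x y * d x * d y)"
    by (simp add: sum.distrib algebra_simps)
  moreover have "(\<Sum>x\<in>UNIV. \<Sum>y\<in>UNIV. c x y * d x * p y) = v * (\<Sum>j\<in>UNIV. c i j * \<psi> j)"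
  proof -
    have "(\<Sum>x\<in>UNIV. \<Sum>y\<in>UNIV. c x y * d x * p y) = (\<Sum>x\<in>UNIV. if x = i then \<Sum>y\<in>UNIV. v * (c i y * p y) else 0)"
      by (intro sum.cong) (auto simp: d_def mult_ac)
    then show ?thesis by (simp add: cp sum_distrib_left)
  qed
  moreover have "(\<Sum>x\<in>UNIV. \<Sum>y\<in>UNIV. c x y * p x * d y) = (\<Sum>x\<in>UNIV. \<Sum>y\<in>UNIV. c x y * d x * p y)"
    by (subst sum.swap) (simp only: c_sym mult_ac)
  moreover have "(\<Sum>x\<in>UNIV. \<Sum>y\<in>UNIV. c x y * d x * d y) = 0"
    by (intro sum.neutral ballI) (auto simp: d_def)
  ultimately show ?thesis unfolding upd by (simp add: p_def add_divide_distrib)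
qed

lemma gibbs_upd: "gibbs (\<psi>(i := v)) = gibbs (\<psi>(i := 0)) * exp (v * (\<Sum>j\<in>UNIV. c i j * \<psi> j))"
  unfolding gibbs_def by (subst quadratic_form_upd) (rule exp_add)

lemma has_derivative_gibbs:
  "((\<lambda>v. gibbs (\<lambda>x. \<sigma> x * (L(i := v)) x)) has_real_derivative
     gibbs (\<lambda>x. \<sigma> x * (L(i := v)) x) * (\<sigma> i * (\<Sum>j\<in>UNIV. c i j * (\<sigma> j * L j)))) (at v)"
proof -
  have eq: "gibbs (\<lambda>x. \<sigma> x * (L(i := v)) x) = gibbs ((\<lambda>x. \<sigma> x * L x)(i := 0)) *
      exp (v * (\<sigma> i * (\<Sum>j\<in>UNIV. c i j * (\<sigma> j * L j))))" for v
  proof -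
    have "(\<lambda>x. \<sigma> x * (L(i := v)) x) = (\<lambda>x. \<sigma> x * L x)(i := \<sigma> i * v)" by auto
    then show ?thesis using gibbs_upd[of "\<lambda>x. \<sigma> x * L x" i "\<sigma> i * v"] by (simp add: mult_ac)
  qed
  show ?thesis unfolding eq by (auto intro!: derivative_eq_intros)
qed

lemma has_derivative_spin_sum_general:
  "((\<lambda>v. spin_sum (L(i := v)) k) has_real_derivative
     (\<Sum>\<sigma>\<in>spins x0. \<sigma> k * (gibbs (\<lambda>x. \<sigma> x * (L(i := v)) x) * (\<sigma> i * (\<Sum>j\<in>UNIV. c i j * (\<sigma> j * L j)))))) (at v)"
  unfolding spin_sum_def by (intro DERIV_sum DERIV_cmult has_derivative_gibbs)

lemma isCont_spin_sum [continuous_intros]: "isCont (\<lambda>v. spin_sum (L(i := v)) k) v"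
  by (rule DERIV_isCont[OF has_derivative_spin_sum_general])

text \<open>Differentiating the weight of \<open>\<sigma>\<close> in \<open>L i\<close> brings down \<open>\<sigma> i * (\<Sum>j\<in>UNIV. c i j * \<sigma> j * L j)\<close>, and the
  factor \<open>\<sigma> i\<close> cancels against the one in \<open>spin_sum\<close>.\<close>

lemma has_derivative_spin_sum:
  "((\<lambda>v. spin_sum (L(i := v)) i) has_real_derivative
     (\<Sum>j\<in>UNIV. c i j * L j * spin_sum (L(i := v)) j)) (at v)"
proof -
  have "(\<Sum>\<sigma>\<in>spins x0. \<sigma> i * (gibbs (\<lambda>x. \<sigma> x * (L(i := v)) x) * (\<sigma> i * (\<Sum>j\<in>UNIV. c i j * (\<sigma> j * L j))))) =
    (\<Sum>\<sigma>\<in>spins x0. \<Sum>j\<in>UNIV. c i j * L j * (\<sigma> j * gibbs (\<lambda>x. \<sigma> x * (L(i := v)) x)))"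
  proof (rule sum.cong[OF refl])
    fix \<sigma> assume "\<sigma> \<in> spins x0"
    define g where "g = gibbs (\<lambda>x. \<sigma> x * (L(i := v)) x)"
    have "\<sigma> i * (g * (\<sigma> i * (\<Sum>j\<in>UNIV. c i j * (\<sigma> j * L j)))) =
        (\<sigma> i * \<sigma> i) * (g * (\<Sum>j\<in>UNIV. c i j * (\<sigma> j * L j)))"
      by (simp only: mult_ac)
    also have "\<dots> = (\<Sum>j\<in>UNIV. c i j * L j * (\<sigma> j * g))"
      using spin_square[OF \<open>\<sigma> \<in> spins x0\<close>] by (simp add: sum_distrib_left mult_ac)
    finally show "\<sigma> i * (gibbs (\<lambda>x. \<sigma> x * (L(i := v)) x) * (\<sigma> i * (\<Sum>j\<in>UNIV. c i j * (\<sigma> j * L j)))) =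
       (\<Sum>j\<in>UNIV. c i j * L j * (\<sigma> j * gibbs (\<lambda>x. \<sigma> x * (L(i := v)) x)))"
      by (simp only: g_def)
  qed
  also have "\<dots> = (\<Sum>j\<in>UNIV. c i j * L j * spin_sum (L(i := v)) j)"
    by (subst sum.swap) (simp add: spin_sum_def sum_distrib_left)
  finally show ?thesis using has_derivative_spin_sum_general[of L i i v] by simp
qed

text \<open>For \<open>L i = 0\<close> the spin at \<open>i\<close> decouples, so flipping it is a symmetry.\<close>

lemma spin_sum_zero:
  assumes "i \<noteq> x0"
  shows "spin_sum (L(i := 0)) i = 0"
proof -
  have flip: "\<sigma>(i := - \<sigma> i) \<in> spins x0" if "\<sigma> \<in> spins x0" for \<sigma>
  proof -
    have \<sigma>: "\<sigma> x = -1 \<or> \<sigma> x = 1" "\<sigma> x0 = 1" for x using that by (simp_all add: spins_def)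
    have "(\<sigma>(i := - \<sigma> i)) x \<in> {-1, 1}" for x using \<sigma>(1)[of x] by (cases "x = i") auto
    with \<sigma>(2) assms show ?thesis by (simp add: spins_def)
  qed
  have "spin_sum (L(i := 0)) i = (\<Sum>\<sigma>\<in>spins x0. - (\<sigma> i * gibbs (\<lambda>x. \<sigma> x * (L(i := 0)) x)))"
    unfolding spin_sum_def
  proof (rule sum.reindex_bij_witness[of _ "\<lambda>\<sigma>. \<sigma>(i := - \<sigma> i)" "\<lambda>\<sigma>. \<sigma>(i := - \<sigma> i)"])
    fix \<sigma>
    have "(\<lambda>x. (\<sigma>(i := - \<sigma> i)) x * (L(i := 0)) x) = (\<lambda>x. \<sigma> x * (L(i := 0)) x)" by auto
    then show "- ((\<sigma>(i := - \<sigma> i)) i * gibbs (\<lambda>x. (\<sigma>(i := - \<sigma> i)) x * (L(i := 0)) x)) =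
        \<sigma> i * gibbs (\<lambda>x. \<sigma> x * (L(i := 0)) x)" by simp
    show "(\<sigma>(i := - \<sigma> i))(i := - (\<sigma>(i := - \<sigma> i)) i) = \<sigma>" by simp
    then show "(\<sigma>(i := - \<sigma> i))(i := - (\<sigma>(i := - \<sigma> i)) i) = \<sigma>" .
  qed (rule flip, assumption)+
  also have "\<dots> = - spin_sum (L(i := 0)) i" by (simp add: spin_sum_def sum_negf)
  finally show ?thesis by simp
qed

lemma spin_sum_integral:
  assumes "i \<noteq> x0" "0 \<le> L i"
  defines "g \<equiv> \<lambda>v. indicator {0<..<L i} v * (\<Sum>j\<in>UNIV. c i j * L j * spin_sum (L(i := v)) j)"
  shows "integrable lborel g" "(\<integral>v. g v \<partial>lborel) = spin_sum L i"
proof -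
  let ?G = "\<lambda>v. \<Sum>j\<in>UNIV. c i j * L j * spin_sum (L(i := v)) j"
  have cont: "isCont ?G v" for v by (intro continuous_intros)
  have Gint: "integrable lborel (\<lambda>v. ?G v * indicator {0..L i} v)"
    by (rule borel_integrable_atLeastAtMost) (rule cont)
  have int: "(\<integral>v. ?G v * indicator {0..L i} v \<partial>lborel) = spin_sum (L(i := L i)) i - spin_sum (L(i := 0)) i"
    by (rule integral_FTC_Icc_real[OF assms(2)]) (rule has_derivative_spin_sum, rule cont)
  have ae: "AE v in lborel. ?G v * indicator {0..L i} v = g v"
    using AE_lborel_singleton[of 0] AE_lborel_singleton[of "L i"]
    by eventually_elim (auto simp: g_def split: split_indicator)
  have G: "?G \<in> borel_measurable borel"
    by (rule borel_measurable_continuous_onI) (simp add: continuous_at_imp_continuous_on cont)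
  have ind: "indicat_real A \<in> borel_measurable lborel" if "A \<in> sets borel" for A
    using that by simp
  have g: "g \<in> borel_measurable lborel"
    unfolding g_def by (rule borel_measurable_times[OF ind]) (simp_all only: measurable_lborel2 G borel_open open_greaterThanLessThan)
  have Gi: "(\<lambda>v. ?G v * indicator {0..L i} v) \<in> borel_measurable lborel"
    by (rule borel_measurable_times[OF _ ind]) (simp_all only: measurable_lborel2 G borel_closed closed_atLeastAtMost)
  show "integrable lborel g"
    using integrable_cong_AE[OF Gi g ae] Gint by (rule iffD1)
  have "(\<integral>v. ?G v * indicator {0..L i} v \<partial>lborel) = (\<integral>v. g v \<partial>lborel)"
    by (rule integral_cong_AE[OF Gi g ae])
  with int spin_sum_zero[OF assms(1), of L] show "(\<integral>v. g v \<partial>lborel) = spin_sum L i" by simp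
qed

lemma measurable_gibbs [measurable]:
  assumes [measurable]: "\<And>x. (\<lambda>\<omega>. f \<omega> x) \<in> borel_measurable N"
  shows "(\<lambda>\<omega>. gibbs (\<lambda>x. a x * f \<omega> x)) \<in> borel_measurable N"
  unfolding gibbs_def by measurable

lemma measurable_spin_sum [measurable]: "(\<lambda>L. spin_sum L i) \<in> borel_measurable field_space"
  unfolding spin_sum_def by measurable

lemma spin_sum_bounded:
  "\<exists>C\<ge>0. \<forall>i. \<forall>L\<in>positive_fields. (\<forall>x. L x \<le> S) \<longrightarrow> \<bar>L i * spin_sum L i\<bar> \<le> C"
proof (intro exI conjI allI ballI impI)
  let ?e = "exp ((\<Sum>x\<in>UNIV. \<Sum>y\<in>UNIV. c x y * S * S) / 2)"
  show "0 \<le> \<bar>S\<bar> * (card (spins x0) * ?e)" by simp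
  fix i L assume pos: "L \<in> positive_fields" and "\<forall>x. L x \<le> S"
  then have L: "0 < L x" "L x \<le> S" for x by (auto dest: positive_fieldsD)
  have "\<bar>spin_sum L i\<bar> \<le> (\<Sum>\<sigma>\<in>spins x0. \<bar>\<sigma> i * gibbs (\<lambda>x. \<sigma> x * L x)\<bar>)"
    unfolding spin_sum_def by (rule sum_abs)
  also have "\<dots> \<le> (\<Sum>\<sigma>\<in>spins x0. ?e)"
  proof (rule sum_mono)
    fix \<sigma> assume \<sigma>: "\<sigma> \<in> spins x0"
    have "c x y * (\<sigma> x * L x) * (\<sigma> y * L y) \<le> c x y * S * S" for x y
    proof -
      have "(\<sigma> x * L x) * (\<sigma> y * L y) \<le> \<bar>(\<sigma> x * L x) * (\<sigma> y * L y)\<bar>" by (rule abs_ge_self)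
      also have "\<dots> = L x * L y"
        using spin_abs[OF \<sigma>] L(1) by (simp add: abs_mult less_imp_le)
      also have "\<dots> \<le> S * S"
        using L[of x] L[of y] by (intro mult_mono) auto
      finally show ?thesis using mult_left_mono[OF _ c_nonneg] by (simp add: mult.assoc)
    qed
    then have "gibbs (\<lambda>x. \<sigma> x * L x) \<le> ?e"
      unfolding gibbs_def by (auto intro!: sum_mono divide_right_mono)
    then show "\<bar>\<sigma> i * gibbs (\<lambda>x. \<sigma> x * L x)\<bar> \<le> ?e"
      using spin_abs[OF \<sigma>] gibbs_pos by (simp add: abs_mult less_imp_le)
  qed
  finally have "\<bar>spin_sum L i\<bar> \<le> card (spins x0) * ?e" by simp
  then have "\<bar>L i\<bar> * \<bar>spin_sum L i\<bar> \<le> \<bar>S\<bar> * (card (spins x0) * ?e)"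
    using L[of i] by (intro mult_mono) auto
  then show "\<bar>L i * spin_sum L i\<bar> \<le> \<bar>S\<bar> * (card (spins x0) * ?e)" by (simp only: abs_mult)
qed

text \<open>The differential equation of \<open>spin_sum\<close> in integrated form, for the positive part of a multiple.
  The sign \<open>\<epsilon> = - 1\<close> serves to prove positivity, \<open>\<epsilon> = 1\<close> to bound the total mass of the descents from
  below.\<close>

lemma spin_sum_subsolution:
  fixes \<epsilon> :: real
  assumes i: "i \<noteq> x0" and L: "L \<in> positive_fields"
  defines "k \<equiv> \<lambda>j L. ennreal (\<epsilon> * (L j * spin_sum L j))"
  shows "k i L \<le> (\<Sum>j\<in>UNIV. ennreal (c i j) * lower i (k j) L)"
proof -
  have Lp: "0 < L x" for x using L by (rule positive_fieldsD)
  let ?g = "\<lambda>v. indicator {0<..<L i} v * (\<Sum>j\<in>UNIV. c i j * L j * spin_sum (L(i := v)) j)"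
  let ?k = "\<lambda>j v. indicator {0<..<L i} v * k j (L(i := v))"
  have int: "integrable lborel ?g" "(\<integral>v. ?g v \<partial>lborel) = spin_sum L i"
    using spin_sum_integral[OF i, of L] Lp by (auto simp: less_imp_le)
  have sum_le: "ennreal (sum f A) \<le> (\<Sum>j\<in>A. ennreal (f j))" if "finite A" for f :: "'v \<Rightarrow> real" and A
    using that
  proof (induction A rule: finite_induct)
    case (insert x A)
    have "ennreal (f x + sum f A) \<le> ennreal (f x) + ennreal (sum f A)"
      by (cases "0 \<le> f x"; cases "0 \<le> sum f A")
         (auto simp: ennreal_plus[symmetric] ennreal_neg simp del: ennreal_plus intro!: ennreal_leI)
    with insert show ?case by (simp add: add_left_mono order_trans)
  qed simp
  have "\<epsilon> * spin_sum L i = (\<integral>v. \<epsilon> * ?g v \<partial>lborel)" using int by simp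
  also have "\<dots> \<le> (\<integral>v. max 0 (\<epsilon> * ?g v) \<partial>lborel)"
    using int by (intro integral_mono integrable_max) auto
  finally have "ennreal (\<epsilon> * spin_sum L i) \<le> ennreal (\<integral>v. max 0 (\<epsilon> * ?g v) \<partial>lborel)"
    by (rule ennreal_leI)
  also have "\<dots> = (\<integral>\<^sup>+v. ennreal (max 0 (\<epsilon> * ?g v)) \<partial>lborel)"
    using int by (intro nn_integral_eq_integral[symmetric] integrable_max) auto
  also have "\<dots> \<le> (\<integral>\<^sup>+v. (\<Sum>j\<in>UNIV. ennreal (c i j) * ?k j v) \<partial>lborel)"
  proof (rule nn_integral_mono)
    fix v
    show "ennreal (max 0 (\<epsilon> * ?g v)) \<le> (\<Sum>j\<in>UNIV. ennreal (c i j) * ?k j v)"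
    proof (cases "v \<in> {0<..<L i}")
      case True
      have "ennreal (max 0 (\<epsilon> * ?g v)) = ennreal (\<epsilon> * ?g v)"
        by (simp add: max_def ennreal_neg)
      also have "\<dots> = ennreal (\<Sum>j\<in>UNIV. \<epsilon> * (c i j * L j * spin_sum (L(i := v)) j))"
        using True by (simp add: sum_distrib_left)
      also have "\<dots> \<le> (\<Sum>j\<in>UNIV. ennreal (\<epsilon> * (c i j * L j * spin_sum (L(i := v)) j)))"
        by (rule sum_le) simp
      also have "\<dots> = (\<Sum>j\<in>UNIV. ennreal (c i j) * ?k j v)"
      proof (rule sum.cong[OF refl])
        fix j
        show "ennreal (\<epsilon> * (c i j * L j * spin_sum (L(i := v)) j)) = ennreal (c i j) * ?k j v"
          using True c_nonneg[of i j] by (cases "j = i") (auto simp: k_def ennreal_mult'[symmetric] mult_ac)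
      qed
      finally show ?thesis .
    qed simp
  qed
  also have "\<dots> = (\<Sum>j\<in>UNIV. ennreal (c i j) * (\<integral>\<^sup>+v. ?k j v \<partial>lborel))"
  proof -
    have k: "k j \<in> borel_measurable field_space" for j
      unfolding k_def by measurable
    have [measurable]: "(\<lambda>v. k j (L(i := v))) \<in> borel_measurable borel" for j
      by (rule measurable_lower_slice[OF k])
    show ?thesis
      by (subst nn_integral_sum) (auto simp: nn_integral_cmult)
  qed
  finally have *: "ennreal (\<epsilon> * spin_sum L i) \<le> (\<Sum>j\<in>UNIV. ennreal (c i j) * (\<integral>\<^sup>+v. ?k j v \<partial>lborel))" .
  have "k i L = ennreal (L i) * ennreal (\<epsilon> * spin_sum L i)"
    using Lp[of i] by (simp add: k_def ennreal_mult'[symmetric] mult_ac)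
  also have "\<dots> \<le> ennreal (L i) * (\<Sum>j\<in>UNIV. ennreal (c i j) * (\<integral>\<^sup>+v. ?k j v \<partial>lborel))"
    by (rule mult_left_mono[OF *]) simp
  also have "\<dots> = (\<Sum>j\<in>UNIV. ennreal (c i j) * lower i (k j) L)"
    by (simp add: lower_def sum_distrib_left mult.left_commute)
  finally show ?thesis .
qed

text \<open>Griffiths' inequality: the negative parts form a subsolution that vanishes at \<open>x0\<close>.\<close>

lemma spin_sum_nonneg:
  assumes "L \<in> positive_fields"
  shows "0 \<le> spin_sum L i"
proof -
  define k where "k i L = ennreal (-1 * (L i * spin_sum L i))" for i L
  have "k i L = 0"
  proof (rule subsolution_eq_0[OF _ _ _ assms])
    show "k x0 L = 0" if "L \<in> positive_fields" for L
      using positive_fieldsD[OF that, of x0] spin_sum_root_pos[of L]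
      by (simp add: k_def ennreal_neg less_imp_le)
    show "k i L \<le> (\<Sum>j\<in>UNIV. ennreal (c i j) * lower i (k j) L)" if "i \<noteq> x0" "L \<in> positive_fields" for i L
      using spin_sum_subsolution[OF that, of "-1"] by (simp only: k_def[abs_def])
    show "\<exists>C\<ge>0. \<forall>i. \<forall>L\<in>positive_fields. (\<forall>x. L x \<le> S) \<longrightarrow> k i L \<le> ennreal C" for S
    proof -
      obtain C where C: "0 \<le> C" "\<And>i L. L \<in> positive_fields \<Longrightarrow> \<forall>x. L x \<le> S \<Longrightarrow> \<bar>L i * spin_sum L i\<bar> \<le> C"
        using spin_sum_bounded[of S] by blast
      then show ?thesis unfolding k_def mult_minus1 by (meson abs_le_D2 ennreal_leI)
    qed
  qed
  then have "L i * spin_sum L i \<ge> 0" by (simp add: k_def ennreal_eq_0_iff)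
  with positive_fieldsD[OF assms, of i] show ?thesis by (simp add: zero_le_mult_iff)
qed

end

context conductance_graph
begin

lemma spin_sum_pos:
  assumes "L \<in> positive_fields"
  shows "0 < spin_sum L i"
proof -
  have "\<forall>L\<in>positive_fields. 0 < spin_sum L i"
  proof (induction i rule: vertex_induct)
    case 1
    then show ?case by (simp add: spin_sum_root_pos)
  next
    case (2 i j)
    show ?case
    proof (cases "i = x0")
      case False
      show "\<forall>L\<in>positive_fields. 0 < spin_sum L i"
      proof
        fix L assume L: "L \<in> positive_fields"
        have "spin_sum (L(i := 0)) i < spin_sum (L(i := L i)) i"
        proof (rule DERIV_pos_imp_increasing_open[where f = "\<lambda>v. spin_sum (L(i := v)) i"])
          show "0 < L i" using L by (rule positive_fieldsD)
          show "continuous_on {0..L i} (\<lambda>v. spin_sum (L(i := v)) i)"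
            by (intro continuous_at_imp_continuous_on ballI isCont_spin_sum)
          fix v assume v: "0 < v" "v < L i"
          have L': "L(i := v) \<in> positive_fields" using L v(1) by (rule positive_fields_upd)
          have "0 < c i j * L j * spin_sum (L(i := v)) j"
            using 2 L' positive_fieldsD[OF L, of j] by (intro mult_pos_pos) auto
          also have "\<dots> \<le> (\<Sum>j\<in>UNIV. c i j * L j * spin_sum (L(i := v)) j)"
          proof (rule member_le_sum)
            show "0 \<le> c i x * L x * spin_sum (L(i := v)) x" for x
              by (intro mult_nonneg_nonneg c_nonneg spin_sum_nonneg[OF L'] less_imp_le[OF positive_fieldsD[OF L]])
          qed simp_all
          finally show "\<exists>y. ((\<lambda>v. spin_sum (L(i := v)) i) has_real_derivative y) (at v) \<and> 0 < y"
            using has_derivative_spin_sum by blast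
        qed
        then show "0 < spin_sum L i" using spin_sum_zero[OF False, of L] by simp
      qed
    qed (simp add: spin_sum_root_pos)
  qed
  then show ?thesis using assms by blast
qed

text \<open>The normaliser of the reversed process. The factor \<open>L i\<close> is the one that \<open>descent\<close> carries for the
  starting vertex.\<close>

definition spin_mass :: "'v \<Rightarrow> ('v \<Rightarrow> real) \<Rightarrow> ennreal" where
  "spin_mass i L = ennreal (L i * spin_sum L i)"

lemma measurable_spin_mass [measurable]: "spin_mass i \<in> borel_measurable field_space"
  unfolding spin_mass_def by measurable

text \<open>The sum of all descents of the partition function satisfies the integrated equation with equality
  and has the value \<open>spin_mass x0\<close> at \<open>x0\<close>. The positive part of the difference is therefore a
  subsolution that vanishes at \<open>x0\<close>. Probabilistically, the reversed process reaches \<open>x0\<close> before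
  it is stopped.\<close>

lemma spin_mass_le_descent:
  assumes L: "L \<in> positive_fields"
  shows "spin_mass i L \<le> (\<Sum>n. descent n i (\<lambda>L. ennreal (spin_sum L x0)) L)"
proof -
  define Z where "Z L = ennreal (spin_sum L x0)" for L
  have Z [measurable]: "Z \<in> borel_measurable field_space"
    unfolding Z_def by measurable
  define T where "T i L = (\<Sum>n. descent n i Z L)" for i L
  have T [measurable]: "T i \<in> borel_measurable field_space" for i
    unfolding T_def by measurable
  have T_root: "T x0 L = spin_mass x0 L" if "L \<in> positive_fields" for L
  proof -
    have "T x0 L = (\<Sum>n\<in>{0}. descent n x0 Z L)"
      unfolding T_def
    proof (rule suminf_finite)
      show "descent n x0 Z L = 0" if "n \<notin> {0}" for n using that by (cases n) auto
    qed simp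
    then show ?thesis using positive_fieldsD[OF that, of x0]
      by (simp add: spin_mass_def Z_def ennreal_mult')
  qed
  have T_step: "T i L = (\<Sum>j\<in>UNIV. ennreal (c i j) * lower i (T j) L)" if "i \<noteq> x0" for i L
  proof -
    have "T i L = (\<Sum>n. descent (Suc n) i Z L)"
      unfolding T_def using that by (subst suminf_offset[of _ 1]) auto
    also have "\<dots> = (\<Sum>n. \<Sum>j\<in>UNIV. ennreal (c i j) * lower i (descent n j Z) L)"
      using that by simp
    also have "\<dots> = (\<Sum>j\<in>UNIV. \<Sum>n. ennreal (c i j) * lower i (descent n j Z) L)"
      by (rule suminf_sum) simp
    also have "\<dots> = (\<Sum>j\<in>UNIV. ennreal (c i j) * lower i (T j) L)"
      unfolding T_def by (simp add: lower_suminf)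
    finally show ?thesis .
  qed
  define k where "k i L = spin_mass i L - T i L" for i L
  have k_meas [measurable]: "k i \<in> borel_measurable field_space" for i
    unfolding k_def by measurable
  have "k i L = 0"
  proof (rule subsolution_eq_0[OF _ _ _ L])
    show "k x0 L = 0" if "L \<in> positive_fields" for L
      using T_root[OF that] by (simp add: k_def spin_mass_def)
    show "\<exists>C\<ge>0. \<forall>i. \<forall>L\<in>positive_fields. (\<forall>x. L x \<le> S) \<longrightarrow> k i L \<le> ennreal C" for S
      using spin_sum_bounded[of S] unfolding k_def spin_mass_def
      by (meson abs_le_D1 diff_le_self_ennreal ennreal_leI order_trans)
    fix i L assume i: "i \<noteq> x0" and L: "L \<in> positive_fields"
    have "spin_mass i L \<le> (\<Sum>j\<in>UNIV. ennreal (c i j) * lower i (spin_mass j) L)"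
      using spin_sum_subsolution[OF i L, of 1] by (simp add: spin_mass_def[abs_def])
    also have "\<dots> \<le> (\<Sum>j\<in>UNIV. ennreal (c i j) * lower i (\<lambda>L. k j L + T j L) L)"
    proof (intro sum_mono mult_left_mono lower_mono)
      fix j v
      have "spin_mass j (L(i := v)) < \<top>" by (simp add: spin_mass_def)
      then show "spin_mass j (L(i := v)) \<le> k j (L(i := v)) + T j (L(i := v))"
        unfolding k_def
        by (cases "spin_mass j (L(i := v)) \<le> T j (L(i := v))")
           (auto simp: diff_add_cancel_ennreal intro: order_trans)
    qed simp
    also have "\<dots> = (\<Sum>j\<in>UNIV. ennreal (c i j) * lower i (k j) L) + T i L"
      by (simp add: lower_add T_step[OF i] distrib_left sum.distrib)
    finally have "spin_mass i L \<le> T i L + (\<Sum>j\<in>UNIV. ennreal (c i j) * lower i (k j) L)"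
      by (simp add: add.commute)
    then show "k i L \<le> (\<Sum>j\<in>UNIV. ennreal (c i j) * lower i (k j) L)"
      unfolding k_def by (simp add: ennreal_minus_le_iff spin_mass_def add.commute)
  qed
  then have "spin_mass i L \<le> T i L"
    by (simp add: k_def diff_eq_0_iff_ennreal)
  then show ?thesis by (simp add: T_def Z_def[abs_def])
qed

section \<open>The reversed process\<close>

lemma ising_weight_eq: "ising_weight E (interaction E W L) \<sigma> = gibbs (\<lambda>x. \<sigma> x * L x)"
proof -
  have "(\<Sum>(i, j)\<in>{(i, j). {i, j} \<in> E}. interaction E W L i j * \<sigma> i * \<sigma> j) =
      (\<Sum>(i, j)\<in>UNIV \<times> UNIV. c i j * (\<sigma> i * L i) * (\<sigma> j * L j))"
    by (rule sum.mono_neutral_cong_left) (auto simp: interaction_def conductance_def mult_ac split: if_splits)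
  then show ?thesis by (simp add: ising_weight_def gibbs_def sum.cartesian_product)
qed

lemma spin_sum_root: "spin_sum L x0 = (\<Sum>\<sigma>\<in>spins x0. gibbs (\<lambda>x. \<sigma> x * L x))"
  unfolding spin_sum_def by (intro sum.cong) (simp_all add: spin_root)

lemma ising_eq: "ising E (interaction E W L) x0 =
    point_measure (spins x0) (\<lambda>\<sigma>. ennreal (gibbs (\<lambda>x. \<sigma> x * L x) / spin_sum L x0))"
  unfolding ising_def ising_weight_eq spin_sum_root ..

lemma magnetization_eq: "magnetization E W x0 L i = spin_sum L i / spin_sum L x0"
proof -
  have "magnetization E W x0 L i = (\<Sum>\<sigma>\<in>spins x0. (gibbs (\<lambda>x. \<sigma> x * L x) / spin_sum L x0) * \<sigma> i)"
    unfolding magnetization_def ising_eq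
    by (subst lebesgue_integral_point_measure_finite)
       (auto intro!: divide_nonneg_nonneg simp: gibbs_pos spin_sum_root_pos less_imp_le)
  also have "\<dots> = spin_sum L i / spin_sum L x0"
    by (simp add: spin_sum_def[of _ i] sum_divide_distrib mult.commute)
  finally show ?thesis .
qed

lemma check_rate_eq:
  "check_rate E W x0 \<Phi> l i j = (if (\<lambda>x. \<Phi> x - l x) \<in> positive_fields
     then c i j * (\<Phi> j - l j) * spin_sum (\<lambda>x. \<Phi> x - l x) j / spin_sum (\<lambda>x. \<Phi> x - l x) i else 0)"
  using spin_sum_root_pos[of "\<lambda>x. \<Phi> x - l x"]
  by (simp add: check_rate_def Let_def positive_fields_def magnetization_eq)

lemma measurable_minus_field [measurable]:
  "(\<lambda>l x. \<Phi> x - l x) \<in> field_space \<rightarrow>\<^sub>M (field_space :: ('v \<Rightarrow> real) measure)"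
  by (rule measurable_PiM_single') auto

lemma measurable_check_rate: "(\<lambda>l. check_rate E W x0 \<Phi> l i j) \<in> borel_measurable field_space"
proof -
  have [measurable]: "(\<lambda>l. spin_sum (\<lambda>x. \<Phi> x - l x) i) \<in> borel_measurable field_space" for i
    by (rule measurable_compose[OF measurable_minus_field measurable_spin_sum])
  have [measurable]: "Measurable.pred field_space (\<lambda>l. (\<lambda>x. \<Phi> x - l x) \<in> positive_fields)"
    by (rule pred_sets2[OF sets_positive_fields measurable_minus_field])
  show ?thesis unfolding check_rate_eq by measurable
qed

text \<open>The total rate at \<open>i\<close> after a holding time \<open>v\<close> is minus the derivative of
  \<open>ln (spin_sum (L(i := L i - v)) i)\<close>, so the exponential in the jump density is a quotient of two values
  of \<open>spin_sum\<close>, and its numerator cancels against the denominator of the rate.\<close>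

lemma check_jump_density:
  assumes L: "(\<lambda>x. \<Phi> x - l x) \<in> positive_fields" and i: "i \<noteq> x0" and u: "0 < u"
  defines "L \<equiv> \<lambda>x. \<Phi> x - l x"
  shows "jump_density (check_rate E W x0 \<Phi>) l i j u =
    (if u < L i then c i j * L j * spin_sum (L(i := L i - u)) j / spin_sum L i else 0)"
proof -
  have shift: "(\<lambda>x. \<Phi> x - (l(i := l i + v)) x) = L(i := L i - v)" for v
    by (auto simp: L_def)
  have LP: "L \<in> positive_fields" using L by (simp add: L_def)
  show ?thesis
  proof (cases "u < L i")
    case False
    then have "L(i := L i - u) \<notin> positive_fields" by (auto simp: positive_fields_def)
    then have "check_rate E W x0 \<Phi> (l(i := l i + u)) i j = 0"
      unfolding check_rate_eq shift by simp
    then show ?thesis using False by (simp add: jump_density_def)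
  next
    case True
    let ?h = "\<lambda>v k. spin_sum (L(i := L i - v)) k"
    let ?R = "\<lambda>v. \<Sum>k\<in>UNIV. c i k * L k * ?h v k / ?h v i"
    have pos: "L(i := L i - v) \<in> positive_fields" if "v \<le> u" for v
      using that True by (intro positive_fields_upd LP) simp
    have hpos: "0 < ?h v k" if "v \<le> u" for v k
      by (rule spin_sum_pos[OF pos[OF that]])
    have rate: "check_rate E W x0 \<Phi> (l(i := l i + v)) i k = c i k * L k * ?h v k / ?h v i" if "v \<le> u" for v k
    proof -
      have "\<Phi> k - (l(i := l i + v)) k = (L(i := L i - v)) k" using fun_cong[OF shift, of k v] by simp
      then show ?thesis
        unfolding check_rate_eq shift using pos[OF that] by (cases "k = i") simp_all
    qed
    have "(\<integral>v\<in>{0..u}. (\<Sum>k\<in>UNIV. check_rate E W x0 \<Phi> (l(i := l i + v)) i k) \<partial>lborel) =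
        (\<integral>v. ?R v * indicator {0..u} v \<partial>lborel)"
      unfolding set_lebesgue_integral_def
      by (intro Bochner_Integration.integral_cong) (auto simp: rate split: split_indicator)
    also have "\<dots> = (- ln (?h u i)) - (- ln (?h 0 i))"
    proof (rule integral_FTC_Icc_real)
      show "0 \<le> u" using u by simp
      fix v assume v: "0 \<le> v" "v \<le> u"
      have d: "((\<lambda>v. ?h v k) has_real_derivative D * (-1)) (at v)"
        if "((\<lambda>v. spin_sum (L(i := v)) k) has_real_derivative D) (at (L i - v))" for k D
        by (rule DERIV_chain'[of "\<lambda>v. L i - v", OF _ that]) (auto intro!: derivative_eq_intros)
      have "((\<lambda>v. - ln (?h v i)) has_real_derivative
          - ((1 / ?h v i) * ((\<Sum>j\<in>UNIV. c i j * L j * ?h v j) * (-1)))) (at v)"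
        using hpos[OF v(2), of i] by (intro DERIV_minus DERIV_chain'[OF d[OF has_derivative_spin_sum]] DERIV_ln_divide)
      then show "((\<lambda>v. - ln (?h v i)) has_real_derivative ?R v) (at v)"
        by (simp add: sum_divide_distrib)
      have "isCont (\<lambda>v. ?h v k) v" for k
        by (rule DERIV_isCont[OF d[OF has_derivative_spin_sum_general]])
      then show "isCont ?R v"
        using hpos[OF v(2), of i] by (intro continuous_intros) auto
    qed
    also have "\<dots> = ln (spin_sum L i) - ln (?h u i)" by simp
    finally have "exp (- (\<integral>v\<in>{0..u}. (\<Sum>k\<in>UNIV. check_rate E W x0 \<Phi> (l(i := l i + v)) i k) \<partial>lborel)) =
        ?h u i / spin_sum L i"
      using hpos[of u i] spin_sum_pos[OF LP, of i] by (simp add: exp_diff)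
    then show ?thesis
      using True hpos[of u i] unfolding jump_density_def by (simp add: rate)
  qed
qed

lemma nn_integral_reflect:
  fixes F :: "real \<Rightarrow> ennreal"
  assumes [measurable]: "F \<in> borel_measurable borel"
  shows "(\<integral>\<^sup>+u. indicator {0<..<b} u * F (b - u) \<partial>lborel) = (\<integral>\<^sup>+v. indicator {0<..<b} v * F v \<partial>lborel)"
proof -
  have "(\<integral>\<^sup>+v. indicator {0<..<b} v * F v \<partial>lborel) =
      ennreal \<bar>-1\<bar> * (\<integral>\<^sup>+u. indicator {0<..<b} (b + (-1) * u) * F (b + (-1) * u) \<partial>lborel)"
    by (rule nn_integral_real_affine) auto
  also have "\<dots> = (\<integral>\<^sup>+u. indicator {0<..<b} u * F (b - u) \<partial>lborel)"
    by (simp, intro nn_integral_cong) (auto split: split_indicator)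
  finally show ?thesis by simp
qed

text \<open>With \<open>v = L i - u\<close> as the new variable, the jump densities along a path multiply to the kernel of
  \<open>descent\<close>, times the quotient of the partition function at the end by \<open>spin_mass\<close> at the start.\<close>

lemma hit_expect_check:
  assumes f [measurable]: "f \<in> borel_measurable field_space"
    and L: "(\<lambda>x. \<Phi> x - l x) \<in> positive_fields"
  shows "spin_mass i (\<lambda>x. \<Phi> x - l x) * hit_expect (check_rate E W x0 \<Phi>) x0 n i l f =
    descent n i (\<lambda>L. ennreal (spin_sum L x0) * f (\<lambda>x. \<Phi> x - L x)) (\<lambda>x. \<Phi> x - l x)"
  using L
proof (induction n arbitrary: i l)
  case 0
  then show ?case
    using positive_fieldsD[OF 0, of x0] by (simp add: spin_mass_def ennreal_mult' mult.assoc)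
next
  case (Suc n)
  define L where "L = (\<lambda>x. \<Phi> x - l x)"
  have LP: "L \<in> positive_fields" using Suc.prems by (simp add: L_def)
  define k where "k = (\<lambda>L. ennreal (spin_sum L x0) * f (\<lambda>x. \<Phi> x - L x))"
  have [measurable]: "(\<lambda>L. f (\<lambda>x. \<Phi> x - L x)) \<in> borel_measurable field_space"
    by (rule measurable_compose[OF measurable_minus_field f])
  have [measurable]: "k \<in> borel_measurable field_space" unfolding k_def by measurable
  let ?H = "\<lambda>j l. hit_expect (check_rate E W x0 \<Phi>) x0 n j l f"
  show ?case
  proof (cases "i = x0")
    case False
    have hi: "0 < spin_sum L i" "0 < L i"
      using spin_sum_pos[OF LP] positive_fieldsD[OF LP] by auto
    have summand: "spin_mass i L * (\<integral>\<^sup>+u. indicator {0<..} u *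
          ennreal (jump_density (check_rate E W x0 \<Phi>) l i j u) * ?H j (l(i := l i + u)) \<partial>lborel) =
        ennreal (c i j) * lower i (descent n j k) L" for j
    proof -
      have [measurable]: "(\<lambda>v. descent n j k (L(i := v))) \<in> borel_measurable borel"
        by (rule measurable_lower_slice) simp
      have [measurable]: "(\<lambda>u. descent n j k (L(i := L i - u))) \<in> borel_measurable borel"
        by (rule measurable_compose[of "\<lambda>u. L i - u" borel borel "\<lambda>v. descent n j k (L(i := v))"]) simp_all
      have "(\<integral>\<^sup>+u. indicator {0<..} u *
          ennreal (jump_density (check_rate E W x0 \<Phi>) l i j u) * ?H j (l(i := l i + u)) \<partial>lborel) =
        (\<integral>\<^sup>+u. ennreal (c i j / spin_sum L i) * (indicator {0<..<L i} u * descent n j k (L(i := L i - u))) \<partial>lborel)"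
      proof (rule nn_integral_cong)
        fix u
        have shift: "(\<lambda>x. \<Phi> x - (l(i := l i + u)) x) = L(i := L i - u)"
          by (auto simp: L_def)
        have dens: "jump_density (check_rate E W x0 \<Phi>) l i j u =
          (if u < L i then c i j * L j * spin_sum (L(i := L i - u)) j / spin_sum L i else 0)" if "0 < u"
          using check_jump_density[OF Suc.prems False that] by (simp add: L_def)
        show "indicator {0<..} u *
            ennreal (jump_density (check_rate E W x0 \<Phi>) l i j u) * ?H j (l(i := l i + u)) =
          ennreal (c i j / spin_sum L i) * (indicator {0<..<L i} u * descent n j k (L(i := L i - u)))"
        proof (cases "0 < u \<and> u < L i")
          case True
          then have L': "L(i := L i - u) \<in> positive_fields" by (intro positive_fields_upd LP) simp
          have IH: "spin_mass j (L(i := L i - u)) * ?H j (l(i := l i + u)) = descent n j k (L(i := L i - u))"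
            using Suc.IH[of "l(i := l i + u)" j] L' unfolding shift k_def .
          have eq: "c i j * L j * spin_sum (L(i := L i - u)) j / spin_sum L i =
              (c i j / spin_sum L i) * ((L(i := L i - u)) j * spin_sum (L(i := L i - u)) j)"
            by (cases "j = i") simp_all
          have "jump_density (check_rate E W x0 \<Phi>) l i j u =
              (c i j / spin_sum L i) * ((L(i := L i - u)) j * spin_sum (L(i := L i - u)) j)"
            unfolding eq[symmetric] using True dens by simp
          then have "ennreal (jump_density (check_rate E W x0 \<Phi>) l i j u) =
              ennreal (c i j / spin_sum L i) * spin_mass j (L(i := L i - u))"
            using hi c_nonneg[of i j] by (simp only: spin_mass_def ennreal_mult' divide_nonneg_pos)
          with True show ?thesis by (simp add: mult.assoc IH)
        qed (use dens in \<open>auto split: split_indicator\<close>)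
      qed
      also have "\<dots> = ennreal (c i j / spin_sum L i) *
          (\<integral>\<^sup>+v. indicator {0<..<L i} v * descent n j k (L(i := v)) \<partial>lborel)"
        by (subst nn_integral_cmult) (simp_all add: nn_integral_reflect[of "\<lambda>v. descent n j k (L(i := v))"])
      finally show ?thesis
      proof (simp only:)
        have "spin_mass i L * ennreal (c i j / spin_sum L i) = ennreal (c i j) * ennreal (L i)"
          using hi c_nonneg[of i j] by (simp add: spin_mass_def ennreal_mult'[symmetric] mult.commute)
        then show "spin_mass i L * (ennreal (c i j / spin_sum L i) *
            (\<integral>\<^sup>+v. indicator {0<..<L i} v * descent n j k (L(i := v)) \<partial>lborel)) =
          ennreal (c i j) * lower i (descent n j k) L"
          by (simp only: lower_def mult.assoc[symmetric])
      qed
    qed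
    have "spin_mass i L * hit_expect (check_rate E W x0 \<Phi>) x0 (Suc n) i l f =
        (\<Sum>j\<in>UNIV. spin_mass i L * (\<integral>\<^sup>+u. indicator {0<..} u *
          ennreal (jump_density (check_rate E W x0 \<Phi>) l i j u) * ?H j (l(i := l i + u)) \<partial>lborel))"
      using False by (simp add: sum_distrib_left)
    also have "\<dots> = descent (Suc n) i k L"
      using False by (simp add: summand)
    finally show ?thesis by (simp only: L_def k_def)
  qed simp
qed

lemma nn_integral_check_local_time:
  assumes \<Phi>: "\<Phi> \<in> positive_fields" and cp: "check_process N E W x0 \<Phi> z Y"
    and f [measurable]: "f \<in> borel_measurable field_space"
  shows "spin_mass z \<Phi> * (\<integral>\<^sup>+\<omega>. f (hitting_local_time (\<lambda>t. Y t \<omega>) x0) \<partial>N) =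
    (\<Sum>n. descent n z (\<lambda>L. ennreal (spin_sum L x0) * f (\<lambda>x. \<Phi> x - L x)) \<Phi>)"
proof -
  interpret local_time_jump_process N Y "check_rate E W x0 \<Phi>" z
    using cp by (intro local_time_jump_processI measurable_check_rate) (simp add: check_process_def)
  have start: "spin_mass z \<Phi> * hit_expect (check_rate E W x0 \<Phi>) x0 n z (\<lambda>_. 0) g =
      descent n z (\<lambda>L. ennreal (spin_sum L x0) * g (\<lambda>x. \<Phi> x - L x)) \<Phi>"
    if "g \<in> borel_measurable field_space" for g n
    using hit_expect_check[OF that, of \<Phi> "\<lambda>_. 0"] \<Phi> by simp
  have pos: "0 < \<Phi> z * spin_sum \<Phi> z"
    using spin_sum_pos[OF \<Phi>] positive_fieldsD[OF \<Phi>] by simp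
  then have sm: "spin_mass z \<Phi> \<noteq> 0" "spin_mass z \<Phi> \<noteq> \<top>"
    by (simp_all only: spin_mass_def ennreal_eq_0_iff not_le ennreal_neq_top not_False_eq_True)
  have "spin_mass z \<Phi> * 1 \<le> spin_mass z \<Phi> * (\<Sum>n. hit_expect (check_rate E W x0 \<Phi>) x0 n z (\<lambda>_. 0) (\<lambda>_. 1))"
    using spin_mass_le_descent[OF \<Phi>, of z] by (simp add: start flip: ennreal_suminf_cmult)
  then have mass: "1 \<le> (\<Sum>n. hit_expect (check_rate E W x0 \<Phi>) x0 n z (\<lambda>_. 0) (\<lambda>_. 1))"
    by (subst (asm) ennreal_mult_le_mult_iff) (use sm in simp_all)
  show ?thesis
    by (simp add: nn_integral_local_time_hitting[OF f mass] start flip: ennreal_suminf_cmult)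
qed

text \<open>The mass of \<open>A\<close> under the conditional law of \<open>\<psi>\<close> given \<open>\<bar>\<psi>\<bar> = L\<close>, before it is divided by the
  partition function.\<close>

definition signed_weight :: "('v \<Rightarrow> real) set \<Rightarrow> ('v \<Rightarrow> real) \<Rightarrow> ennreal" where
  "signed_weight A L = (\<Sum>\<sigma>\<in>spins x0. ennreal (gibbs (\<lambda>x. \<sigma> x * L x)) * indicator A (\<lambda>x. \<sigma> x * L x))"

lemma measurable_sign_field [measurable]:
  "(\<lambda>L x. \<sigma> x * L x) \<in> field_space \<rightarrow>\<^sub>M (field_space :: ('v \<Rightarrow> real) measure)"
  by (rule measurable_PiM_single') auto

lemma measurable_signed_weight [measurable]:
  assumes [measurable]: "A \<in> sets field_space"
  shows "signed_weight A \<in> borel_measurable field_space"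
proof -
  have [measurable]: "(\<lambda>L. indicator A (\<lambda>x. \<sigma> x * L x) :: ennreal) \<in> borel_measurable field_space" for \<sigma>
    by (rule measurable_compose[OF measurable_sign_field borel_measurable_indicator[OF assms]])
  show ?thesis unfolding signed_weight_def by measurable
qed

lemma signed_weight_UNIV: "signed_weight UNIV L = ennreal (spin_sum L x0)"
  unfolding signed_weight_def spin_sum_root by (simp add: gibbs_pos less_imp_le)

abbreviation signed_law :: "('v \<Rightarrow> real) \<Rightarrow> ('v \<Rightarrow> real) measure" where
  "signed_law L \<equiv> distr (ising E (interaction E W L) x0) field_space (\<lambda>\<sigma> x. \<sigma> x * L x)"

lemma emeasure_signed_law:
  assumes A: "A \<in> sets field_space"
  shows "emeasure (signed_law L) A = signed_weight A L / ennreal (spin_sum L x0)"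
proof -
  have m: "(\<lambda>\<sigma> x. \<sigma> x * L x) \<in> ising E (interaction E W L) x0 \<rightarrow>\<^sub>M field_space"
    unfolding ising_eq by (rule measurableI) (auto simp: space_point_measure sets_point_measure space_PiM)
  have "emeasure (signed_law L) A =
      emeasure (ising E (interaction E W L) x0) ({\<sigma>\<in>spins x0. (\<lambda>x. \<sigma> x * L x) \<in> A})"
    by (subst emeasure_distr[OF m A])
       (auto simp: ising_eq space_point_measure intro!: arg_cong[where f = "emeasure _"])
  also have "\<dots> = (\<Sum>\<sigma>\<in>{\<sigma>\<in>spins x0. (\<lambda>x. \<sigma> x * L x) \<in> A}. ennreal (gibbs (\<lambda>x. \<sigma> x * L x) / spin_sum L x0))"
    unfolding ising_eq by (subst emeasure_point_measure_finite) auto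
  also have "\<dots> = (\<Sum>\<sigma>\<in>spins x0. (ennreal (gibbs (\<lambda>x. \<sigma> x * L x)) * indicator A (\<lambda>x. \<sigma> x * L x)) / ennreal (spin_sum L x0))"
    by (intro sum.mono_neutral_cong_left)
       (auto simp: divide_ennreal spin_sum_root_pos gibbs_pos less_imp_le split: split_indicator)
  also have "\<dots> = signed_weight A L / ennreal (spin_sum L x0)"
    unfolding signed_weight_def divide_ennreal_def sum_distrib_right ..
  finally show ?thesis .
qed

lemma prob_space_signed_law: "prob_space (signed_law L)"
proof (rule prob_spaceI)
  have "emeasure (signed_law L) UNIV = 1"
    using spin_sum_root_pos[of L]
    by (subst emeasure_signed_law) (auto simp: signed_weight_UNIV divide_ennreal space_PiM sets.top[of field_space, simplified space_PiM, simplified])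
  then show "emeasure (signed_law L) (space (signed_law L)) = 1"
    by (simp add: space_PiM)
qed

lemma measurable_signed_law: "signed_law \<in> field_space \<rightarrow>\<^sub>M prob_algebra field_space"
proof (rule measurable_prob_algebraI)
  show "prob_space (signed_law L)" for L by (rule prob_space_signed_law)
  show "signed_law \<in> field_space \<rightarrow>\<^sub>M subprob_algebra field_space"
  proof (rule measurable_subprob_algebra)
    show "subprob_space (signed_law L)" for L
      by (rule prob_space_imp_subprob_space) (rule prob_space_signed_law)
    fix A :: "('v \<Rightarrow> real) set" assume [measurable]: "A \<in> sets field_space"
    show "(\<lambda>L. emeasure (signed_law L) A) \<in> borel_measurable field_space"
      by (simp add: emeasure_signed_law)
  qed simp
qed

text \<open>The partition function that \<open>hit_expect_check\<close> leaves at the end of the descent is the denominator of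
  the Ising weights of the signs drawn there, so that only \<open>signed_weight\<close> remains.\<close>

lemma signed_check_L_law_emeasure:
  assumes \<Phi>: "\<Phi> \<in> positive_fields" and cp: "check_process N E W x0 \<Phi> z Y"
  shows "prob_space (signed_check_L_law E W x0 \<Phi> N Y)"
    and "sets (signed_check_L_law E W x0 \<Phi> N Y) = sets field_space"
    and "A \<in> sets field_space \<Longrightarrow> spin_mass z \<Phi> * emeasure (signed_check_L_law E W x0 \<Phi> N Y) A =
      (\<Sum>n. descent n z (signed_weight A) \<Phi>)"
proof -
  interpret local_time_jump_process N Y "check_rate E W x0 \<Phi>" z
    using cp by (intro local_time_jump_processI measurable_check_rate) (simp add: check_process_def)
  define L where "L \<omega> = (\<lambda>x. \<Phi> x - hitting_local_time (\<lambda>t. Y t \<omega>) x0 x)" for \<omega>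
  have L [measurable]: "L \<in> N \<rightarrow>\<^sub>M field_space"
    unfolding L_def by (rule measurable_field_at_hitting) simp
  define \<mu> where "\<mu> = distr N field_space L"
  have K: "signed_check_L_law E W x0 \<Phi> N Y = \<mu> \<bind> signed_law"
  proof -
    have "L = (\<lambda>\<omega>. let y = (\<lambda>t. Y t \<omega>) in check_L \<Phi> y (hitting_time y x0))"
      by (auto simp: L_def check_L_def Let_def fun_eq_iff)
    then show ?thesis by (simp only: signed_check_L_law_def \<mu>_def)
  qed
  have \<mu>: "\<mu> \<in> space (prob_algebra field_space)"
    unfolding \<mu>_def by (simp add: space_prob_algebra prob_space_distr)
  have "(\<lambda>_. \<mu> \<bind> signed_law) \<in> count_space (UNIV :: unit set) \<rightarrow>\<^sub>M prob_algebra field_space"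
    by (rule measurable_bind_prob_space[OF measurable_const[OF \<mu>] measurable_signed_law])
  then have "\<mu> \<bind> signed_law \<in> space (prob_algebra field_space)"
    by (auto dest: measurable_space)
  then show "prob_space (signed_check_L_law E W x0 \<Phi> N Y)"
    and "sets (signed_check_L_law E W x0 \<Phi> N Y) = sets field_space"
    by (simp_all add: K space_prob_algebra)
  assume A [measurable]: "A \<in> sets field_space"
  define f where "f l = (\<lambda>L. signed_weight A L / ennreal (spin_sum L x0)) (\<lambda>x. \<Phi> x - l x)" for l
  have [measurable]: "f \<in> borel_measurable field_space"
    unfolding f_def by (rule measurable_compose[OF measurable_minus_field]) measurable
  have sub: "signed_law \<in> \<mu> \<rightarrow>\<^sub>M subprob_algebra field_space"
    using measurable_prob_algebraD[OF measurable_signed_law] by (simp add: \<mu>_def)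
  have "emeasure (\<mu> \<bind> signed_law) A = (\<integral>\<^sup>+L. emeasure (signed_law L) A \<partial>\<mu>)"
    by (rule emeasure_bind[OF _ sub A]) (simp add: \<mu>_def space_PiM)
  also have "\<dots> = (\<integral>\<^sup>+\<omega>. emeasure (signed_law (L \<omega>)) A \<partial>N)"
    unfolding \<mu>_def by (rule nn_integral_distr[OF L]) (simp add: emeasure_signed_law)
  also have "\<dots> = (\<integral>\<^sup>+\<omega>. f (hitting_local_time (\<lambda>t. Y t \<omega>) x0) \<partial>N)"
    by (simp add: emeasure_signed_law f_def L_def)
  finally have "spin_mass z \<Phi> * emeasure (\<mu> \<bind> signed_law) A =
      (\<Sum>n. descent n z (\<lambda>L. ennreal (spin_sum L x0) * f (\<lambda>x. \<Phi> x - L x)) \<Phi>)"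
    using nn_integral_check_local_time[OF \<Phi> cp, of f] by simp
  also have "(\<lambda>L. ennreal (spin_sum L x0) * f (\<lambda>x. \<Phi> x - L x)) = signed_weight A"
  proof
    fix L
    have "ennreal (spin_sum L x0) \<noteq> 0" using spin_sum_root_pos[of L] by (simp add: ennreal_eq_0_iff not_le)
    then show "ennreal (spin_sum L x0) * f (\<lambda>x. \<Phi> x - L x) = signed_weight A L"
      by (simp add: f_def ennreal_times_divide mult.commute[of "ennreal _"] mult_divide_eq_ennreal)
  qed
  finally show "spin_mass z \<Phi> * emeasure (signed_check_L_law E W x0 \<Phi> N Y) A =
      (\<Sum>n. descent n z (signed_weight A) \<Phi>)"
    by (simp only: K)
qed

end

section \<open>The Markov jump process up to the hitting time\<close>

lemma nn_integral_halfline_square_substitution: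
  fixes H :: "real \<Rightarrow> ennreal"
  assumes [measurable]: "H \<in> borel_measurable borel" and v: "0 < v"
  shows "(\<integral>\<^sup>+u. indicator {0<..} u * H u \<partial>lborel) =
    (\<integral>\<^sup>+t. indicator {v<..} t * (ennreal t * H ((t\<^sup>2 - v\<^sup>2) / 2)) \<partial>lborel)"
proof -
  define g where "g t = (t\<^sup>2 - v\<^sup>2) / 2" for t :: real
  have [measurable]: "g \<in> borel_measurable borel" unfolding g_def by measurable
  have g_mono: "g x \<le> g y" if "0 \<le> x" "x \<le> y" for x y
    using that by (simp add: g_def power_mono)
  have gv: "g v = 0" by (simp add: g_def)
  let ?b = "\<lambda>n::nat. v + 1 + real n"
  have fin: "(\<integral>\<^sup>+u. H u * indicator {0..g (?b n)} u \<partial>lborel) =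
      (\<integral>\<^sup>+t. H (g t) * ennreal t * indicator {v..?b n} t \<partial>lborel)" for n
  proof -
    have "(\<integral>\<^sup>+u. H u * indicator {g v..g (?b n)} u \<partial>lborel) =
      (\<integral>\<^sup>+t. H (g t) * ennreal t * indicator {v..?b n} t \<partial>lborel)"
      by (rule nn_integral_substitution_aux)
         (use v in \<open>auto simp: g_def intro!: derivative_eq_intros continuous_intros\<close>)
    then show ?thesis by (simp only: gv)
  qed
  have "(\<integral>\<^sup>+u. H u * indicator {0..} u \<partial>lborel) = (\<integral>\<^sup>+u. (SUP n. H u * indicator {0..g (?b n)} u) \<partial>lborel)"
  proof (rule nn_integral_cong)
    fix u
    show "H u * indicator {0..} u = (SUP n. H u * indicator {0..g (?b n)} u)"
    proof (rule antisym)
      show "(SUP n. H u * indicator {0..g (?b n)} u) \<le> H u * indicator {0..} u"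
        by (rule SUP_least) (auto split: split_indicator)
      obtain n :: nat where n: "u < real n" using reals_Archimedean2 by blast
      have "real n \<le> g (?b n)"
        using v by (simp add: g_def power2_eq_square algebra_simps)
      then have "u \<le> g (?b n)" using n by simp
      then show "H u * indicator {0..} u \<le> (SUP n. H u * indicator {0..g (?b n)} u)"
        by (intro SUP_upper2[of n]) (auto split: split_indicator)
    qed
  qed
  also have "\<dots> = (SUP n. \<integral>\<^sup>+u. H u * indicator {0..g (?b n)} u \<partial>lborel)"
  proof (rule nn_integral_monotone_convergence_SUP)
    show "incseq (\<lambda>n u. H u * indicator {0..g (?b n)} u)"
    proof (intro monoI le_funI mult_left_mono)
      fix m n :: nat and u assume "m \<le> n"
      then have "g (?b m) \<le> g (?b n)" using v by (intro g_mono) auto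
      then show "indicator {0..g (?b m)} u \<le> (indicator {0..g (?b n)} u :: ennreal)"
        by (auto split: split_indicator)
    qed simp
  qed simp
  also have "\<dots> = (SUP n. \<integral>\<^sup>+t. H (g t) * ennreal t * indicator {v..?b n} t \<partial>lborel)"
    by (simp only: fin)
  also have "\<dots> = (\<integral>\<^sup>+t. (SUP n. H (g t) * ennreal t * indicator {v..?b n} t) \<partial>lborel)"
  proof (rule nn_integral_monotone_convergence_SUP[symmetric])
    show "incseq (\<lambda>n t. H (g t) * ennreal t * indicator {v..?b n} t)"
      by (intro monoI le_funI mult_left_mono) (auto split: split_indicator)
  qed measurable
  also have "\<dots> = (\<integral>\<^sup>+t. H (g t) * ennreal t * indicator {v..} t \<partial>lborel)"
  proof (rule nn_integral_cong, rule antisym)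
    fix t
    show "(SUP n. H (g t) * ennreal t * indicator {v..?b n} t) \<le> H (g t) * ennreal t * indicator {v..} t"
      by (rule SUP_least) (auto split: split_indicator)
    obtain n :: nat where "t < real n" using reals_Archimedean2 by blast
    then have "t \<le> ?b n" using v by simp
    then show "H (g t) * ennreal t * indicator {v..} t \<le> (SUP n. H (g t) * ennreal t * indicator {v..?b n} t)"
      by (intro SUP_upper2[of n]) (auto split: split_indicator)
  qed
  finally have closed: "(\<integral>\<^sup>+u. H u * indicator {0..} u \<partial>lborel) = (\<integral>\<^sup>+t. H (g t) * ennreal t * indicator {v..} t \<partial>lborel)" .
  have "(\<integral>\<^sup>+u. indicator {0<..} u * H u \<partial>lborel) = (\<integral>\<^sup>+u. H u * indicator {0..} u \<partial>lborel)"
    using AE_lborel_singleton[of 0]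
    by (intro nn_integral_cong_AE, eventually_elim) (auto split: split_indicator)
  also have "\<dots> = (\<integral>\<^sup>+t. indicator {v<..} t * (ennreal t * H (g t)) \<partial>lborel)"
    unfolding closed using AE_lborel_singleton[of v]
    by (intro nn_integral_cong_AE, eventually_elim) (auto simp: mult.commute split: split_indicator)
  finally show ?thesis by (simp only: g_def)
qed

lemma nn_integral_exp_halfline:
  assumes "0 < r"
  shows "(\<integral>\<^sup>+u. indicator {0<..} u * ennreal (exp (- r * u)) \<partial>lborel) = ennreal (1 / r)"
proof -
  have "(\<integral>\<^sup>+u. indicator {0<..} u * ennreal (exp (- r * u)) \<partial>lborel) =
      (\<integral>\<^sup>+u. ennreal (exp (- r * u)) * indicator {0..} u \<partial>lborel)"
    using AE_lborel_singleton[of 0]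
    by (intro nn_integral_cong_AE, eventually_elim) (auto split: split_indicator)
  also have "\<dots> = ennreal (0 - (- exp (- r * 0) / r))"
  proof (rule nn_integral_FTC_atLeast)
    have "filterlim (\<lambda>u. r * u) at_top at_top"
      using assms by (simp add: filterlim_tendsto_pos_mult_at_top[OF tendsto_const _ filterlim_ident])
    then have "((\<lambda>u. exp (- (r * u))) \<longlongrightarrow> 0) at_top"
      by (intro filterlim_compose[OF exp_at_bot]) (simp add: filterlim_uminus_at_bot)
    then have "((\<lambda>u. - exp (- (r * u)) / r) \<longlongrightarrow> - 0 / r) at_top"
      using assms by (intro tendsto_intros) auto
    then show "((\<lambda>u. - exp (- r * u) / r) \<longlongrightarrow> 0) at_top" by simp
  qed (use assms in \<open>auto intro!: derivative_eq_intros\<close>)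
  finally show ?thesis by simp
qed

context conductance_graph
begin

definition total_rate :: "'v \<Rightarrow> real" where
  "total_rate i = (\<Sum>j\<in>UNIV. c i j)"

lemma total_rate_pos: "i \<noteq> x0 \<Longrightarrow> 0 < total_rate i"
proof -
  assume i: "i \<noteq> x0"
  have "i = x0 \<or> (\<exists>j. 0 < c i j)"
    by (induction i rule: vertex_induct) auto
  with i obtain j where "0 < c i j" by auto
  also have "c i j \<le> total_rate i"
    unfolding total_rate_def by (rule member_le_sum) (auto simp: c_nonneg)
  finally show ?thesis .
qed

text \<open>Integrates out the holding time \<open>u\<close> of one visit of \<open>i\<close> by the walk; the field \<open>L\<close> stands for
  \<open>sqrt (2 * l + \<psi>\<^sup>2)\<close> with the local times \<open>l\<close> collected so far.\<close>

definition raise :: "'v \<Rightarrow> (('v \<Rightarrow> real) \<Rightarrow> ennreal) \<Rightarrow> ('v \<Rightarrow> real) \<Rightarrow> ennreal" where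
  "raise i f L = (\<integral>\<^sup>+u. indicator {0<..} u *
     (ennreal (exp (- total_rate i * u)) * f (L(i := sqrt ((L i)\<^sup>2 + 2 * u)))) \<partial>lborel)"

lemma measurable_raise_integrand:
  assumes f: "f \<in> borel_measurable field_space"
  shows "(\<lambda>u. ennreal (exp (- total_rate i * u)) * f (L(i := sqrt ((L i)\<^sup>2 + 2 * u)))) \<in> borel_measurable borel"
proof -
  have [measurable]: "(\<lambda>u. f (L(i := sqrt ((L i)\<^sup>2 + 2 * u)))) \<in> borel_measurable borel"
    by (rule measurable_compose[OF _ f]) measurable
  show ?thesis by measurable
qed

lemma measurable_raise [measurable]:
  assumes f: "f \<in> borel_measurable field_space"
  shows "raise i f \<in> borel_measurable field_space"
proof -
  have [measurable]: "(\<lambda>p. f ((fst p)(i := sqrt ((fst p i)\<^sup>2 + 2 * snd p)))) \<in> borel_measurable (field_space \<Otimes>\<^sub>M lborel)"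
    by (rule measurable_compose[OF _ f]) measurable
  have [measurable]: "(\<lambda>p. indicator {0<..} (snd p) * (ennreal (exp (- total_rate i * snd p)) *
      f ((fst p)(i := sqrt ((fst p i)\<^sup>2 + 2 * snd p))))) \<in> borel_measurable (field_space \<Otimes>\<^sub>M lborel)"
    by measurable
  show ?thesis unfolding raise_def[abs_def]
    by (rule lborel.borel_measurable_nn_integral) (simp add: split_def)
qed

primrec ascent :: "nat \<Rightarrow> 'v \<Rightarrow> (('v \<Rightarrow> real) \<Rightarrow> ennreal) \<Rightarrow> ('v \<Rightarrow> real) \<Rightarrow> ennreal" where
  "ascent 0 i g L = (if i = x0 then g L else 0)"
| "ascent (Suc n) i g L = (if i = x0 then 0 else \<Sum>j\<in>UNIV. ennreal (c i j) * raise i (ascent n j g) L)"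

lemma measurable_ascent [measurable]:
  assumes [measurable]: "g \<in> borel_measurable field_space"
  shows "ascent n i g \<in> borel_measurable field_space"
proof (induction n arbitrary: i)
  case 0
  have "(\<lambda>L. ascent 0 i g L) \<in> borel_measurable field_space" by (cases "i = x0") simp_all
  then show ?case by simp
next
  case (Suc n)
  note [measurable] = Suc.IH
  have "(\<lambda>L. ascent (Suc n) i g L) \<in> borel_measurable field_space" by (cases "i = x0") simp_all
  then show ?case by simp
qed

lemma jump_density_conductance:
  assumes "0 < u"
  shows "jump_density (\<lambda>_. c) l i j u = c i j * exp (- total_rate i * u)"
proof -
  have "(\<integral>v\<in>{0..u}. total_rate i \<partial>lborel) = total_rate i * u"
    using assms by (simp add: set_lebesgue_integral_def mult.commute)
  then show ?thesis by (simp add: jump_density_def total_rate_def)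
qed

lemma hit_expect_conductance:
  assumes g [measurable]: "g \<in> borel_measurable field_space" and "\<And>x. 0 \<le> l x"
  shows "hit_expect (\<lambda>_. c) x0 n i l (\<lambda>l. g (\<lambda>x. sqrt (2 * l x + (\<psi> x)\<^sup>2))) =
    ascent n i g (\<lambda>x. sqrt (2 * l x + (\<psi> x)\<^sup>2))"
  using assms(2)
proof (induction n arbitrary: i l)
  case 0
  show ?case by simp
next
  case (Suc n)
  let ?L = "\<lambda>l x. sqrt (2 * l x + (\<psi> x)\<^sup>2)"
  show ?case
  proof (cases "i = x0")
    case False
    have "(\<integral>\<^sup>+u. indicator {0<..} u * ennreal (jump_density (\<lambda>_. c) l i j u) *
        hit_expect (\<lambda>_. c) x0 n j (l(i := l i + u)) (\<lambda>l. g (?L l)) \<partial>lborel) =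
      ennreal (c i j) * raise i (ascent n j g) (?L l)" for j
    proof -
      let ?I = "\<lambda>u. ennreal (exp (- total_rate i * u)) * ascent n j g ((?L l)(i := sqrt ((?L l i)\<^sup>2 + 2 * u)))"
      have I: "?I \<in> borel_measurable borel"
        by (rule measurable_raise_integrand) simp
      have "(\<integral>\<^sup>+u. indicator {0<..} u * ennreal (jump_density (\<lambda>_. c) l i j u) *
          hit_expect (\<lambda>_. c) x0 n j (l(i := l i + u)) (\<lambda>l. g (?L l)) \<partial>lborel) =
        (\<integral>\<^sup>+u. ennreal (c i j) * (indicator {0<..} u * ?I u) \<partial>lborel)"
      proof (rule nn_integral_cong)
        fix u :: real
        show "indicator {0<..} u * ennreal (jump_density (\<lambda>_. c) l i j u) *
            hit_expect (\<lambda>_. c) x0 n j (l(i := l i + u)) (\<lambda>l. g (?L l)) =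
          ennreal (c i j) * (indicator {0<..} u * ?I u)"
        proof (cases "0 < u")
          case True
          have "?L (l(i := l i + u)) = (?L l)(i := sqrt ((?L l i)\<^sup>2 + 2 * u))"
            using Suc.prems[of i] by (auto simp: algebra_simps)
          moreover have "hit_expect (\<lambda>_. c) x0 n j (l(i := l i + u)) (\<lambda>l. g (?L l)) =
              ascent n j g (?L (l(i := l i + u)))"
            using Suc.prems True by (intro Suc.IH) (simp add: add_nonneg_pos less_imp_le)
          ultimately show ?thesis
            using True c_nonneg[of i j]
            by (simp only: jump_density_conductance) (simp add: ennreal_mult' mult.assoc)
        qed simp
      qed
      also have "\<dots> = ennreal (c i j) * (\<integral>\<^sup>+u. indicator {0<..} u * ?I u \<partial>lborel)"
        using I by (intro nn_integral_cmult) simp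
      finally show ?thesis by (simp only: raise_def)
    qed
    then show ?thesis using False by simp
  qed simp
qed

text \<open>The walk reaches \<open>x0\<close> almost surely: the hitting probability is harmonic off \<open>x0\<close>, so its
  minimum spreads along the edges to \<open>x0\<close>, where it is \<open>1\<close>.\<close>

primrec hit_prob :: "nat \<Rightarrow> 'v \<Rightarrow> real" where
  "hit_prob 0 i = (if i = x0 then 1 else 0)"
| "hit_prob (Suc n) i = (if i = x0 then 0 else (\<Sum>j\<in>UNIV. c i j * hit_prob n j) / total_rate i)"

lemma hit_prob_nonneg: "0 \<le> hit_prob n i"
  by (induction n arbitrary: i)
     (auto intro!: divide_nonneg_pos sum_nonneg mult_nonneg_nonneg c_nonneg total_rate_pos)

lemma hit_expect_hit_prob: "hit_expect (\<lambda>_. c) x0 n i l (\<lambda>_. 1) = ennreal (hit_prob n i)"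
proof (induction n arbitrary: i l)
  case (Suc n)
  show ?case
  proof (cases "i = x0")
    case False
    have r: "0 < total_rate i" using False by (rule total_rate_pos)
    have "(\<integral>\<^sup>+u. indicator {0<..} u * ennreal (jump_density (\<lambda>_. c) l i j u) * ennreal (hit_prob n j) \<partial>lborel) =
        ennreal (c i j * hit_prob n j / total_rate i)" for j
    proof -
      have "(\<integral>\<^sup>+u. indicator {0<..} u * ennreal (jump_density (\<lambda>_. c) l i j u) * ennreal (hit_prob n j) \<partial>lborel) =
          (\<integral>\<^sup>+u. ennreal (c i j * hit_prob n j) * (indicator {0<..} u * ennreal (exp (- total_rate i * u))) \<partial>lborel)"
        by (intro nn_integral_cong)
           (auto split: split_indicator simp: jump_density_conductance c_nonneg hit_prob_nonneg
              ennreal_mult'[symmetric] mult_ac)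
      also have "\<dots> = ennreal (c i j * hit_prob n j) * ennreal (1 / total_rate i)"
        by (subst nn_integral_cmult) (simp_all only: nn_integral_exp_halfline[OF r], measurable)
      also have "\<dots> = ennreal (c i j * hit_prob n j / total_rate i)"
        using r by (subst ennreal_mult'[symmetric]) (simp_all add: c_nonneg hit_prob_nonneg)
      finally show ?thesis .
    qed
    then have "hit_expect (\<lambda>_. c) x0 (Suc n) i l (\<lambda>_. 1) = (\<Sum>j\<in>UNIV. ennreal (c i j * hit_prob n j / total_rate i))"
      using False by (simp add: Suc.IH)
    also have "\<dots> = ennreal (\<Sum>j\<in>UNIV. c i j * hit_prob n j / total_rate i)"
      using r by (intro sum_ennreal) (simp add: c_nonneg hit_prob_nonneg)
    finally show ?thesis using False by (simp add: sum_divide_distrib)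
  qed simp
qed simp

lemma hit_prob_partial_sum_le: "(\<Sum>n<m. hit_prob n i) \<le> 1"
proof (induction m arbitrary: i)
  case (Suc m)
  have split: "(\<Sum>n<Suc m. hit_prob n i) = hit_prob 0 i + (\<Sum>n<m. hit_prob (Suc n) i)"
    by (rule sum.lessThan_Suc_shift)
  show ?case
  proof (cases "i = x0")
    case False
    have r: "0 < total_rate i" using False by (rule total_rate_pos)
    have "(\<Sum>n<Suc m. hit_prob n i) = (\<Sum>n<m. \<Sum>j\<in>UNIV. c i j * hit_prob n j) / total_rate i"
      unfolding split using False by (simp add: sum_divide_distrib)
    also have "(\<Sum>n<m. \<Sum>j\<in>UNIV. c i j * hit_prob n j) = (\<Sum>j\<in>UNIV. c i j * (\<Sum>n<m. hit_prob n j))"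
      by (subst sum.swap) (simp add: sum_distrib_left)
    also have "\<dots> \<le> (\<Sum>j\<in>UNIV. c i j * 1)"
      by (intro sum_mono mult_left_mono Suc.IH c_nonneg)
    finally show ?thesis using r by (simp add: total_rate_def divide_right_mono)
  next
    case True
    have "(\<Sum>n<m. hit_prob (Suc n) i) = 0" using True by (intro sum.neutral) simp
    then show ?thesis using True unfolding split by simp
  qed
qed simp

lemma hit_prob_sum:
  "summable (\<lambda>n. hit_prob n i)" "1 \<le> (\<Sum>n. hit_prob n i)"
proof -
  have summ: "summable (\<lambda>n. hit_prob n i)" for i
    by (rule summableI_nonneg_bounded[OF hit_prob_nonneg hit_prob_partial_sum_le])
  define q where "q i = (\<Sum>n. hit_prob n i)" for i
  have q_root: "q x0 = 1"
  proof -
    have "q x0 = (\<Sum>n\<in>{0}. hit_prob n x0)"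
      unfolding q_def
    proof (rule suminf_finite)
      show "hit_prob n x0 = 0" if "n \<notin> {0}" for n using that by (cases n) auto
    qed simp
    then show ?thesis by simp
  qed
  have q_harm: "total_rate i * q i = (\<Sum>j\<in>UNIV. c i j * q j)" if "i \<noteq> x0" for i
  proof -
    have "q i = (\<Sum>n. hit_prob (Suc n) i)"
      unfolding q_def using suminf_split_head[OF summ[of i]] that by simp
    also have "\<dots> = (\<Sum>n. \<Sum>j\<in>UNIV. c i j / total_rate i * hit_prob n j)"
      using that by (simp add: sum_divide_distrib)
    also have "\<dots> = (\<Sum>j\<in>UNIV. c i j / total_rate i * q j)"
    proof -
      have "(\<Sum>n. \<Sum>j\<in>UNIV. c i j / total_rate i * hit_prob n j) =
          (\<Sum>j\<in>UNIV. \<Sum>n. c i j / total_rate i * hit_prob n j)"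
        by (rule suminf_sum) (rule summable_mult[OF summ])
      then show ?thesis by (simp only: suminf_mult[OF summ] q_def)
    qed
    finally show ?thesis
      using total_rate_pos[OF that] by (simp add: sum_distrib_left field_simps)
  qed
  define m where "m = Min (range q)"
  have m_le: "m \<le> q j" for j by (simp add: m_def)
  have "m \<in> range q" unfolding m_def by (rule Min_in) auto
  then obtain i0 where i0: "q i0 = m" by auto
  have "q i0 = m \<longrightarrow> m = 1"
  proof (induction i0 rule: vertex_induct)
    case 1
    then show ?case using q_root by simp
  next
    case (2 i j)
    show ?case
    proof (cases "i = x0")
      case False
      show "q i = m \<longrightarrow> m = 1"
      proof
        assume "q i = m"
        then have "(\<Sum>j\<in>UNIV. c i j * (q j - m)) = 0"
          using q_harm[OF False] by (simp add: right_diff_distrib sum_subtractf sum_distrib_right total_rate_def)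
        then have "c i j * (q j - m) = 0"
          using m_le c_nonneg by (subst (asm) sum_nonneg_eq_0_iff) auto
        then show "m = 1" using 2 by simp
      qed
    qed (use q_root in simp)
  qed
  with i0 have "m = 1" by simp
  with m_le show "1 \<le> (\<Sum>n. hit_prob n i)" by (simp add: q_def)
qed (rule summableI_nonneg_bounded[OF hit_prob_nonneg hit_prob_partial_sum_le])

lemma nn_integral_conductance_local_time:
  assumes X: "markov_jump_process M E W z X" and g [measurable]: "g \<in> borel_measurable field_space"
  shows "(\<integral>\<^sup>+\<omega>. g (\<lambda>x. sqrt (2 * hitting_local_time (\<lambda>t. X t \<omega>) x0 x + (\<psi> x)\<^sup>2)) \<partial>M) =
    (\<Sum>n. ascent n z g (\<lambda>x. \<bar>\<psi> x\<bar>))"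
proof -
  interpret local_time_jump_process M X "\<lambda>_. c" z
    using X by (intro local_time_jump_processI) (simp_all add: markov_jump_process_def)
  have [measurable]: "(\<lambda>l x. sqrt (2 * l x + (\<psi> x)\<^sup>2)) \<in> field_space \<rightarrow>\<^sub>M (field_space :: ('v \<Rightarrow> real) measure)"
    by (rule measurable_PiM_single') auto
  have f: "(\<lambda>l. g (\<lambda>x. sqrt (2 * l x + (\<psi> x)\<^sup>2))) \<in> borel_measurable field_space"
    by measurable
  have mass: "1 \<le> (\<Sum>n. hit_expect (\<lambda>_. c) x0 n z (\<lambda>_. 0) (\<lambda>_. 1))"
    unfolding hit_expect_hit_prob
    using hit_prob_sum[of z] by (simp add: suminf_ennreal2 hit_prob_nonneg)
  have "(\<integral>\<^sup>+\<omega>. g (\<lambda>x. sqrt (2 * hitting_local_time (\<lambda>t. X t \<omega>) x0 x + (\<psi> x)\<^sup>2)) \<partial>M) =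
      (\<Sum>n. hit_expect (\<lambda>_. c) x0 n z (\<lambda>_. 0) (\<lambda>l. g (\<lambda>x. sqrt (2 * l x + (\<psi> x)\<^sup>2))))"
    by (rule nn_integral_local_time_hitting[OF f mass])
  also have "\<dots> = (\<Sum>n. ascent n z g (\<lambda>x. \<bar>\<psi> x\<bar>))"
    by (subst hit_expect_conductance[OF g]) simp_all
  finally show ?thesis .
qed

end

section \<open>Duality of descent and ascent\<close>

lemma lower_raise_adjoint_real:
  fixes K F :: "real \<Rightarrow> ennreal"
  assumes K [measurable]: "K \<in> borel_measurable borel" and F [measurable]: "F \<in> borel_measurable borel"
  shows "(\<integral>\<^sup>+v. indicator {0<..} v * (ennreal (exp (- (r * v\<^sup>2) / 2)) * (K v *
      (\<integral>\<^sup>+u. indicator {0<..} u * (ennreal (exp (- r * u)) * F (sqrt (v\<^sup>2 + 2 * u))) \<partial>lborel))) \<partial>lborel) =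
    (\<integral>\<^sup>+t. indicator {0<..} t * (ennreal (exp (- (r * t\<^sup>2) / 2)) *
      (ennreal t * (\<integral>\<^sup>+v. indicator {0<..<t} v * K v \<partial>lborel) * F t)) \<partial>lborel)"
proof -
  define G where "G t = ennreal (exp (- (r * t\<^sup>2) / 2)) * (ennreal t * F t)" for t
  have [measurable]: "G \<in> borel_measurable borel" unfolding G_def by measurable
  have [measurable]: "(\<lambda>p. if 0 < fst p \<and> fst p < snd p then K (fst p) * G (snd p) else 0)
      \<in> borel_measurable (lborel \<Otimes>\<^sub>M lborel)"
    by measurable
  have inner: "ennreal (exp (- (r * v\<^sup>2) / 2)) * (K v *
      (\<integral>\<^sup>+u. indicator {0<..} u * (ennreal (exp (- r * u)) * F (sqrt (v\<^sup>2 + 2 * u))) \<partial>lborel)) =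
    (\<integral>\<^sup>+t. (if 0 < v \<and> v < t then K v * G t else 0) \<partial>lborel)" if v: "0 < v" for v
  proof -
    have "(\<integral>\<^sup>+u. indicator {0<..} u * (ennreal (exp (- r * u)) * F (sqrt (v\<^sup>2 + 2 * u))) \<partial>lborel) =
        (\<integral>\<^sup>+t. indicator {v<..} t * (ennreal t * (ennreal (exp (- r * ((t\<^sup>2 - v\<^sup>2) / 2))) *
           F (sqrt (v\<^sup>2 + 2 * ((t\<^sup>2 - v\<^sup>2) / 2))))) \<partial>lborel)"
      by (rule nn_integral_halfline_square_substitution[OF _ v]) measurable
    also have "\<dots> = (\<integral>\<^sup>+t. indicator {v<..} t * (ennreal t * (ennreal (exp (- r * ((t\<^sup>2 - v\<^sup>2) / 2))) * F t)) \<partial>lborel)"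
    proof (rule nn_integral_cong)
      fix t
      have "v\<^sup>2 + 2 * ((t\<^sup>2 - v\<^sup>2) / 2) = t\<^sup>2" by (simp add: field_simps)
      then have "sqrt (v\<^sup>2 + 2 * ((t\<^sup>2 - v\<^sup>2) / 2)) = \<bar>t\<bar>" by (simp only: real_sqrt_abs)
      then show "indicator {v<..} t * (ennreal t * (ennreal (exp (- r * ((t\<^sup>2 - v\<^sup>2) / 2))) *
           F (sqrt (v\<^sup>2 + 2 * ((t\<^sup>2 - v\<^sup>2) / 2))))) =
         indicator {v<..} t * (ennreal t * (ennreal (exp (- r * ((t\<^sup>2 - v\<^sup>2) / 2))) * F t))"
        using v by (cases "v < t") simp_all
    qed
    finally have "ennreal (exp (- (r * v\<^sup>2) / 2)) * (K v *
      (\<integral>\<^sup>+u. indicator {0<..} u * (ennreal (exp (- r * u)) * F (sqrt (v\<^sup>2 + 2 * u))) \<partial>lborel)) =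
      (\<integral>\<^sup>+t. ennreal (exp (- (r * v\<^sup>2) / 2)) * (K v *
         (indicator {v<..} t * (ennreal t * (ennreal (exp (- r * ((t\<^sup>2 - v\<^sup>2) / 2))) * F t)))) \<partial>lborel)"
      by (simp add: nn_integral_cmult)
    also have "\<dots> = (\<integral>\<^sup>+t. (if 0 < v \<and> v < t then K v * G t else 0) \<partial>lborel)"
    proof (rule nn_integral_cong)
      fix t
      have "exp (- (r * v\<^sup>2) / 2) * exp (- r * ((t\<^sup>2 - v\<^sup>2) / 2)) = exp (- (r * t\<^sup>2) / 2)"
        by (simp add: exp_add[symmetric] algebra_simps diff_divide_distrib)
      then have "ennreal (exp (- (r * v\<^sup>2) / 2)) * ennreal (exp (- r * ((t\<^sup>2 - v\<^sup>2) / 2))) = ennreal (exp (- (r * t\<^sup>2) / 2))"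
        by (simp only: ennreal_mult'[symmetric] exp_ge_zero)
      then show "ennreal (exp (- (r * v\<^sup>2) / 2)) * (K v *
         (indicator {v<..} t * (ennreal t * (ennreal (exp (- r * ((t\<^sup>2 - v\<^sup>2) / 2))) * F t)))) =
         (if 0 < v \<and> v < t then K v * G t else 0)"
        using v by (auto simp: G_def mult_ac split: split_indicator)
    qed
    finally show ?thesis .
  qed
  have "(\<integral>\<^sup>+v. indicator {0<..} v * (ennreal (exp (- (r * v\<^sup>2) / 2)) * (K v *
      (\<integral>\<^sup>+u. indicator {0<..} u * (ennreal (exp (- r * u)) * F (sqrt (v\<^sup>2 + 2 * u))) \<partial>lborel))) \<partial>lborel) =
    (\<integral>\<^sup>+v. \<integral>\<^sup>+t. (if 0 < v \<and> v < t then K v * G t else 0) \<partial>lborel \<partial>lborel)"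
  proof (rule nn_integral_cong)
    fix v :: real
    show "indicator {0<..} v * (ennreal (exp (- (r * v\<^sup>2) / 2)) * (K v *
      (\<integral>\<^sup>+u. indicator {0<..} u * (ennreal (exp (- r * u)) * F (sqrt (v\<^sup>2 + 2 * u))) \<partial>lborel))) =
      (\<integral>\<^sup>+t. (if 0 < v \<and> v < t then K v * G t else 0) \<partial>lborel)"
    proof (cases "0 < v")
      case True
      then show ?thesis by (simp only: inner[OF True]) simp
    qed simp
  qed
  also have "\<dots> = (\<integral>\<^sup>+t. \<integral>\<^sup>+v. (if 0 < v \<and> v < t then K v * G t else 0) \<partial>lborel \<partial>lborel)"
    by (rule lborel_pair.Fubini') (simp add: split_def)
  also have "\<dots> = (\<integral>\<^sup>+t. indicator {0<..} t * (ennreal (exp (- (r * t\<^sup>2) / 2)) *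
      (ennreal t * (\<integral>\<^sup>+v. indicator {0<..<t} v * K v \<partial>lborel) * F t)) \<partial>lborel)"
  proof (rule nn_integral_cong)
    fix t :: real
    have "(\<integral>\<^sup>+v. (if 0 < v \<and> v < t then K v * G t else 0) \<partial>lborel) =
        (\<integral>\<^sup>+v. (indicator {0<..<t} v * K v) * G t \<partial>lborel)"
      by (intro nn_integral_cong) (auto split: split_indicator)
    also have "\<dots> = (\<integral>\<^sup>+v. indicator {0<..<t} v * K v \<partial>lborel) * G t"
      by (rule nn_integral_multc) simp
    also have "\<dots> = indicator {0<..} t * (ennreal (exp (- (r * t\<^sup>2) / 2)) *
      (ennreal t * (\<integral>\<^sup>+v. indicator {0<..<t} v * K v \<partial>lborel) * F t))"
      by (cases "0 < t") (simp_all add: G_def mult_ac ennreal_neg)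
    finally show "(\<integral>\<^sup>+v. (if 0 < v \<and> v < t then K v * G t else 0) \<partial>lborel) =
      indicator {0<..} t * (ennreal (exp (- (r * t\<^sup>2) / 2)) *
      (ennreal t * (\<integral>\<^sup>+v. indicator {0<..<t} v * K v \<partial>lborel) * F t))" .
  qed
  finally show ?thesis .
qed

context conductance_graph
begin

text \<open>The part of the density of \<open>\<psi>\<close> that depends on \<open>\<bar>\<psi>\<bar>\<close> only, restricted to positive fields.\<close>

definition weight :: "('v \<Rightarrow> real) \<Rightarrow> ennreal" where
  "weight L = indicator positive_fields L * ennreal (exp (- (\<Sum>x\<in>UNIV. total_rate x * (L x)\<^sup>2) / 2))"

abbreviation free_fields :: "('v \<Rightarrow> real) measure" where
  "free_fields \<equiv> Pi\<^sub>M (- {x0}) (\<lambda>_. lborel)"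

definition pairing :: "real \<Rightarrow> (('v \<Rightarrow> real) \<Rightarrow> ennreal) \<Rightarrow> (('v \<Rightarrow> real) \<Rightarrow> ennreal) \<Rightarrow> ennreal" where
  "pairing s k f = (\<integral>\<^sup>+\<phi>. weight (\<phi>(x0 := s)) * (k (\<phi>(x0 := s)) * f (\<phi>(x0 := s))) \<partial>free_fields)"

lemma measurable_weight [measurable]: "weight \<in> borel_measurable field_space"
  unfolding weight_def[abs_def] by measurable

lemma measurable_extend: "(\<lambda>\<phi>. \<phi>(x0 := s)) \<in> Pi\<^sub>M (- {x0}) (\<lambda>_. lborel) \<rightarrow>\<^sub>M (field_space :: ('v \<Rightarrow> real) measure)"
proof (rule measurable_PiM_single')
  fix x
  show "(\<lambda>\<phi>. (\<phi>(x0 := s)) x) \<in> borel_measurable (Pi\<^sub>M (- {x0}) (\<lambda>_. lborel))"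
    by (cases "x = x0") auto
qed auto

lemma measurable_pairing_integrand:
  assumes "k \<in> borel_measurable field_space" "f \<in> borel_measurable field_space"
  shows "(\<lambda>\<phi>. weight (\<phi>(x0 := s)) * (k (\<phi>(x0 := s)) * f (\<phi>(x0 := s)))) \<in> borel_measurable free_fields"
  by (intro borel_measurable_times_ennreal measurable_compose[OF measurable_extend] measurable_weight assms)

lemma pairing_cong:
  assumes "\<And>L. L \<in> positive_fields \<Longrightarrow> L x0 = s \<Longrightarrow> k L * f L = k' L * f' L"
  shows "pairing s k f = pairing s k' f'"
  unfolding pairing_def weight_def
  by (intro nn_integral_cong) (auto split: split_indicator simp: assms)

lemma pairing_commute: "pairing s k f = pairing s f k"
  by (simp add: pairing_def mult.commute)

lemma pairing_cmult_right:
  assumes "k \<in> borel_measurable field_space" "f \<in> borel_measurable field_space"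
  shows "pairing s k (\<lambda>L. a * f L) = a * pairing s k f"
  unfolding pairing_def using measurable_pairing_integrand[OF assms]
  by (simp add: nn_integral_cmult[symmetric] mult_ac)

lemma pairing_sum_right:
  assumes "k \<in> borel_measurable field_space" "\<And>j. f j \<in> borel_measurable field_space"
  shows "pairing s k (\<lambda>L. \<Sum>j\<in>A. f j L) = (\<Sum>j\<in>A. pairing s k (f j))"
  unfolding pairing_def using measurable_pairing_integrand[OF assms]
  by (simp add: nn_integral_sum[symmetric] sum_distrib_left)

lemma pairing_suminf_right:
  assumes "k \<in> borel_measurable field_space" "\<And>n. f n \<in> borel_measurable field_space"
  shows "pairing s k (\<lambda>L. \<Sum>n. f n L) = (\<Sum>n. pairing s k (f n))"
  unfolding pairing_def using measurable_pairing_integrand[OF assms]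
  by (simp add: nn_integral_suminf[symmetric])

lemma weight_upd:
  "weight (B(i := y)) = (indicator {L. \<forall>x. x \<noteq> i \<longrightarrow> 0 < L x} B * ennreal (exp (- (\<Sum>x\<in>- {i}. total_rate x * (B x)\<^sup>2) / 2))) *
     (indicator {0<..} y * ennreal (exp (- (total_rate i * y\<^sup>2) / 2)))"
proof -
  have "(\<Sum>x\<in>UNIV. total_rate x * ((B(i := y)) x)\<^sup>2) =
      total_rate i * y\<^sup>2 + (\<Sum>x\<in>- {i}. total_rate x * (B x)\<^sup>2)"
    by (subst sum.remove[of _ i]) (auto simp: Compl_eq_Diff_UNIV intro!: sum.cong)
  then have "exp (- (\<Sum>x\<in>UNIV. total_rate x * ((B(i := y)) x)\<^sup>2) / 2) =
      exp (- (\<Sum>x\<in>- {i}. total_rate x * (B x)\<^sup>2) / 2) * exp (- (total_rate i * y\<^sup>2) / 2)"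
    by (simp only: exp_add[symmetric] add_divide_distrib minus_add_distrib add.commute)
  then have "ennreal (exp (- (\<Sum>x\<in>UNIV. total_rate x * ((B(i := y)) x)\<^sup>2) / 2)) =
      ennreal (exp (- (\<Sum>x\<in>- {i}. total_rate x * (B x)\<^sup>2) / 2)) * ennreal (exp (- (total_rate i * y\<^sup>2) / 2))"
    by (simp only: ennreal_mult' exp_ge_zero)
  moreover have "indicator positive_fields (B(i := y)) =
      (indicator {L. \<forall>x. x \<noteq> i \<longrightarrow> 0 < L x} B * indicator {0<..} y :: ennreal)"
    by (auto simp: positive_fields_def split: split_indicator)
  ultimately show ?thesis by (simp only: weight_def mult_ac)
qed

lemma pairing_slices:
  assumes i: "i \<noteq> x0" and k: "k \<in> borel_measurable field_space" and f: "f \<in> borel_measurable field_space"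
  shows "pairing s k f = (\<integral>\<^sup>+\<phi>. \<integral>\<^sup>+y. weight ((\<phi>(x0 := s))(i := y)) *
      (k ((\<phi>(x0 := s))(i := y)) * f ((\<phi>(x0 := s))(i := y))) \<partial>lborel \<partial>Pi\<^sub>M (- {x0, i}) (\<lambda>_. lborel))"
proof -
  interpret product_sigma_finite "\<lambda>_ :: 'v. lborel :: real measure" by standard
  have I: "- {x0} = insert i (- {x0, i})" using i by auto
  have "pairing s k f = (\<integral>\<^sup>+\<phi>. weight (\<phi>(x0 := s)) * (k (\<phi>(x0 := s)) * f (\<phi>(x0 := s)))
      \<partial>Pi\<^sub>M (insert i (- {x0, i})) (\<lambda>_. lborel))"
    unfolding pairing_def I[symmetric] ..
  also have "\<dots> = (\<integral>\<^sup>+\<phi>. \<integral>\<^sup>+y. weight ((\<phi>(i := y))(x0 := s)) *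
      (k ((\<phi>(i := y))(x0 := s)) * f ((\<phi>(i := y))(x0 := s))) \<partial>lborel \<partial>Pi\<^sub>M (- {x0, i}) (\<lambda>_. lborel))"
    by (rule product_nn_integral_insert)
       (use measurable_pairing_integrand[OF k f, of s] in \<open>simp_all add: I[symmetric]\<close>)
  finally show ?thesis by (simp only: fun_upd_twist[OF i])
qed

text \<open>All the coordinates but the one at \<open>i\<close> are fixed, and the identity is
  \<open>lower_raise_adjoint_real\<close> in the remaining one: the exponential weight of the holding time turns the
  Gaussian weight at \<open>L i\<close> into the one at \<open>t = sqrt ((L i)\<^sup>2 + 2 * u)\<close>, and \<open>du = t dt\<close> provides the factor
  \<open>L i\<close> of \<open>lower i\<close>.\<close>

lemma raise_adjoint:
  assumes i: "i \<noteq> x0" and k [measurable]: "k \<in> borel_measurable field_space"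
    and f [measurable]: "f \<in> borel_measurable field_space"
  shows "pairing s k (raise i f) = pairing s (lower i k) f"
proof -
  have "pairing s k (raise i f) = (\<integral>\<^sup>+\<phi>. \<integral>\<^sup>+y. weight ((\<phi>(x0 := s))(i := y)) *
      (k ((\<phi>(x0 := s))(i := y)) * raise i f ((\<phi>(x0 := s))(i := y))) \<partial>lborel \<partial>Pi\<^sub>M (- {x0, i}) (\<lambda>_. lborel))"
    by (rule pairing_slices[OF i]) measurable
  also have "\<dots> = (\<integral>\<^sup>+\<phi>. \<integral>\<^sup>+y. weight ((\<phi>(x0 := s))(i := y)) *
      (lower i k ((\<phi>(x0 := s))(i := y)) * f ((\<phi>(x0 := s))(i := y))) \<partial>lborel \<partial>Pi\<^sub>M (- {x0, i}) (\<lambda>_. lborel))"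
  proof (rule nn_integral_cong)
    fix \<phi> :: "'v \<Rightarrow> real"
    define B where "B = \<phi>(x0 := s)"
    define b where "b = indicator {L. \<forall>x. x \<noteq> i \<longrightarrow> 0 < L x} B * ennreal (exp (- (\<Sum>x\<in>- {i}. total_rate x * (B x)\<^sup>2) / 2))"
    define K where "K v = k (B(i := v))" for v
    define F where "F v = f (B(i := v))" for v
    have K [measurable]: "K \<in> borel_measurable borel" and F [measurable]: "F \<in> borel_measurable borel"
      unfolding K_def F_def by (rule measurable_lower_slice[OF k], rule measurable_lower_slice[OF f])
    have w: "weight (B(i := y)) = b * (indicator {0<..} y * ennreal (exp (- (total_rate i * y\<^sup>2) / 2)))" for y
      unfolding b_def by (rule weight_upd)
    have ra: "raise i f (B(i := v)) = (\<integral>\<^sup>+u. indicator {0<..} u *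
        (ennreal (exp (- total_rate i * u)) * F (sqrt (v\<^sup>2 + 2 * u))) \<partial>lborel)" for v
      by (simp add: raise_def F_def)
    have lo: "lower i k (B(i := t)) = ennreal t * (\<integral>\<^sup>+v. indicator {0<..<t} v * K v \<partial>lborel)" for t
      by (simp add: lower_def K_def)
    have [measurable]: "(\<lambda>v. raise i f (B(i := v))) \<in> borel_measurable borel"
      "(\<lambda>v. lower i k (B(i := v))) \<in> borel_measurable borel"
      by (rule measurable_lower_slice, measurable)+
    have "(\<integral>\<^sup>+y. weight (B(i := y)) * (k (B(i := y)) * raise i f (B(i := y))) \<partial>lborel) =
        (\<integral>\<^sup>+y. b * (indicator {0<..} y * (ennreal (exp (- (total_rate i * y\<^sup>2) / 2)) *
          (K y * raise i f (B(i := y))))) \<partial>lborel)"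
      by (simp only: w K_def mult.assoc)
    also have "\<dots> = b * (\<integral>\<^sup>+y. indicator {0<..} y * (ennreal (exp (- (total_rate i * y\<^sup>2) / 2)) *
          (K y * raise i f (B(i := y)))) \<partial>lborel)"
      by (rule nn_integral_cmult) measurable
    also have "\<dots> = b * (\<integral>\<^sup>+y. indicator {0<..} y * (ennreal (exp (- (total_rate i * y\<^sup>2) / 2)) *
          (lower i k (B(i := y)) * F y)) \<partial>lborel)"
      unfolding ra lo lower_raise_adjoint_real[OF K F] ..
    also have "\<dots> = (\<integral>\<^sup>+y. b * (indicator {0<..} y * (ennreal (exp (- (total_rate i * y\<^sup>2) / 2)) *
          (lower i k (B(i := y)) * F y))) \<partial>lborel)"
      by (rule nn_integral_cmult[symmetric]) measurable
    also have "\<dots> = (\<integral>\<^sup>+y. weight (B(i := y)) * (lower i k (B(i := y)) * f (B(i := y))) \<partial>lborel)"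
      by (simp only: w F_def mult.assoc)
    finally show "(\<integral>\<^sup>+y. weight ((\<phi>(x0 := s))(i := y)) *
      (k ((\<phi>(x0 := s))(i := y)) * raise i f ((\<phi>(x0 := s))(i := y))) \<partial>lborel) =
      (\<integral>\<^sup>+y. weight ((\<phi>(x0 := s))(i := y)) *
      (lower i k ((\<phi>(x0 := s))(i := y)) * f ((\<phi>(x0 := s))(i := y))) \<partial>lborel)"
      by (simp only: B_def)
  qed
  also have "\<dots> = pairing s (lower i k) f"
    by (rule pairing_slices[OF i, symmetric]) measurable
  finally show ?thesis .
qed

text \<open>Passing to the adjoints produces the operators \<open>lower\<close> in the order opposite to that in
  \<open>descent\<close>; \<open>descent_Suc_right\<close> restores it. The factor \<open>s\<close> is the value \<open>L x0\<close>.\<close>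

theorem descent_ascent_duality:
  assumes k [measurable]: "k \<in> borel_measurable field_space" and g [measurable]: "g \<in> borel_measurable field_space"
  shows "ennreal s * pairing s k (ascent n i g) = pairing s (descent n i k) g"
  using k
proof (induction n arbitrary: i k)
  case 0
  note [measurable] = 0
  show ?case
  proof (cases "i = x0")
    case True
    have "ennreal s * pairing s k (ascent 0 i g) = ennreal s * pairing s k g"
      using True by (intro arg_cong2[where f = times] refl pairing_cong) simp
    also have "\<dots> = pairing s k (\<lambda>L. ennreal s * g L)"
      by (rule pairing_cmult_right[symmetric]) measurable
    also have "\<dots> = pairing s (descent 0 i k) g"
      using True by (intro pairing_cong) (simp add: mult_ac)
    finally show ?thesis .
  next
    case False
    then show ?thesis by (simp add: pairing_def)
  qed
next
  case (Suc n)
  note [measurable] = Suc.prems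
  show ?case
  proof (cases "i = x0")
    case True
    then show ?thesis by (simp add: pairing_def)
  next
    case False
    have "ennreal s * pairing s k (ascent (Suc n) i g) =
        ennreal s * pairing s k (\<lambda>L. \<Sum>j\<in>UNIV. ennreal (c i j) * raise i (ascent n j g) L)"
      using False by (intro arg_cong2[where f = times] refl pairing_cong) simp
    also have "\<dots> = (\<Sum>j\<in>UNIV. ennreal (c i j) * (ennreal s * pairing s k (raise i (ascent n j g))))"
      by (subst pairing_sum_right) (simp_all add: pairing_cmult_right sum_distrib_left mult_ac)
    also have "\<dots> = (\<Sum>j\<in>UNIV. ennreal (c i j) * pairing s (descent n j (lower i k)) g)"
      by (simp add: raise_adjoint[OF False] Suc.IH)
    also have "\<dots> = (\<Sum>j\<in>UNIV. ennreal (c i j) * pairing s g (descent n j (lower i k)))"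
      by (rule sum.cong[OF refl]) (simp only: pairing_commute[of s g])
    also have "\<dots> = pairing s g (\<lambda>L. \<Sum>j\<in>UNIV. ennreal (c i j) * descent n j (lower i k) L)"
      by (subst pairing_sum_right) (simp_all add: pairing_cmult_right)
    also have "\<dots> = pairing s g (descent (Suc n) i k)"
      using False by (intro pairing_cong) (simp only: descent_Suc_right[OF Suc.prems] if_False)
    finally show ?thesis by (simp only: pairing_commute[of s g])
  qed
qed

end

section \<open>Symmetries of Lebesgue measure and the law of the free field\<close>

lemma nn_integral_PiM_coordinatewise:
  fixes T :: "'i \<Rightarrow> real \<Rightarrow> real" and F :: "('i \<Rightarrow> real) \<Rightarrow> ennreal"
  assumes "finite J"
    and T [measurable]: "\<And>x. T x \<in> borel_measurable borel"
    and inv: "\<And>x (G :: real \<Rightarrow> ennreal). G \<in> borel_measurable borel \<Longrightarrow>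
      (\<integral>\<^sup>+y. G (T x y) \<partial>lborel) = (\<integral>\<^sup>+y. G y \<partial>lborel)"
    and F: "F \<in> borel_measurable (Pi\<^sub>M J (\<lambda>_. lborel))"
  shows "(\<integral>\<^sup>+\<phi>. F (\<lambda>x\<in>J. T x (\<phi> x)) \<partial>Pi\<^sub>M J (\<lambda>_. lborel)) = (\<integral>\<^sup>+\<phi>. F \<phi> \<partial>Pi\<^sub>M J (\<lambda>_. lborel))"
  using \<open>finite J\<close> F
proof (induction J arbitrary: F rule: finite_induct)
  case empty
  show ?case
    by (intro nn_integral_cong) (auto simp: space_PiM intro!: arg_cong[where f = F])
next
  case (insert i J)
  interpret product_sigma_finite "\<lambda>_ :: 'i. lborel :: real measure" by standard
  have map_meas: "(\<lambda>\<phi>. \<lambda>x\<in>I. T x (\<phi> x)) \<in> Pi\<^sub>M I (\<lambda>_. lborel) \<rightarrow>\<^sub>M Pi\<^sub>M I (\<lambda>_. lborel :: real measure)" for I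
  proof (rule measurable_restrict)
    fix x assume "x \<in> I"
    then have "(\<lambda>\<phi>. \<phi> x) \<in> Pi\<^sub>M I (\<lambda>_. lborel) \<rightarrow>\<^sub>M (lborel :: real measure)"
      by (rule measurable_component_singleton)
    then have "(\<lambda>\<phi>. \<phi> x) \<in> borel_measurable (Pi\<^sub>M I (\<lambda>_. lborel :: real measure))" by simp
    from measurable_compose[OF this T]
    show "(\<lambda>\<phi>. T x (\<phi> x)) \<in> Pi\<^sub>M I (\<lambda>_. lborel) \<rightarrow>\<^sub>M lborel" by simp
  qed
  define F' where "F' \<phi> = (\<integral>\<^sup>+y. F (\<phi>(i := y)) \<partial>lborel)" for \<phi>
  have F': "F' \<in> borel_measurable (Pi\<^sub>M J (\<lambda>_. lborel))"
    unfolding F'_def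
    by (rule lborel.borel_measurable_nn_integral)
       (use measurable_compose[OF measurable_add_dim insert.prems] in \<open>simp add: split_def fun_upd_def\<close>)
  have slice: "(\<lambda>y. F (\<phi>(i := y))) \<in> borel_measurable borel" if "\<phi> \<in> space (Pi\<^sub>M J (\<lambda>_. lborel :: real measure))" for \<phi>
    using measurable_compose[OF measurable_component_update[OF that insert.hyps(2)] insert.prems]
    by (simp add: fun_upd_def)
  have "(\<integral>\<^sup>+\<phi>. F (\<lambda>x\<in>insert i J. T x (\<phi> x)) \<partial>Pi\<^sub>M (insert i J) (\<lambda>_. lborel)) =
      (\<integral>\<^sup>+\<phi>. \<integral>\<^sup>+y. F (\<lambda>x\<in>insert i J. T x ((\<phi>(i := y)) x)) \<partial>lborel \<partial>Pi\<^sub>M J (\<lambda>_. lborel))"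
    by (rule product_nn_integral_insert[OF insert.hyps measurable_compose[OF map_meas insert.prems]])
  also have "\<dots> = (\<integral>\<^sup>+\<phi>. F' (\<lambda>x\<in>J. T x (\<phi> x)) \<partial>Pi\<^sub>M J (\<lambda>_. lborel))"
  proof (rule nn_integral_cong)
    fix \<phi> :: "'i \<Rightarrow> real" assume \<phi>: "\<phi> \<in> space (Pi\<^sub>M J (\<lambda>_. lborel))"
    have eq: "(\<lambda>x\<in>insert i J. T x ((\<phi>(i := y)) x)) = (\<lambda>x\<in>J. T x (\<phi> x))(i := T i y)" for y
      using insert.hyps(2) by (auto simp: fun_eq_iff)
    have "(\<lambda>y. F ((\<lambda>x\<in>J. T x (\<phi> x))(i := y))) \<in> borel_measurable borel"
      by (rule slice) (rule measurable_space[OF map_meas \<phi>])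
    from inv[OF this]
    show "(\<integral>\<^sup>+y. F (\<lambda>x\<in>insert i J. T x ((\<phi>(i := y)) x)) \<partial>lborel) = F' (\<lambda>x\<in>J. T x (\<phi> x))"
      by (simp only: eq F'_def)
  qed
  also have "\<dots> = (\<integral>\<^sup>+\<phi>. F' \<phi> \<partial>Pi\<^sub>M J (\<lambda>_. lborel))"
    by (rule insert.IH[OF F'])
  also have "\<dots> = (\<integral>\<^sup>+\<phi>. F \<phi> \<partial>Pi\<^sub>M (insert i J) (\<lambda>_. lborel))"
    unfolding F'_def by (rule product_nn_integral_insert[symmetric, OF insert.hyps insert.prems])
  finally show ?case .
qed

context conductance_graph
begin

lemma nn_integral_free_translate:
  assumes G: "G \<in> borel_measurable field_space"
  shows "(\<integral>\<^sup>+\<phi>. G (\<lambda>x. (\<phi>(x0 := 0)) x + s) \<partial>free_fields) = (\<integral>\<^sup>+\<phi>. G (\<phi>(x0 := s)) \<partial>free_fields)"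
proof -
  have "(\<integral>\<^sup>+\<phi>. G ((\<lambda>x\<in>- {x0}. \<phi> x + s)(x0 := s)) \<partial>free_fields) = (\<integral>\<^sup>+\<phi>. G (\<phi>(x0 := s)) \<partial>free_fields)"
  proof (rule nn_integral_PiM_coordinatewise)
    show "(\<integral>\<^sup>+y. H (y + s) \<partial>lborel) = (\<integral>\<^sup>+y. H y \<partial>lborel)" if "H \<in> borel_measurable borel" for H :: "real \<Rightarrow> ennreal"
      using nn_integral_real_affine[OF that, of 1 s] by (simp add: add.commute)
    show "(\<lambda>\<phi>. G (\<phi>(x0 := s))) \<in> borel_measurable free_fields"
      by (rule measurable_compose[OF measurable_extend G])
  qed simp_all
  moreover have "(\<lambda>x\<in>- {x0}. \<phi> x + s)(x0 := s) = (\<lambda>x. (\<phi>(x0 := 0)) x + s)" for \<phi>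
    by (auto simp: fun_eq_iff)
  ultimately show ?thesis by simp
qed

lemma nn_integral_free_signs:
  assumes \<sigma>: "\<sigma> \<in> spins x0" and G: "G \<in> borel_measurable field_space"
  shows "(\<integral>\<^sup>+\<phi>. G (\<lambda>x. \<sigma> x * (\<phi>(x0 := s)) x) \<partial>free_fields) = (\<integral>\<^sup>+\<phi>. G (\<phi>(x0 := s)) \<partial>free_fields)"
proof -
  have "(\<integral>\<^sup>+\<phi>. G ((\<lambda>x\<in>- {x0}. \<sigma> x * \<phi> x)(x0 := s)) \<partial>free_fields) = (\<integral>\<^sup>+\<phi>. G (\<phi>(x0 := s)) \<partial>free_fields)"
  proof (rule nn_integral_PiM_coordinatewise)
    show "(\<integral>\<^sup>+y. H (\<sigma> x * y) \<partial>lborel) = (\<integral>\<^sup>+y. H y \<partial>lborel)" if "H \<in> borel_measurable borel" for x and H :: "real \<Rightarrow> ennreal"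
    proof -
      have "\<sigma> x \<noteq> 0" using spin_abs[OF \<sigma>, of x] by auto
      then show ?thesis using nn_integral_real_affine[OF that, of "\<sigma> x" 0] spin_abs[OF \<sigma>, of x] by simp
    qed
    show "(\<lambda>\<phi>. G (\<phi>(x0 := s))) \<in> borel_measurable free_fields"
      by (rule measurable_compose[OF measurable_extend G])
  qed simp_all
  moreover have "(\<lambda>x\<in>- {x0}. \<sigma> x * \<phi> x)(x0 := s) = (\<lambda>x. \<sigma> x * (\<phi>(x0 := s)) x)" for \<phi>
    using spin_root[OF \<sigma>] by (auto simp: fun_eq_iff)
  ultimately show ?thesis by simp
qed

lemma AE_free_nonzero:
  assumes "0 < s"
  shows "AE \<phi> in free_fields. \<forall>x. (\<phi>(x0 := s)) x \<noteq> 0"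
proof -
  interpret product_sigma_finite "\<lambda>_ :: 'v. lborel :: real measure" by standard
  have "AE \<phi> in free_fields. \<forall>x\<in>- {x0}. \<phi> x \<noteq> 0"
  proof (rule AE_finite_allI)
    fix i assume i: "i \<in> - {x0}"
    then have I: "- {x0} = insert i (- {x0, i})" by auto
    have comp: "(\<lambda>\<phi>. \<phi> i) \<in> borel_measurable free_fields"
      using measurable_component_singleton[OF i, of "\<lambda>_. lborel :: real measure"] by simp
    have meas: "(\<lambda>\<phi>. indicator {0} (\<phi> i) :: ennreal) \<in> borel_measurable free_fields"
      by (rule measurable_compose[OF comp]) simp
    have "(\<integral>\<^sup>+\<phi>. indicator {0} (\<phi> i) \<partial>free_fields) =
        (\<integral>\<^sup>+\<phi>. indicator {0} (\<phi> i) \<partial>Pi\<^sub>M (insert i (- {x0, i})) (\<lambda>_. lborel :: real measure))"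
      unfolding I[symmetric] ..
    also have "\<dots> = (\<integral>\<^sup>+\<phi>. \<integral>\<^sup>+y. indicator {0} ((\<phi>(i := y)) i) \<partial>lborel \<partial>Pi\<^sub>M (- {x0, i}) (\<lambda>_. lborel :: real measure))"
      by (rule product_nn_integral_insert) (use meas in \<open>simp_all add: I[symmetric]\<close>)
    also have "\<dots> = 0" by simp
    finally have "AE \<phi> in free_fields. (indicator {0} (\<phi> i) :: ennreal) = 0"
      using meas by (subst (asm) nn_integral_0_iff_AE)
    then show "AE \<phi> in free_fields. \<phi> i \<noteq> 0"
      by eventually_elim (auto split: split_indicator_asm)
  qed simp
  then show ?thesis
    by eventually_elim (use assms in auto)
qed

text \<open>For almost every field exactly one choice of the signs makes all the coordinates positive, and
  changing signs preserves Lebesgue measure.\<close>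

lemma nn_integral_free_sign_decomposition:
  assumes s: "0 < s" and G [measurable]: "G \<in> borel_measurable field_space"
  shows "(\<integral>\<^sup>+\<phi>. G (\<phi>(x0 := s)) \<partial>free_fields) =
    (\<Sum>\<sigma>\<in>spins x0. \<integral>\<^sup>+\<phi>. indicator positive_fields (\<phi>(x0 := s)) * G (\<lambda>x. \<sigma> x * (\<phi>(x0 := s)) x) \<partial>free_fields)"
proof -
  define H where "H \<sigma> \<psi> = indicator positive_fields (\<lambda>x. \<sigma> x * \<psi> x) * G \<psi>" for \<sigma> \<psi> :: "'v \<Rightarrow> real"
  have H: "H \<sigma> \<in> borel_measurable field_space" for \<sigma>
  proof -
    have [measurable]: "(\<lambda>\<psi>. indicator positive_fields (\<lambda>x. \<sigma> x * \<psi> x) :: ennreal) \<in> borel_measurable field_space"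
      by (rule measurable_compose[OF measurable_sign_field borel_measurable_indicator[OF sets_positive_fields]])
    show ?thesis unfolding H_def by measurable
  qed
  have one: "(\<Sum>\<sigma>\<in>spins x0. H \<sigma> \<psi>) = G \<psi>" if nz: "\<forall>x. \<psi> x \<noteq> 0" and root: "\<psi> x0 = s" for \<psi>
  proof -
    define \<tau> where "\<tau> x = sgn (\<psi> x)" for x
    have \<tau>: "\<tau> \<in> spins x0" using nz root s by (auto simp: \<tau>_def spins_def sgn_if)
    have iff: "(\<lambda>x. \<sigma> x * \<psi> x) \<in> positive_fields \<longleftrightarrow> \<sigma> = \<tau>" if \<sigma>: "\<sigma> \<in> spins x0" for \<sigma>
    proof
      assume "(\<lambda>x. \<sigma> x * \<psi> x) \<in> positive_fields"
      then have pos: "0 < \<sigma> x * \<psi> x" for x by (simp add: positive_fields_def)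
      have "\<sigma> x = \<tau> x" for x
        using pos[of x] spin_abs[OF \<sigma>, of x] by (auto simp: \<tau>_def sgn_if zero_less_mult_iff abs_if split: if_splits)
      then show "\<sigma> = \<tau>" by auto
    next
      assume "\<sigma> = \<tau>"
      then show "(\<lambda>x. \<sigma> x * \<psi> x) \<in> positive_fields"
        using nz by (auto simp: positive_fields_def \<tau>_def sgn_if zero_less_mult_iff not_less le_less)
    qed
    have "(\<Sum>\<sigma>\<in>spins x0. H \<sigma> \<psi>) = (\<Sum>\<sigma>\<in>spins x0. if \<sigma> = \<tau> then G \<psi> else 0)"
      using iff by (intro sum.cong) (auto simp: H_def)
    then show ?thesis using \<tau> by simp
  qed
  have "(\<integral>\<^sup>+\<phi>. G (\<phi>(x0 := s)) \<partial>free_fields) = (\<integral>\<^sup>+\<phi>. (\<Sum>\<sigma>\<in>spins x0. H \<sigma> (\<phi>(x0 := s))) \<partial>free_fields)"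
  proof (rule nn_integral_cong_AE)
    show "AE \<phi> in free_fields. G (\<phi>(x0 := s)) = (\<Sum>\<sigma>\<in>spins x0. H \<sigma> (\<phi>(x0 := s)))"
      using AE_free_nonzero[OF s] by eventually_elim (rule one[symmetric], auto)
  qed
  also have "\<dots> = (\<Sum>\<sigma>\<in>spins x0. \<integral>\<^sup>+\<phi>. H \<sigma> (\<phi>(x0 := s)) \<partial>free_fields)"
    by (rule nn_integral_sum) (rule measurable_compose[OF measurable_extend H])
  also have "\<dots> = (\<Sum>\<sigma>\<in>spins x0. \<integral>\<^sup>+\<phi>. indicator positive_fields (\<phi>(x0 := s)) * G (\<lambda>x. \<sigma> x * (\<phi>(x0 := s)) x) \<partial>free_fields)"
  proof (rule sum.cong[OF refl])
    fix \<sigma> assume \<sigma>: "\<sigma> \<in> spins x0"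
    have sq: "(\<lambda>x. \<sigma> x * (\<sigma> x * \<psi> x)) = \<psi>" for \<psi>
      using spin_square[OF \<sigma>] by (simp add: mult.assoc[symmetric])
    have "(\<integral>\<^sup>+\<phi>. H \<sigma> (\<phi>(x0 := s)) \<partial>free_fields) = (\<integral>\<^sup>+\<phi>. H \<sigma> (\<lambda>x. \<sigma> x * (\<phi>(x0 := s)) x) \<partial>free_fields)"
      by (rule nn_integral_free_signs[OF \<sigma> H, symmetric])
    then show "(\<integral>\<^sup>+\<phi>. H \<sigma> (\<phi>(x0 := s)) \<partial>free_fields) =
        (\<integral>\<^sup>+\<phi>. indicator positive_fields (\<phi>(x0 := s)) * G (\<lambda>x. \<sigma> x * (\<phi>(x0 := s)) x) \<partial>free_fields)"
      by (simp only: H_def sq)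
  qed
  finally show ?thesis .
qed

lemma exp_dirichlet_energy:
  "exp (- dirichlet_energy E W \<psi> / 2) = exp (- (\<Sum>x\<in>UNIV. total_rate x * (\<psi> x)\<^sup>2) / 2) * gibbs \<psi>"
proof -
  define R where "R = (\<Sum>x\<in>UNIV. total_rate x * (\<psi> x)\<^sup>2)"
  define Q where "Q = (\<Sum>x\<in>UNIV. \<Sum>y\<in>UNIV. c x y * \<psi> x * \<psi> y)"
  have R1: "(\<Sum>x\<in>UNIV. \<Sum>y\<in>UNIV. c x y * (\<psi> x)\<^sup>2) = R"
    by (simp add: R_def total_rate_def sum_distrib_right)
  have R2: "(\<Sum>x\<in>UNIV. \<Sum>y\<in>UNIV. c x y * (\<psi> y)\<^sup>2) = R"
  proof -
    have "(\<Sum>x\<in>UNIV. \<Sum>y\<in>UNIV. c x y * (\<psi> y)\<^sup>2) = (\<Sum>y\<in>UNIV. \<Sum>x\<in>UNIV. c x y * (\<psi> y)\<^sup>2)"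
      by (rule sum.swap)
    also have "\<dots> = (\<Sum>y\<in>UNIV. \<Sum>x\<in>UNIV. c y x * (\<psi> y)\<^sup>2)"
      by (intro sum.cong refl) (simp only: c_sym)
    finally show ?thesis using R1 by simp
  qed
  have "(\<Sum>x\<in>UNIV. \<Sum>y\<in>UNIV. c x y * (\<psi> x - \<psi> y)\<^sup>2) =
      (\<Sum>x\<in>UNIV. \<Sum>y\<in>UNIV. c x y * (\<psi> x)\<^sup>2) + (\<Sum>x\<in>UNIV. \<Sum>y\<in>UNIV. c x y * (\<psi> y)\<^sup>2) - 2 * Q"
    unfolding Q_def
    by (simp add: power2_diff sum.distrib sum_subtractf sum_distrib_left right_diff_distrib distrib_left mult_ac)
  then have "dirichlet_energy E W \<psi> = R - Q"
    by (simp add: dirichlet_energy_def R1 R2)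
  then have "- dirichlet_energy E W \<psi> / 2 = - R / 2 + Q / 2" by (simp add: field_simps)
  then show ?thesis by (simp only: exp_add gibbs_def R_def Q_def)
qed

definition gff_density :: "('v \<Rightarrow> real) \<Rightarrow> real" where
  "gff_density \<phi> = exp (- dirichlet_energy E W (\<phi>(x0 := 0)) / 2)"

text \<open>If the density is not integrable, its Bochner integral is \<open>0\<close> and so is this constant: then
  \<open>gff\<close> is the zero measure, for which the identities below remain true.\<close>

definition gff_const :: ennreal where
  "gff_const = ennreal (1 / (\<integral>\<phi>. gff_density \<phi> \<partial>free_fields))"

lemma measurable_exp_dirichlet [measurable]:
  "(\<lambda>\<psi>. exp (- dirichlet_energy E W \<psi> / 2)) \<in> borel_measurable field_space"
  unfolding dirichlet_energy_def by measurable

lemma measurable_gff_density [measurable]: "gff_density \<in> borel_measurable free_fields"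
  unfolding gff_density_def[abs_def] by (rule measurable_compose[OF measurable_extend measurable_exp_dirichlet])

lemma gff_eq: "gff E W x0 = distr (density free_fields (\<lambda>\<phi>. gff_const * ennreal (gff_density \<phi>))) field_space (\<lambda>\<phi>. \<phi>(x0 := 0))"
proof -
  have "0 \<le> (\<integral>\<phi>. gff_density \<phi> \<partial>free_fields)"
    by (rule Bochner_Integration.integral_nonneg) (simp add: gff_density_def)
  then have "ennreal (gff_density \<phi> / (\<integral>\<phi>. gff_density \<phi> \<partial>free_fields)) = gff_const * ennreal (gff_density \<phi>)" for \<phi>
    by (simp add: gff_const_def ennreal_mult'[symmetric])
  then show ?thesis by (simp add: gff_def Let_def gff_density_def)
qed

lemma sets_gff [measurable_cong]: "sets (gff E W x0) = sets field_space"
  by (simp add: gff_eq)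

lemma nn_integral_gff:
  assumes G: "G \<in> borel_measurable field_space"
  shows "(\<integral>\<^sup>+\<phi>. G \<phi> \<partial>gff E W x0) =
    gff_const * (\<integral>\<^sup>+\<phi>. ennreal (gff_density \<phi>) * G (\<phi>(x0 := 0)) \<partial>free_fields)"
proof -
  have m: "(\<lambda>\<phi>. \<phi>(x0 := 0)) \<in> density free_fields (\<lambda>\<phi>. gff_const * ennreal (gff_density \<phi>)) \<rightarrow>\<^sub>M field_space"
    using measurable_extend by simp
  have G0: "(\<lambda>\<phi>. G (\<phi>(x0 := 0))) \<in> borel_measurable free_fields"
    by (rule measurable_compose[OF measurable_extend G])
  have d: "(\<lambda>\<phi>. ennreal (gff_density \<phi>)) \<in> borel_measurable free_fields"
    using measurable_gff_density by (rule measurable_compose) simp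
  have "(\<integral>\<^sup>+\<phi>. G \<phi> \<partial>gff E W x0) =
      (\<integral>\<^sup>+\<phi>. gff_const * ennreal (gff_density \<phi>) * G (\<phi>(x0 := 0)) \<partial>free_fields)"
    unfolding gff_eq using d G0 G by (simp add: nn_integral_distr[OF m] nn_integral_density)
  also have "\<dots> = gff_const * (\<integral>\<^sup>+\<phi>. ennreal (gff_density \<phi>) * G (\<phi>(x0 := 0)) \<partial>free_fields)"
    using d G0 by (simp add: mult.assoc nn_integral_cmult)
  finally show ?thesis .
qed

lemma finite_measure_gff: "finite_measure (gff E W x0)"
proof (rule finite_measureI)
  have "emeasure (gff E W x0) (space (gff E W x0)) = (\<integral>\<^sup>+\<phi>. 1 \<partial>gff E W x0)" by simp
  also have "\<dots> = gff_const * (\<integral>\<^sup>+\<phi>. ennreal (gff_density \<phi>) \<partial>free_fields)"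
    by (subst nn_integral_gff) simp_all
  also have "\<dots> \<noteq> \<infinity>"
  proof (cases "integrable free_fields gff_density")
    case True
    then have "(\<integral>\<^sup>+\<phi>. ennreal (gff_density \<phi>) \<partial>free_fields) = ennreal (\<integral>\<phi>. gff_density \<phi> \<partial>free_fields)"
      by (rule nn_integral_eq_integral) (rule AE_I2, simp add: gff_density_def)
    then show ?thesis by (simp add: gff_const_def ennreal_mult_eq_top_iff)
  next
    case False
    then show ?thesis by (simp add: gff_const_def not_integrable_integral_eq)
  qed
  finally show "emeasure (gff E W x0) (space (gff E W x0)) \<noteq> \<infinity>" .
qed

lemma nn_integral_shifted_gff:
  assumes s: "0 < s" and G [measurable]: "G \<in> borel_measurable field_space"
  shows "(\<integral>\<^sup>+\<phi>. G (\<lambda>x. \<phi> x + s) \<partial>gff E W x0) =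
    gff_const * (\<Sum>\<sigma>\<in>spins x0. pairing s (\<lambda>L. ennreal (gibbs (\<lambda>x. \<sigma> x * L x))) (\<lambda>L. G (\<lambda>x. \<sigma> x * L x)))"
proof -
  let ?e = "\<lambda>\<psi>. ennreal (exp (- dirichlet_energy E W \<psi> / 2))"
  have [measurable]: "(\<lambda>\<phi> x. \<phi> x + s) \<in> field_space \<rightarrow>\<^sub>M (field_space :: ('v \<Rightarrow> real) measure)"
    by (rule measurable_PiM_single') auto
  have shift: "dirichlet_energy E W (\<phi>(x0 := 0)) = dirichlet_energy E W (\<lambda>x. (\<phi>(x0 := 0)) x + s)" for \<phi>
    unfolding dirichlet_energy_def by (simp del: fun_upd_apply)
  have "(\<integral>\<^sup>+\<phi>. G (\<lambda>x. \<phi> x + s) \<partial>gff E W x0) =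
      gff_const * (\<integral>\<^sup>+\<phi>. ennreal (gff_density \<phi>) * G (\<lambda>x. (\<phi>(x0 := 0)) x + s) \<partial>free_fields)"
    by (rule nn_integral_gff) measurable
  also have "(\<integral>\<^sup>+\<phi>. ennreal (gff_density \<phi>) * G (\<lambda>x. (\<phi>(x0 := 0)) x + s) \<partial>free_fields) =
      (\<integral>\<^sup>+\<phi>. (\<lambda>\<psi>. ?e \<psi> * G \<psi>) (\<lambda>x. (\<phi>(x0 := 0)) x + s) \<partial>free_fields)"
    by (simp only: gff_density_def shift)
  also have "\<dots> = (\<integral>\<^sup>+\<phi>. (\<lambda>\<psi>. ?e \<psi> * G \<psi>) (\<phi>(x0 := s)) \<partial>free_fields)"
    by (rule nn_integral_free_translate) measurable
  also have "\<dots> = (\<Sum>\<sigma>\<in>spins x0. \<integral>\<^sup>+\<phi>. indicator positive_fields (\<phi>(x0 := s)) *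
      (\<lambda>\<psi>. ?e \<psi> * G \<psi>) (\<lambda>x. \<sigma> x * (\<phi>(x0 := s)) x) \<partial>free_fields)"
    by (rule nn_integral_free_sign_decomposition[OF s]) measurable
  also have "\<dots> = (\<Sum>\<sigma>\<in>spins x0. pairing s (\<lambda>L. ennreal (gibbs (\<lambda>x. \<sigma> x * L x))) (\<lambda>L. G (\<lambda>x. \<sigma> x * L x)))"
  proof (rule sum.cong[OF refl])
    fix \<sigma> assume \<sigma>: "\<sigma> \<in> spins x0"
    have e: "?e (\<lambda>x. \<sigma> x * L x) = ennreal (exp (- (\<Sum>x\<in>UNIV. total_rate x * (L x)\<^sup>2) / 2)) * ennreal (gibbs (\<lambda>x. \<sigma> x * L x))" for L
    proof -
      have "(\<sigma> x * L x)\<^sup>2 = (L x)\<^sup>2" for x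
        using spin_square[OF \<sigma>, of x] by (simp add: power_mult_distrib power2_eq_square)
      then show ?thesis by (simp only: exp_dirichlet_energy ennreal_mult' exp_ge_zero)
    qed
    show "(\<integral>\<^sup>+\<phi>. indicator positive_fields (\<phi>(x0 := s)) *
        (\<lambda>\<psi>. ?e \<psi> * G \<psi>) (\<lambda>x. \<sigma> x * (\<phi>(x0 := s)) x) \<partial>free_fields) =
      pairing s (\<lambda>L. ennreal (gibbs (\<lambda>x. \<sigma> x * L x))) (\<lambda>L. G (\<lambda>x. \<sigma> x * L x))"
      by (simp only: e pairing_def weight_def mult.assoc)
  qed
  finally show ?thesis .
qed


section \<open>The conditional law of the field\<close>

definition descent_mass :: "'v \<Rightarrow> ('v \<Rightarrow> real) set \<Rightarrow> ('v \<Rightarrow> real) \<Rightarrow> ennreal" where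
  "descent_mass z A \<Phi> = (\<Sum>n. descent n z (signed_weight A) \<Phi>)"

lemma measurable_descent_mass [measurable]:
  assumes [measurable]: "A \<in> sets field_space"
  shows "descent_mass z A \<in> borel_measurable field_space"
  unfolding descent_mass_def[abs_def] by measurable

lemma measurable_ray_knight_field:
  assumes "right_continuous_process M X"
  shows "ray_knight_field X x0 s \<in> M \<Otimes>\<^sub>M gff E W x0 \<rightarrow>\<^sub>M field_space"
proof -
  interpret right_continuous_process M X by fact
  show ?thesis
  proof (rule measurable_PiM_single')
    fix x
    have "(\<lambda>\<omega>. hitting_local_time (\<lambda>t. X t \<omega>) x0 x) \<in> borel_measurable M"
      by measurable
    from measurable_compose[OF measurable_fst this]
    have [measurable]: "(\<lambda>p. hitting_local_time (\<lambda>t. X t (fst p)) x0 x)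
        \<in> borel_measurable (M \<Otimes>\<^sub>M gff E W x0)" .
    have "(\<lambda>\<phi>. \<phi> x) \<in> borel_measurable (gff E W x0)"
      by (subst measurable_cong_sets[OF sets_gff refl]) simp
    from measurable_compose[OF measurable_snd this]
    have [measurable]: "(\<lambda>p. snd p x) \<in> borel_measurable (M \<Otimes>\<^sub>M gff E W x0)" .
    show "(\<lambda>p. ray_knight_field X x0 s p x) \<in> borel_measurable (M \<Otimes>\<^sub>M gff E W x0)"
      unfolding ray_knight_field_def split_def Let_def by measurable
  qed auto
qed

lemma measurable_shifted_field:
  "(\<lambda>(\<omega>, \<phi>) x. \<phi> x + s) \<in> M \<Otimes>\<^sub>M gff E W x0 \<rightarrow>\<^sub>M (field_space :: ('v \<Rightarrow> real) measure)"
proof (rule measurable_PiM_single')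
  fix x
  have "(\<lambda>\<phi>. \<phi> x) \<in> borel_measurable (gff E W x0)"
    by (subst measurable_cong_sets[OF sets_gff refl]) simp
  from measurable_compose[OF measurable_snd this]
  have [measurable]: "(\<lambda>p. snd p x) \<in> borel_measurable (M \<Otimes>\<^sub>M gff E W x0)" .
  show "(\<lambda>p. (case p of (\<omega>, \<phi>) \<Rightarrow> \<lambda>x. \<phi> x + s) x) \<in> borel_measurable (M \<Otimes>\<^sub>M gff E W x0)"
    unfolding split_def by measurable
qed auto

text \<open>For fixed \<open>\<psi>\<close>, integrating over the walk gives the ascents of \<open>g\<close> from \<open>\<bar>\<psi>\<bar>\<close>. Summing over the signs of
  \<open>\<psi>\<close> gives the pairing of these ascents with \<open>signed_weight A\<close>, and duality moves them to the
  other side.\<close>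

lemma joint_law:
  assumes s: "0 < s" and X: "markov_jump_process M E W z X"
    and A [measurable]: "A \<in> sets field_space" and g [measurable]: "g \<in> borel_measurable field_space"
  shows "ennreal s * (\<integral>\<^sup>+p. indicator A (\<lambda>x. snd p x + s) * g (ray_knight_field X x0 s p) \<partial>(M \<Otimes>\<^sub>M gff E W x0)) =
    gff_const * pairing s (descent_mass z A) g"
proof -
  interpret local_time_jump_process M X "\<lambda>_. c" z
    using X by (intro local_time_jump_processI) (simp_all add: markov_jump_process_def)
  interpret G: finite_measure "gff E W x0" by (rule finite_measure_gff)
  interpret PG: pair_sigma_finite M "gff E W x0" ..
  note RK = measurable_ray_knight_field[OF right_continuous_process_axioms, of s]
  define H where "H L = (\<Sum>n. ascent n z g L)" for L
  have H [measurable]: "H \<in> borel_measurable field_space"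
    unfolding H_def[abs_def] by measurable
  have [measurable]: "(\<lambda>\<phi> x. \<bar>\<phi> x\<bar>) \<in> field_space \<rightarrow>\<^sub>M (field_space :: ('v \<Rightarrow> real) measure)"
    by (rule measurable_PiM_single') auto
  have sg: "signed_weight A \<in> borel_measurable field_space" by measurable
  have meas: "(\<lambda>p. indicator A (\<lambda>x. snd p x + s) * g (ray_knight_field X x0 s p)) \<in> borel_measurable (M \<Otimes>\<^sub>M gff E W x0)"
  proof (rule borel_measurable_times_ennreal)
    have "(\<lambda>p. indicator A ((\<lambda>(\<omega>, \<phi>) x. \<phi> x + s) p) :: ennreal) \<in> borel_measurable (M \<Otimes>\<^sub>M gff E W x0)"
      by (rule measurable_compose[OF measurable_shifted_field borel_measurable_indicator[OF A]])
    then show "(\<lambda>p. indicator A (\<lambda>x. snd p x + s) :: ennreal) \<in> borel_measurable (M \<Otimes>\<^sub>M gff E W x0)"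
      by (simp add: split_def)
    show "(\<lambda>p. g (ray_knight_field X x0 s p)) \<in> borel_measurable (M \<Otimes>\<^sub>M gff E W x0)"
      by (rule measurable_compose[OF RK g])
  qed
  have "(\<integral>\<^sup>+p. indicator A (\<lambda>x. snd p x + s) * g (ray_knight_field X x0 s p) \<partial>(M \<Otimes>\<^sub>M gff E W x0)) =
      (\<integral>\<^sup>+\<phi>. \<integral>\<^sup>+\<omega>. indicator A (\<lambda>x. \<phi> x + s) * g (ray_knight_field X x0 s (\<omega>, \<phi>)) \<partial>M \<partial>gff E W x0)"
    using PG.nn_integral_snd[OF meas] by simp
  also have "\<dots> = (\<integral>\<^sup>+\<phi>. (\<lambda>\<psi>. indicator A \<psi> * H (\<lambda>x. \<bar>\<psi> x\<bar>)) (\<lambda>x. \<phi> x + s) \<partial>gff E W x0)"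
  proof (rule nn_integral_cong)
    fix \<phi> assume \<phi>: "\<phi> \<in> space (gff E W x0)"
    have "(\<lambda>\<omega>. ray_knight_field X x0 s (\<omega>, \<phi>)) \<in> M \<rightarrow>\<^sub>M field_space"
      by (rule measurable_compose[OF measurable_Pair2'[OF \<phi>] RK])
    then have "(\<lambda>\<omega>. g (ray_knight_field X x0 s (\<omega>, \<phi>))) \<in> borel_measurable M"
      by (rule measurable_compose) (rule g)
    then have "(\<integral>\<^sup>+\<omega>. indicator A (\<lambda>x. \<phi> x + s) * g (ray_knight_field X x0 s (\<omega>, \<phi>)) \<partial>M) =
        indicator A (\<lambda>x. \<phi> x + s) * (\<integral>\<^sup>+\<omega>. g (ray_knight_field X x0 s (\<omega>, \<phi>)) \<partial>M)"
      by (rule nn_integral_cmult)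
    then show "(\<integral>\<^sup>+\<omega>. indicator A (\<lambda>x. \<phi> x + s) * g (ray_knight_field X x0 s (\<omega>, \<phi>)) \<partial>M) =
        (\<lambda>\<psi>. indicator A \<psi> * H (\<lambda>x. \<bar>\<psi> x\<bar>)) (\<lambda>x. \<phi> x + s)"
      using nn_integral_conductance_local_time[OF X g, of "\<lambda>x. \<phi> x + s"]
      by (simp add: ray_knight_field_def Let_def H_def)
  qed
  also have "\<dots> = gff_const * (\<Sum>\<sigma>\<in>spins x0. pairing s (\<lambda>L. ennreal (gibbs (\<lambda>x. \<sigma> x * L x)))
      (\<lambda>L. indicator A (\<lambda>x. \<sigma> x * L x) * H (\<lambda>x. \<bar>\<sigma> x * L x\<bar>)))"
    by (rule nn_integral_shifted_gff[OF s]) measurable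
  also have "(\<Sum>\<sigma>\<in>spins x0. pairing s (\<lambda>L. ennreal (gibbs (\<lambda>x. \<sigma> x * L x)))
      (\<lambda>L. indicator A (\<lambda>x. \<sigma> x * L x) * H (\<lambda>x. \<bar>\<sigma> x * L x\<bar>))) =
    (\<Sum>\<sigma>\<in>spins x0. pairing s H (\<lambda>L. ennreal (gibbs (\<lambda>x. \<sigma> x * L x)) * indicator A (\<lambda>x. \<sigma> x * L x)))"
  proof (intro sum.cong refl pairing_cong)
    fix \<sigma> L assume \<sigma>: "\<sigma> \<in> spins x0" and L: "L \<in> positive_fields"
    have "(\<lambda>x. \<bar>\<sigma> x * L x\<bar>) = L"
      using spin_abs[OF \<sigma>] positive_fieldsD[OF L] by (simp add: abs_mult fun_eq_iff abs_of_pos)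
    then show "ennreal (gibbs (\<lambda>x. \<sigma> x * L x)) * (indicator A (\<lambda>x. \<sigma> x * L x) * H (\<lambda>x. \<bar>\<sigma> x * L x\<bar>)) =
        H L * (ennreal (gibbs (\<lambda>x. \<sigma> x * L x)) * indicator A (\<lambda>x. \<sigma> x * L x))"
      by (simp add: mult_ac)
  qed
  also have "\<dots> = pairing s H (\<lambda>L. \<Sum>\<sigma>\<in>spins x0. ennreal (gibbs (\<lambda>x. \<sigma> x * L x)) * indicator A (\<lambda>x. \<sigma> x * L x))"
  proof (rule pairing_sum_right[symmetric, OF H])
    fix \<sigma>
    have [measurable]: "(\<lambda>L. indicator A (\<lambda>x. \<sigma> x * L x) :: ennreal) \<in> borel_measurable field_space"
      by (rule measurable_compose[OF measurable_sign_field borel_measurable_indicator[OF A]])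
    show "(\<lambda>L. ennreal (gibbs (\<lambda>x. \<sigma> x * L x)) * indicator A (\<lambda>x. \<sigma> x * L x)) \<in> borel_measurable field_space"
      by measurable
  qed
  also have "\<dots> = pairing s (signed_weight A) H"
    by (simp only: pairing_commute[of s H] signed_weight_def[abs_def])
  also have "\<dots> = (\<Sum>n. pairing s (signed_weight A) (ascent n z g))"
    unfolding H_def[abs_def] by (rule pairing_suminf_right[OF sg]) measurable
  finally have "ennreal s * (\<integral>\<^sup>+p. indicator A (\<lambda>x. snd p x + s) * g (ray_knight_field X x0 s p) \<partial>(M \<Otimes>\<^sub>M gff E W x0)) =
      gff_const * (\<Sum>n. ennreal s * pairing s (signed_weight A) (ascent n z g))"
    by (simp add: mult.left_commute)
  also have "(\<Sum>n. ennreal s * pairing s (signed_weight A) (ascent n z g)) = (\<Sum>n. pairing s g (descent n z (signed_weight A)))"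
    by (simp only: descent_ascent_duality[OF sg g] pairing_commute[of s g])
  also have "\<dots> = pairing s (descent_mass z A) g"
    unfolding pairing_commute[of s _ g] descent_mass_def[abs_def]
    by (rule pairing_suminf_right[symmetric, OF g]) measurable
  finally show ?thesis .
qed

end

theorem theorem7:
  fixes E :: "'v::finite set set" and W :: "'v set \<Rightarrow> real" and x0 z0 :: 'v and s :: real
    and M :: "'a measure" and X :: "real \<Rightarrow> 'a \<Rightarrow> 'v"
    and N :: "('v \<Rightarrow> real) \<Rightarrow> 'b measure" and Y :: "('v \<Rightarrow> real) \<Rightarrow> real \<Rightarrow> 'b \<Rightarrow> 'v"
  assumes "weighted_graph E W"
    and "0 < s"
    and "markov_jump_process M E W z0 X"
    and "\<And>\<Phi>. (\<forall>x. 0 < \<Phi> x) \<Longrightarrow> check_process (N \<Phi>) E W x0 \<Phi> z0 (Y \<Phi>)"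
  shows "conditional_law_given (M \<Otimes>\<^sub>M gff E W x0)
           field_space (\<lambda>(\<omega>, \<phi>) x. \<phi> x + s)
           field_space (ray_knight_field X x0 s)
           {\<Phi>. \<forall>x. 0 < \<Phi> x}
           (\<lambda>\<Phi>. signed_check_L_law E W x0 \<Phi> (N \<Phi>) (Y \<Phi>))"
proof -
  interpret conductance_graph E W x0 by unfold_locales (rule assms(1))
  note s = assms(2) and X = assms(3)
  interpret X: local_time_jump_process M X "\<lambda>_. c" z0
    using X by (intro local_time_jump_processI) (simp_all add: markov_jump_process_def)
  interpret G: finite_measure "gff E W x0" by (rule finite_measure_gff)
  define P where "P = M \<Otimes>\<^sub>M gff E W x0"
  define \<psi> where "\<psi> = (\<lambda>(\<omega> :: 'a, \<phi>) (x :: 'v). \<phi> x + s)"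
  define \<Phi> where "\<Phi> = ray_knight_field X x0 s"
  define K where "K = (\<lambda>\<Phi>. signed_check_L_law E W x0 \<Phi> (N \<Phi>) (Y \<Phi>))"
  interpret P: finite_measure P
    unfolding P_def by (rule finite_measure_pair_measure) unfold_locales
  have D: "{\<Phi>. \<forall>x. 0 < \<Phi> x} = positive_fields" by (simp add: positive_fields_def)
  have check: "check_process (N L) E W x0 L z0 (Y L)" if "L \<in> positive_fields" for L
    using assms(4) that by (simp add: positive_fields_def)
  have \<psi> [measurable]: "\<psi> \<in> P \<rightarrow>\<^sub>M field_space"
    unfolding \<psi>_def P_def by (rule measurable_shifted_field)
  have \<Phi> [measurable]: "\<Phi> \<in> P \<rightarrow>\<^sub>M field_space"
    unfolding \<Phi>_def P_def by (rule measurable_ray_knight_field) unfold_locales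
  have joint: "ennreal s * (\<integral>\<^sup>+p. indicator A (\<psi> p) * g (\<Phi> p) \<partial>P) = gff_const * pairing s (descent_mass z0 A) g"
    if "A \<in> sets field_space" "g \<in> borel_measurable field_space" for A g
    using joint_law[OF s X that] by (simp add: \<psi>_def \<Phi>_def P_def split_def)
  have cancel: "x = y" if "ennreal s * x = ennreal s * y" for x y
    using that s by (simp add: ennreal_mult_cancel_left)
  have K_prob: "prob_space (K L)" and K_sets: "sets (K L) = sets field_space"
    and K_emeasure: "A \<in> sets field_space \<Longrightarrow> spin_mass z0 L * emeasure (K L) A = descent_mass z0 A L"
    if "L \<in> positive_fields" for L A
    using signed_check_L_law_emeasure[OF that check[OF that]] by (auto simp: K_def descent_mass_def)
  have sm: "spin_mass z0 L \<noteq> 0" "spin_mass z0 L \<noteq> \<top>" if "L \<in> positive_fields" for L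
  proof -
    have "0 < L z0 * spin_sum L z0"
      using spin_sum_pos[OF that, of z0] positive_fieldsD[OF that, of z0] by (rule mult_pos_pos[rotated])
    then show "spin_mass z0 L \<noteq> 0" "spin_mass z0 L \<noteq> \<top>"
      by (simp_all only: spin_mass_def ennreal_eq_0_iff not_le ennreal_neq_top not_False_eq_True)
  qed
  have K_eq: "emeasure (K L) A = descent_mass z0 A L / spin_mass z0 L"
    if "A \<in> sets field_space" "L \<in> positive_fields" for A L
    using K_emeasure[OF that(2,1)] sm[OF that(2)]
    by (simp add: K_emeasure[OF that(2,1), symmetric] mult.commute mult_divide_eq_ennreal)
  have mass: "descent_mass z0 UNIV L = spin_mass z0 L" if "L \<in> positive_fields" for L
  proof -
    have "space (K L) = UNIV"
      using sets_eq_imp_space_eq[OF K_sets[OF that]] by (simp add: space_PiM)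
    then have "emeasure (K L) UNIV = 1"
      using prob_space.emeasure_space_1[OF K_prob[OF that]] by simp
    moreover have "UNIV \<in> sets (field_space :: ('v \<Rightarrow> real) measure)"
      using sets.top[of "field_space :: ('v \<Rightarrow> real) measure"] by (simp add: space_PiM)
    ultimately show ?thesis using K_emeasure[OF that, of UNIV] by simp
  qed
  have UNIV_sets: "UNIV \<in> sets (field_space :: ('v \<Rightarrow> real) measure)"
    using sets.top[of "field_space :: ('v \<Rightarrow> real) measure"] by (simp add: space_PiM)
  have AE_D: "AE p in P. \<Phi> p \<in> positive_fields"
  proof -
    have "ennreal s * (\<integral>\<^sup>+p. indicator UNIV (\<psi> p) * indicator (- positive_fields) (\<Phi> p) \<partial>P) =
        gff_const * pairing s (descent_mass z0 UNIV) (indicator (- positive_fields))"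
      using sets.compl_sets[OF sets_positive_fields] by (intro joint UNIV_sets) (simp add: space_PiM Compl_eq_Diff_UNIV)
    also have "pairing s (descent_mass z0 UNIV) (indicator (- positive_fields)) = pairing s (descent_mass z0 UNIV) (\<lambda>_. 0)"
      by (rule pairing_cong) simp
    also have "gff_const * \<dots> = ennreal s * 0" by (simp add: pairing_def)
    finally have "(\<integral>\<^sup>+p. indicator UNIV (\<psi> p) * indicator (- positive_fields) (\<Phi> p) \<partial>P) = 0"
      by (rule cancel)
    then have "(\<integral>\<^sup>+p. indicator (- positive_fields) (\<Phi> p) \<partial>P) = 0"
      by simp
    moreover have "(\<lambda>p. indicator (- positive_fields) (\<Phi> p) :: ennreal) \<in> borel_measurable P"
      using sets.compl_sets[OF sets_positive_fields]
      by (intro measurable_compose[OF \<Phi>] borel_measurable_indicator) (simp add: space_PiM Compl_eq_Diff_UNIV)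
    ultimately have "AE p in P. (indicator (- positive_fields) (\<Phi> p) :: ennreal) = 0"
      by (subst (asm) nn_integral_0_iff_AE)
    then show ?thesis by eventually_elim (auto split: split_indicator_asm)
  qed
  have K_meas: "K \<in> restrict_space field_space positive_fields \<rightarrow>\<^sub>M prob_algebra field_space"
  proof (rule measurable_prob_algebraI)
    show "prob_space (K L)" if "L \<in> space (restrict_space field_space positive_fields)" for L
      using that K_prob by (simp add: space_restrict_space)
    show "K \<in> restrict_space field_space positive_fields \<rightarrow>\<^sub>M subprob_algebra field_space"
    proof (rule measurable_subprob_algebra)
      fix L assume "L \<in> space (restrict_space field_space positive_fields)"
      then have L: "L \<in> positive_fields" by (simp add: space_restrict_space)
      show "subprob_space (K L)" by (rule prob_space_imp_subprob_space[OF K_prob[OF L]])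
      show "sets (K L) = sets field_space" by (rule K_sets[OF L])
    next
      fix A :: "('v \<Rightarrow> real) set" assume A [measurable]: "A \<in> sets field_space"
      have "(\<lambda>L. descent_mass z0 A L / spin_mass z0 L) \<in> borel_measurable (restrict_space field_space positive_fields)"
        by (rule measurable_restrict_space1) measurable
      then show "(\<lambda>L. emeasure (K L) A) \<in> borel_measurable (restrict_space field_space positive_fields)"
        by (rule measurable_cong[THEN iffD1, rotated]) (simp add: space_restrict_space K_eq[OF A])
    qed
  qed
  have cond: "AE p in P. real_cond_exp P (vimage_algebra (space P) \<Phi> field_space) (indicator (\<psi> -` A \<inter> space P)) p =
      measure (K (\<Phi> p)) A" if A [measurable]: "A \<in> sets field_space" for A
  proof -
    define F where "F = vimage_algebra (space P) \<Phi> field_space"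
    have \<Phi>F: "\<Phi> \<in> F \<rightarrow>\<^sub>M field_space"
      unfolding F_def by (rule measurable_vimage_algebra1) (auto simp: space_PiM)
    interpret finite_measure_subalgebra P F
    proof
      show "subalgebra P F"
        unfolding subalgebra_def F_def using measurable_sets[OF \<Phi>]
        by (auto simp: sets_vimage_algebra2 space_PiM)
    qed
    \<comment> \<open>a version of the conditional probability that is measurable on all fields\<close>
    define q where "q L = (if L \<in> positive_fields then enn2real (descent_mass z0 A L / spin_mass z0 L) else 0)" for L
    have q [measurable]: "q \<in> borel_measurable field_space"
      unfolding q_def[abs_def] by measurable
    have q_K: "q L = measure (K L) A" if "L \<in> positive_fields" for L
      using that by (simp add: q_def measure_def K_eq[OF A])
    have q_nonneg: "0 \<le> q L" and q_le: "q L \<le> 1" for L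
    proof -
      show "0 \<le> q L" by (simp add: q_def)
      show "q L \<le> 1"
        using q_K[of L] prob_space.prob_le_1[OF K_prob[of L], of A] by (cases "L \<in> positive_fields") (auto simp: q_def)
    qed
    have q_eq: "spin_mass z0 L * ennreal (q L) = descent_mass z0 A L" if "L \<in> positive_fields" for L
    proof -
      interpret KL: prob_space "K L" by (rule K_prob[OF that])
      show ?thesis using K_emeasure[OF that A] by (simp add: q_K[OF that] KL.emeasure_eq_measure)
    qed
    \<comment> \<open>the joint law tested with \<open>A\<close> and \<open>B\<close>, and with all fields and \<open>q\<close> on \<open>B\<close>\<close>
    have key: "(\<integral>\<^sup>+p. indicator A (\<psi> p) * indicator B (\<Phi> p) \<partial>P) = (\<integral>\<^sup>+p. ennreal (q (\<Phi> p)) * indicator B (\<Phi> p) \<partial>P)"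
      if B [measurable]: "B \<in> sets field_space" for B
    proof (rule cancel)
      have "ennreal s * (\<integral>\<^sup>+p. indicator A (\<psi> p) * indicator B (\<Phi> p) \<partial>P) =
          gff_const * pairing s (descent_mass z0 A) (indicator B)"
        by (rule joint) measurable
      also have "pairing s (descent_mass z0 A) (indicator B) =
          pairing s (descent_mass z0 UNIV) (\<lambda>L. ennreal (q L) * indicator B L)"
        by (rule pairing_cong) (simp add: mass q_eq[symmetric] mult.assoc)
      also have "gff_const * \<dots> = ennreal s * (\<integral>\<^sup>+p. indicator UNIV (\<psi> p) * (ennreal (q (\<Phi> p)) * indicator B (\<Phi> p)) \<partial>P)"
        by (rule joint[symmetric, OF UNIV_sets]) measurable
      finally show "ennreal s * (\<integral>\<^sup>+p. indicator A (\<psi> p) * indicator B (\<Phi> p) \<partial>P) =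
          ennreal s * (\<integral>\<^sup>+p. ennreal (q (\<Phi> p)) * indicator B (\<Phi> p) \<partial>P)" by simp
    qed
    have "AE p in P. real_cond_exp P F (indicator (\<psi> -` A \<inter> space P)) p = q (\<Phi> p)"
    proof (rule real_cond_exp_charact)
      have \<psi>A: "\<psi> -` A \<inter> space P \<in> sets P" by measurable
      show "integrable P (indicator (\<psi> -` A \<inter> space P) :: _ \<Rightarrow> real)"
        using \<psi>A by (simp add: P.emeasure_finite less_top[symmetric])
      show "integrable P (\<lambda>p. q (\<Phi> p))"
        by (rule P.integrable_const_bound[where B = 1]) (auto simp: q_nonneg q_le)
      show "(\<lambda>p. q (\<Phi> p)) \<in> borel_measurable F"
        by (rule measurable_compose[OF \<Phi>F q])
      fix S assume "S \<in> sets F"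
      then obtain B where B [measurable]: "B \<in> sets field_space" and S: "S = \<Phi> -` B \<inter> space P"
        by (auto simp: F_def sets_vimage_algebra2 space_PiM)
      have [measurable]: "S \<in> sets P" unfolding S by measurable
      have "(\<integral>p\<in>S. indicator (\<psi> -` A \<inter> space P) p \<partial>P) =
          enn2real (\<integral>\<^sup>+p. ennreal (indicator S p *\<^sub>R indicator (\<psi> -` A \<inter> space P) p) \<partial>P)"
        unfolding set_lebesgue_integral_def using \<psi>A by (intro integral_eq_nn_integral) auto
      also have "(\<integral>\<^sup>+p. ennreal (indicator S p *\<^sub>R indicator (\<psi> -` A \<inter> space P) p) \<partial>P) =
          (\<integral>\<^sup>+p. indicator A (\<psi> p) * indicator B (\<Phi> p) \<partial>P)"
        by (intro nn_integral_cong) (auto simp: S split: split_indicator)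
      also have "\<dots> = (\<integral>\<^sup>+p. ennreal (indicator S p *\<^sub>R q (\<Phi> p)) \<partial>P)"
        unfolding key[OF B] by (intro nn_integral_cong) (auto simp: S split: split_indicator)
      also have "enn2real \<dots> = (\<integral>p\<in>S. q (\<Phi> p) \<partial>P)"
        unfolding set_lebesgue_integral_def
        by (intro integral_eq_nn_integral[symmetric]) (auto simp: q_nonneg)
      finally show "(\<integral>p\<in>S. indicator (\<psi> -` A \<inter> space P) p \<partial>P) = (\<integral>p\<in>S. q (\<Phi> p) \<partial>P)" .
    qed
    with AE_D show ?thesis
      unfolding F_def by eventually_elim (simp add: q_K)
  qed
  show ?thesis
    unfolding conditional_law_given_def D P_def[symmetric] \<psi>_def[symmetric] \<Phi>_def[symmetric] K_def[symmetric]
    using \<psi> \<Phi> AE_D K_meas cond by blast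
qed

end
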